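(* Let $W$ be the affine Weyl group of type $\tilde B_2$ and let $u,w\in c_2$ with $u\le w$, $u\sim_R w$ and $u\not\sim_L w$. (i) If $\mathcal{R}(w)\not\subseteq\mathcal{R}(u)$, then $\mu(u,w)=1$ if $l(w)-l(u)=1$ and $0$ otherwise. (ii) If $\mathcal{R}(w)\subseteq\mathcal{R}(u)$, then $\mu(u,w)=1$ if $l(w)-l(u)=5$ and $0$ otherwise.
   Context: $W$ is the Coxeter group with simple reflections $S=\{r,s,t\}$ and relations $r^2=s^2=t^2=e$, $rt=tr$, $(rs)^4=(st)^4=e$; $l$ is the length and $\le$ the Bruhat order. $\mathcal{L}(w)=\{s'\in S\mid s'w<w\}$, $\mathcal{R}(w)=\{s'\in S\mid ws'<w\}$. $\sim_L,\sim_R$ are the Kazhdan–Lusztig left and right cell equivalences. $c_2=\{w\in W\mid a(w)=2\}$ for Lusztig's $a$-function; explicitly $c_2=\{u\,rt(srt)^m\,v\mid u\in\{e,s,ts,rs\},\ v\in\{e,s,st,sr\},\ m\in\mathbb{N}\}$. $P_{u,w}$ are the Kazhdan–Lusztig polynomials and, for $u\le w$, $\mu(u,w)$ is the coefficient of $q^{\frac12(l(w)-l(u)-1)}$ in $P_{u,w}$ (zero if the exponent is not an integer). *)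

theory Defs
  imports
    "HOL-Library.Poly_Mapping"
    "HOL-Library.Extended_Nat"
    "HOL-Computational_Algebra.Polynomial"
begin

section \<open>The Coxeter group of type affine B2\<close>

datatype gen = gen_r | gen_s | gen_t

text \<open>Every generator is an involution, so the group with the given presentation is the
  quotient of the free monoid of words by the congruence generated by the relations.\<close>

inductive relation :: "gen list \<Rightarrow> gen list \<Rightarrow> bool" where
  "relation [g, g] []"
| "relation [gen_r, gen_t] [gen_t, gen_r]"
| "relation [gen_r, gen_s, gen_r, gen_s, gen_r, gen_s, gen_r, gen_s] []"
| "relation [gen_s, gen_t, gen_s, gen_t, gen_s, gen_t, gen_s, gen_t] []"

inductive word_eq :: "gen list \<Rightarrow> gen list \<Rightarrow> bool" where
  weq_rel: "relation a b \<Longrightarrow> word_eq (xs @ a @ ys) (xs @ b @ ys)"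
| weq_refl: "word_eq xs xs"
| weq_sym: "word_eq xs ys \<Longrightarrow> word_eq ys xs"
| weq_trans: "word_eq xs ys \<Longrightarrow> word_eq ys zs \<Longrightarrow> word_eq xs zs"

lemma word_eq_equivp: "equivp word_eq"
  by (rule equivpI; auto intro!: reflpI sympI transpI intro: word_eq.intros)

lemma word_eq_context: "word_eq a b \<Longrightarrow> word_eq (xs @ a @ ys) (xs @ b @ ys)"
proof (induction rule: word_eq.induct)
  case (weq_rel a b us vs)
  then show ?case using word_eq.weq_rel[of a b "xs @ us" "vs @ ys"] by simp
qed (blast intro: word_eq.intros)+

lemma word_eq_append: "word_eq a b \<Longrightarrow> word_eq c d \<Longrightarrow> word_eq (a @ c) (b @ d)"
  using word_eq_context[of a b "[]" c] word_eq_context[of c d b "[]"]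
  by (auto intro: weq_trans)

lemma word_eq_rev_right: "word_eq (xs @ rev xs) []"
proof (induction xs)
  case Nil
  show ?case by (simp add: weq_refl)
next
  case (Cons g xs)
  have "word_eq ((g # xs) @ rev (g # xs)) [g, g]"
    using word_eq_context[OF Cons, of "[g]" "[g]"] by simp
  moreover have "word_eq [g, g] []"
    using weq_rel[OF relation.intros(1), of "[]" g "[]"] by simp
  ultimately show ?case by (rule weq_trans)
qed

lemma word_eq_rev:
  assumes "word_eq xs ys" shows "word_eq (rev xs) (rev ys)"
proof -
  have "word_eq (rev xs @ (ys @ rev ys)) (rev xs @ [])"
    by (intro word_eq_append weq_refl word_eq_rev_right)
  moreover have "word_eq ((rev xs @ xs) @ rev ys) ((rev xs @ ys) @ rev ys)"
    by (intro word_eq_append weq_refl assms)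
  moreover have "word_eq ((rev xs @ xs) @ rev ys) ([] @ rev ys)"
    using word_eq_rev_right[of "rev xs"] by (intro word_eq_append weq_refl) simp
  ultimately show ?thesis
    by (metis append_Nil append_Nil2 append_assoc weq_sym weq_trans)
qed

quotient_type W = "gen list" / word_eq
  by (rule word_eq_equivp)

instantiation W :: monoid_mult
begin

lift_definition one_W :: W is "[]" .

lift_definition times_W :: "W \<Rightarrow> W \<Rightarrow> W" is "(@)"
  by (rule word_eq_append)

instance
  by standard (transfer; simp add: weq_refl)+

end

lift_definition winv :: "W \<Rightarrow> W" is rev
  by (rule word_eq_rev)

lemma winv_right: "w * winv w = 1" and winv_left: "winv w * w = 1"
  by (transfer; use word_eq_rev_right in \<open>metis rev_rev_ident\<close>)+

lift_definition sref :: "gen \<Rightarrow> W" is "\<lambda>g. [g]" .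

definition simple_refls :: "W set" where
  "simple_refls = range sref"

definition word_val :: "gen list \<Rightarrow> W" where
  "word_val ws = prod_list (map sref ws)"

definition len :: "W \<Rightarrow> nat" where
  "len w = (LEAST n. \<exists>ws. length ws = n \<and> word_val ws = w)"

definition reflections :: "W set" where
  "reflections = {x * s * winv x |x s. s \<in> simple_refls}"

definition bruhat_le :: "W \<Rightarrow> W \<Rightarrow> bool" (infix \<open>\<le>\<^sub>B\<close> 50) where
  "bruhat_le = (\<lambda>x y. len x < len y \<and> (\<exists>t \<in> reflections. y = x * t))\<^sup>*\<^sup>*"

definition bruhat_less :: "W \<Rightarrow> W \<Rightarrow> bool" (infix \<open><\<^sub>B\<close> 50) where
  "x <\<^sub>B y \<longleftrightarrow> x \<le>\<^sub>B y \<and> x \<noteq> y"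

definition left_descents :: "W \<Rightarrow> W set" where
  "left_descents w = {s \<in> simple_refls. s * w <\<^sub>B w}"

definition right_descents :: "W \<Rightarrow> W set" where
  "right_descents w = {s \<in> simple_refls. w * s <\<^sub>B w}"


section \<open>The Hecke algebra\<close>

text \<open>Laurent polynomials over the integers in the variable v = q^(1/2), with the product
  of the group algebra of the additive group of exponents.\<close>

type_synonym laurent = "int \<Rightarrow>\<^sub>0 int"

abbreviation vpow :: "int \<Rightarrow> laurent" where
  "vpow i \<equiv> Poly_Mapping.single i 1"

abbreviation qvar :: laurent where
  "qvar \<equiv> vpow 2"

definition laurent_bar :: "laurent \<Rightarrow> laurent" where
  "laurent_bar = Poly_Mapping.map_key uminus"

text \<open>The free module on the symbols T_w; its product is defined below.\<close>

type_synonym hecke = "W \<Rightarrow>\<^sub>0 laurent"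

abbreviation T_basis :: "W \<Rightarrow> hecke" where
  "T_basis w \<equiv> Poly_Mapping.single w 1"

definition hscale :: "laurent \<Rightarrow> hecke \<Rightarrow> hecke" where
  "hscale c h = Poly_Mapping.map ((*) c) h"

text \<open>The linear extension of T_w \<open>\<mapsto>\<close> f w.\<close>

definition hlin :: "(W \<Rightarrow> hecke) \<Rightarrow> hecke \<Rightarrow> hecke" where
  "hlin f h = (\<Sum>w \<in> Poly_Mapping.keys h. hscale (Poly_Mapping.lookup h w) (f w))"

definition gen_mult :: "gen \<Rightarrow> hecke \<Rightarrow> hecke" where
  "gen_mult g = hlin (\<lambda>w. if len w < len (sref g * w) then T_basis (sref g * w)
     else hscale (qvar - 1) (T_basis w) + hscale qvar (T_basis (sref g * w)))"

definition reduced_word :: "W \<Rightarrow> gen list" where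
  "reduced_word w = (SOME ws. word_val ws = w \<and> length ws = len w)"

text \<open>T_x acts as the composite of the actions of the generators along any reduced
  word for x.\<close>

definition hmult :: "hecke \<Rightarrow> hecke \<Rightarrow> hecke" (infixl \<open>\<odot>\<close> 70) where
  "h \<odot> k = hlin (\<lambda>x. foldr gen_mult (reduced_word x) k) h"

definition hinverse :: "hecke \<Rightarrow> hecke" where
  "hinverse h = (THE k. h \<odot> k = T_basis 1 \<and> k \<odot> h = T_basis 1)"

definition hbar :: "hecke \<Rightarrow> hecke" where
  "hbar h = (\<Sum>w \<in> Poly_Mapping.keys h.
     hscale (laurent_bar (Poly_Mapping.lookup h w)) (hinverse (T_basis (winv w))))"


section \<open>Kazhdan-Lusztig polynomials\<close>

text \<open>The element q^(-l(w)/2) * (sum over y \<open>\<le>\<close> w of p_y(q) T_y), for an integer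
  polynomial p_y in q for each y.\<close>

definition kl_element :: "W \<Rightarrow> (W \<Rightarrow> int poly) \<Rightarrow> hecke" where
  "kl_element w p = hscale (vpow (- int (len w)))
     (\<Sum>y | y \<le>\<^sub>B w. hscale (poly (map_poly of_int (p y)) qvar) (T_basis y))"

definition is_kl_family :: "W \<Rightarrow> (W \<Rightarrow> int poly) \<Rightarrow> bool" where
  "is_kl_family w p \<longleftrightarrow>
     p w = 1 \<and>
     (\<forall>y. y <\<^sub>B w \<longrightarrow> 2 * degree (p y) + 1 \<le> len w - len y) \<and>
     (\<forall>y. \<not> y \<le>\<^sub>B w \<longrightarrow> p y = 0) \<and>
     hbar (kl_element w p) = kl_element w p"

definition kl_poly :: "W \<Rightarrow> W \<Rightarrow> int poly" where
  "kl_poly y w = (THE p. is_kl_family w p) y"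

definition kl_basis :: "W \<Rightarrow> hecke" where
  "kl_basis w = kl_element w (\<lambda>y. kl_poly y w)"

definition mu :: "W \<Rightarrow> W \<Rightarrow> int" where
  "mu u w = (if odd (len w - len u)
     then poly.coeff (kl_poly u w) ((len w - len u - 1) div 2) else 0)"


section \<open>Cells\<close>

definition joined :: "W \<Rightarrow> W \<Rightarrow> bool" where
  "joined x y \<longleftrightarrow> (x <\<^sub>B y \<and> mu x y \<noteq> 0) \<or> (y <\<^sub>B x \<and> mu y x \<noteq> 0)"

definition cell_le_L :: "W \<Rightarrow> W \<Rightarrow> bool" (infix \<open>\<le>\<^sub>L\<close> 50) where
  "cell_le_L = (\<lambda>x y. joined x y \<and> \<not> left_descents x \<subseteq> left_descents y)\<^sup>*\<^sup>*"

definition cell_le_R :: "W \<Rightarrow> W \<Rightarrow> bool" (infix \<open>\<le>\<^sub>R\<close> 50) where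
  "x \<le>\<^sub>R y \<longleftrightarrow> winv x \<le>\<^sub>L winv y"

definition cell_eq_L :: "W \<Rightarrow> W \<Rightarrow> bool" (infix \<open>\<sim>\<^sub>L\<close> 50) where
  "x \<sim>\<^sub>L y \<longleftrightarrow> x \<le>\<^sub>L y \<and> y \<le>\<^sub>L x"

definition cell_eq_R :: "W \<Rightarrow> W \<Rightarrow> bool" (infix \<open>\<sim>\<^sub>R\<close> 50) where
  "x \<sim>\<^sub>R y \<longleftrightarrow> x \<le>\<^sub>R y \<and> y \<le>\<^sub>R x"


section \<open>Lusztig's a-function\<close>

text \<open>The structure constants h_(x,y,z) of the Kazhdan-Lusztig basis:
  C_x C_y = sum over z of h_(x,y,z) C_z.\<close>

definition struct_const :: "W \<Rightarrow> W \<Rightarrow> W \<Rightarrow> laurent" where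
  "struct_const x y = Poly_Mapping.lookup
     (THE c. kl_basis x \<odot> kl_basis y = hlin kl_basis c)"

text \<open>a(z) is the least i such that every v^(-i) h_(x,y,z) is a polynomial in
  v^(-1), and infinity if there is no such i.\<close>

definition a_fun :: "W \<Rightarrow> enat" where
  "a_fun z = Inf (enat ` {i. \<forall>x y. \<forall>k \<in> Poly_Mapping.keys (struct_const x y z). k \<le> int i})"

definition c2 :: "W set" where
  "c2 = {w. a_fun w = 2}"

end

theory Submission
  imports Defs
begin

text \<open>If some generator s shortens w but not u from one side, then \<open>\<mu>(u, w)\<close> is 1 or 0 according to
  whether w is the product of u and s. This is (i), with the lifting property of the Bruhat order.

  For (ii), membership in \<open>c\<^sub>2\<close> is only used to exclude the elements \<open>a w\<^sub>0 b\<close> (lengths adding up) with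
  \<open>w\<^sub>0\<close> the longest element of a dihedral parabolic subgroup of order 8: the coefficient of
  \<open>C(a w\<^sub>0 b)\<close> in the product of \<open>C(a w\<^sub>0)\<close> and \<open>C(w\<^sub>0 b)\<close> has degree 4 in v. Among the remaining,
  braid-free elements, those with a unique reduced word form unions of cells, and in both classes
  elements of the same right cell with the same right descents lie in the same left cell. Therefore
  \<open>u\<^sup>-\<^sup>1\<close> starts with rt and \<open>w\<^sup>-\<^sup>1 = p s y\<close>, where y starts with rt and p is r or t. The star operation for
  the dihedral group generated by p and s gives \<open>\<mu>(u\<^sup>-\<^sup>1, p s y) = \<mu>(p s u\<^sup>-\<^sup>1, y)\<close>, and the other one
  of r and t is a left descent of y only, so this is 1 if \<open>y = r t s u\<^sup>-\<^sup>1\<close> and 0 otherwise.\<close>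


section \<open>Length, strong exchange and Bruhat order\<close>

text \<open>The 5 is 2 + 3: two letters lead from y to p s y, and three from u^-1 to r t s u^-1.
  That this difference conversely gives y = r t s u^-1 is a matter of rigidity. A braid-free element
  starting with rt is (rts)^m b with four possible b, and b can be read off from the right descents.
  These are constant on left cells, hence equal for u^-1 and y, and lengths then fix the exponents.
  The a-function speaks about all structure constants, and these, like the inverses and polynomials
  behind them, are given by unique descriptions. So associativity, the bar involution and the
  existence and uniqueness of the basis come before any evaluation. From a(z) = 2 only the degree
  bound 2 at z is extracted, to be contradicted by the 4, which is the length of the longest element
  of the dihedral group. All coefficients are normalised so that \<mu> is the coefficient of v^-1;
  facts about descents and \<mu> then become comparisons of Laurent coefficients.\<close>

lemma word_val_Nil [simp]: "word_val [] = 1"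
  and word_val_Cons [simp]: "word_val (g # ws) = sref g * word_val ws"
  and word_val_append [simp]: "word_val (xs @ ys) = word_val xs * word_val ys"
  by (auto simp: word_val_def)

lemma word_val_eq_abs_W: "word_val ws = abs_W ws"
proof (induction ws)
  case (Cons g ws)
  have "sref g * abs_W ws = abs_W ([g] @ ws)"
    by (simp add: sref_def times_W.abs_eq)
  with Cons show ?case by simp
qed (simp add: one_W_def)

lemma ex_word_val: "\<exists>ws. word_val ws = w"
  by (induction w rule: W.abs_induct) (auto simp: word_val_eq_abs_W)

lemma word_val_eq_iff: "word_val xs = word_val ys \<longleftrightarrow> word_eq xs ys"
  by (simp add: word_val_eq_abs_W W.abs_eq_iff)

lemma sref_sref [simp]: "sref g * sref g = 1"
proof -
  have "word_val [g, g] = word_val []"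
    unfolding word_val_eq_iff using weq_rel[OF relation.intros(1), of "[]" g "[]"] by simp
  then show ?thesis by simp
qed

lemma sref_sref_left [simp]: "sref g * (sref g * x) = x"
  by (simp flip: mult.assoc)

lemma sref_r_t: "sref gen_r * sref gen_t = sref gen_t * sref gen_r"
proof -
  have "word_val [gen_r, gen_t] = word_val [gen_t, gen_r]"
    unfolding word_val_eq_iff using weq_rel[OF relation.intros(2), of "[]" "[]"] by simp
  then show ?thesis by simp
qed

lemma winv_cancel [simp]:
  "w * winv w = 1" "winv w * w = 1" "w * (winv w * x) = x" "winv w * (w * x) = x"
  by (simp_all add: winv_left winv_right flip: mult.assoc)

lemma W_left_cancel [simp]: "(a :: W) * x = a * y \<longleftrightarrow> x = y"
  by (metis winv_cancel(4))

lemma W_right_cancel [simp]: "(x :: W) * a = y * a \<longleftrightarrow> x = y"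
  by (metis winv_cancel(1) mult.assoc mult_1_right)

lemma winv_unique: "a * b = 1 \<Longrightarrow> winv a = b"
  by (metis W_left_cancel winv_right)

lemma winv_winv [simp]: "winv (winv w) = w"
  by (rule winv_unique) simp

lemma winv_mult [simp]: "winv (a * b) = winv b * winv a"
  by (rule winv_unique) (simp add: mult.assoc)

lemma winv_one [simp]: "winv 1 = 1"
  by (rule winv_unique) simp

lemma winv_sref [simp]: "winv (sref g) = sref g"
  by (rule winv_unique) simp

lemma winv_eq_one [simp]: "winv a = 1 \<longleftrightarrow> a = 1"
  by (metis winv_winv winv_one)

lemma sref_mult_eq_iff: "sref g * x = y \<longleftrightarrow> x = sref g * y"
  by auto

lemma mult_sref_eq_iff: "x * sref g = y \<longleftrightarrow> x = y * sref g"
  by (metis mult.assoc sref_sref mult_1_right)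

lemma mult_sref_sref [simp]: "x * sref g * sref g = x"
  by (simp add: mult.assoc)

lemma winv_word_val: "winv (word_val ws) = word_val (rev ws)"
  by (induction ws) auto


section \<open>Parity invariants of words: length and crossed reflections\<close>

lemma word_eq_parity: "word_eq xs ys \<Longrightarrow> even (length xs) = even (length ys)"
  by (induction rule: word_eq.induct) (auto elim!: relation.cases)

lift_definition even_elt :: "W \<Rightarrow> bool" is "\<lambda>ws. even (length ws)"
  by (rule word_eq_parity)

lemma even_elt_word_val: "even_elt (word_val ws) \<longleftrightarrow> even (length ws)"
  unfolding word_val_eq_abs_W by (simp add: even_elt.abs_eq)

text \<open>For a word \<open>g\<^sub>1 \<dots> g\<^sub>n\<close> this is the parity of the number of indices j for which x is the
  reflection \<open>g\<^sub>1 \<dots> g\<^sub>j \<dots> g\<^sub>1\<close>. It depends only on the value of the word, and it is odd for a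
  reflection x exactly if x shortens that value from the left; this is the strong exchange condition.\<close>

fun word_crosses :: "gen list \<Rightarrow> W \<Rightarrow> bool" where
  "word_crosses [] x \<longleftrightarrow> False"
| "word_crosses (g # ws) x \<longleftrightarrow> (x = sref g) \<noteq> word_crosses ws (sref g * x * sref g)"

lemma word_crosses_append:
  "word_crosses (xs @ ys) x \<longleftrightarrow>
     word_crosses xs x \<noteq> word_crosses ys (winv (word_val xs) * x * word_val xs)"
  by (induction xs arbitrary: x) (auto simp: mult.assoc)

lemma dihedral_relation:
  assumes "relation [g, h, g, h, g, h, g, h] []"
  shows "sref g * (sref h * (sref g * (sref h * (sref g * (sref h * (sref g * (sref h * x))))))) = x"
proof -
  have "word_val [g, h, g, h, g, h, g, h] = word_val []"
    unfolding word_val_eq_iff using weq_rel[OF assms, of "[]" "[]"] by simp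
  then have "word_val [g, h, g, h, g, h, g, h] * x = word_val [] * x" by simp
  then show ?thesis by (simp add: mult.assoc)
qed

text \<open>The j-th and the (j+4)-th of the eight reflections coincide by the relation, so every x
  is counted an even number of times.\<close>

lemma word_crosses_dihedral:
  assumes "relation [g, h, g, h, g, h, g, h] []"
  shows "\<not> word_crosses [g, h, g, h, g, h, g, h] x"
proof -
  let ?g = "sref g" and ?h = "sref h"
  note rel = dihedral_relation[OF assms]
  have "word_crosses [g, h, g, h, g, h, g, h] x \<longleftrightarrow>
      (x = ?g) \<noteq> ((x = ?g * ?h * ?g) \<noteq> ((x = ?g * (?h * ?g * ?h) * ?g) \<noteq>
      ((x = ?g * (?h * (?g * ?h * ?g) * ?h) * ?g) \<noteq>
      ((x = ?g * (?h * (?g * (?h * ?g * ?h) * ?g) * ?h) * ?g) \<noteq>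
      ((x = ?g * (?h * (?g * (?h * (?g * ?h * ?g) * ?h) * ?g) * ?h) * ?g) \<noteq>
      ((x = ?g * (?h * (?g * (?h * (?g * (?h * ?g * ?h) * ?g) * ?h) * ?g) * ?h) * ?g) \<noteq>
      (x = ?g * (?h * (?g * (?h * (?g * (?h * (?g * ?h * ?g) * ?h) * ?g) * ?h) * ?g) * ?h) * ?g)))))))"
    by (simp add: mult_sref_eq_iff sref_mult_eq_iff) (simp add: mult.assoc)
  then show ?thesis by (simp only: mult.assoc rel) blast
qed

lemma relation_crosses: "relation a b \<Longrightarrow> word_crosses a x = word_crosses b x"
proof (induction rule: relation.induct)
  case (1 g)
  show ?case by (auto simp: sref_mult_eq_iff mult_sref_eq_iff)
next
  case 2
  have "sref gen_r * x * sref gen_r = sref gen_t \<longleftrightarrow> x = sref gen_t"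
    by (metis mult_sref_eq_iff sref_mult_eq_iff sref_r_t)
  moreover have "sref gen_t * x * sref gen_t = sref gen_r \<longleftrightarrow> x = sref gen_r"
    by (metis mult_sref_eq_iff sref_mult_eq_iff sref_r_t)
  ultimately show ?case by auto
qed (simp_all only: word_crosses_dihedral relation.intros word_crosses.simps(1) simp_thms)

lemma word_eq_crosses: "word_eq xs ys \<Longrightarrow> word_crosses xs x = word_crosses ys x"
proof (induction arbitrary: x rule: word_eq.induct)
  case (weq_rel a b us vs)
  have "word_val a = word_val b"
    unfolding word_val_eq_iff using word_eq.weq_rel[OF weq_rel, of "[]" "[]"] by simp
  then show ?case using weq_rel by (simp add: word_crosses_append relation_crosses)
qed auto

lift_definition crosses :: "W \<Rightarrow> W \<Rightarrow> bool" is word_crosses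
  by (rule ext) (rule word_eq_crosses)

lemma crosses_word_val: "crosses (word_val ws) x \<longleftrightarrow> word_crosses ws x"
  unfolding word_val_eq_abs_W by (simp add: crosses.abs_eq)

lemma crosses_mult: "crosses (a * b) x \<longleftrightarrow> crosses a x \<noteq> crosses b (winv a * x * a)"
proof -
  obtain xs ys where "a = word_val xs" "b = word_val ys" using ex_word_val by metis
  then show ?thesis
    by (simp add: crosses_word_val word_crosses_append flip: word_val_append)
qed

lemma crosses_one [simp]: "\<not> crosses 1 x"
  using crosses_word_val[of "[]"] by simp

lemma crosses_sref [simp]: "crosses (sref g) x \<longleftrightarrow> x = sref g"
  using crosses_word_val[of "[g]"] by simp

lemma reflection_cases:
  assumes "t \<in> reflections" obtains x g where "t = x * sref g * winv x"
  using assms by (auto simp: reflections_def simple_refls_def)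

lemma reflection_involution [simp]:
  assumes "t \<in> reflections" shows "t * t = 1" and "t * (t * x) = x" and "winv t = t"
proof -
  show *: "t * t = 1" using assms by (elim reflection_cases) (simp add: mult.assoc)
  then show "t * (t * x) = x" by (simp flip: mult.assoc)
  show "winv t = t" using * by (rule winv_unique)
qed

lemma sref_reflection [simp]: "sref g \<in> reflections"
  unfolding reflections_def simple_refls_def
  by (intro CollectI exI[of _ 1] exI[of _ "sref g"]) simp

lemma reflection_conj:
  assumes "t \<in> reflections" shows "a * t * winv a \<in> reflections"
proof -
  obtain x g where "t = x * sref g * winv x" using assms by (rule reflection_cases)
  then have "a * t * winv a = (a * x) * sref g * winv (a * x)" by (simp add: mult.assoc)
  then show ?thesis unfolding reflections_def simple_refls_def by blast
qed

text \<open>For t = x g x^-1 the contributions of x and x^-1 to the count cancel, and the middle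
  letter leaves exactly one.\<close>

lemma crosses_self:
  assumes "t \<in> reflections" shows "crosses t t"
proof -
  obtain x g where t: "t = x * sref g * winv x" using assms by (rule reflection_cases)
  have conj: "winv x * t * x = sref g" by (simp add: t mult.assoc)
  have "crosses t t \<longleftrightarrow> crosses x t \<noteq> (True \<noteq> crosses (winv x) (sref g * sref g * sref g))"
    by (subst (1) t) (simp only: mult.assoc crosses_mult conj[unfolded mult.assoc] crosses_sref winv_sref simp_thms)
  also have "crosses (winv x) (sref g * sref g * sref g) \<longleftrightarrow> crosses x t"
    using crosses_mult[of x "winv x" t] by (simp add: conj)
  finally show ?thesis by auto
qed


section \<open>Length and the exchange condition\<close>

lemma len_le_length: "len (word_val ws) \<le> length ws"
  unfolding len_def by (rule Least_le) auto

lemma reduced_word: "word_val (reduced_word w) = w" "length (reduced_word w) = len w"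
proof -
  have "\<exists>ws. word_val ws = w \<and> length ws = len w"
    unfolding len_def by (rule LeastI2_ex) (use ex_word_val in auto)
  from someI_ex[OF this]
  show "word_val (reduced_word w) = w" "length (reduced_word w) = len w"
    unfolding reduced_word_def by auto
qed

lemma ex_minimal_word: obtains ws where "word_val ws = w" "length ws = len w"
  using reduced_word by blast

lemma len_one [simp]: "len 1 = 0"
  using len_le_length[of "[]"] by simp

lemma len_eq_0 [simp]: "len w = 0 \<longleftrightarrow> w = 1"
  by (metis len_one length_0_conv reduced_word word_val_Nil)

lemma len_mult_le: "len (a * b) \<le> len a + len b"
  by (metis len_le_length length_append reduced_word word_val_append)

lemma len_winv [simp]: "len (winv w) = len w"
proof -
  have "len (winv w) \<le> len w" for w
    by (metis len_le_length length_rev reduced_word winv_word_val)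
  from this[of w] this[of "winv w"] show ?thesis by simp
qed

lemma even_elt_mult: "even_elt (a * b) \<longleftrightarrow> even_elt a = even_elt b"
proof -
  obtain xs ys where "a = word_val xs" "b = word_val ys" using ex_word_val by metis
  then show ?thesis by (simp add: even_elt_word_val flip: word_val_append)
qed

lemma even_elt_iff: "even_elt w \<longleftrightarrow> even (len w)"
  by (metis even_elt_word_val reduced_word)

lemma even_len_mult: "even (len (a * b)) \<longleftrightarrow> even (len a) = even (len b)"
  using even_elt_mult by (simp add: even_elt_iff)

lemma not_even_elt_sref [simp]: "\<not> even_elt (sref g)"
  using even_elt_word_val[of "[g]"] by simp

lemma len_sref [simp]: "len (sref g) = 1"
proof -
  have "len (sref g) \<le> 1" using len_le_length[of "[g]"] by simp
  moreover have "odd (len (sref g))" using not_even_elt_sref by (simp add: even_elt_iff)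
  ultimately show ?thesis by (metis le_antisym odd_pos One_nat_def Suc_leI)
qed

lemma odd_reflection: "t \<in> reflections \<Longrightarrow> odd (len t)"
  by (elim reflection_cases) (simp add: even_len_mult)

lemma even_len_sref: "even (len (sref g * w)) \<longleftrightarrow> odd (len w)" "even (len (w * sref g)) \<longleftrightarrow> odd (len w)"
  by (simp_all add: even_len_mult)

lemma even_len_reflection:
  "t \<in> reflections \<Longrightarrow> even (len (t * w)) \<longleftrightarrow> odd (len w)"
  "t \<in> reflections \<Longrightarrow> even (len (w * t)) \<longleftrightarrow> odd (len w)"
  by (simp_all add: even_len_mult odd_reflection)

lemma len_sref_cases: "len (sref g * w) = len w + 1 \<or> len w = len (sref g * w) + 1"
proof -
  have "len (sref g * w) \<le> len w + 1" using len_mult_le[of "sref g" w] by simp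
  moreover have "len w \<le> len (sref g * w) + 1" using len_mult_le[of "sref g" "sref g * w"] by simp
  moreover have "len (sref g * w) \<noteq> len w" using even_len_sref(1)[of g w] by metis
  ultimately show ?thesis by linarith
qed

lemma len_sref_cases_right: "len (w * sref g) = len w + 1 \<or> len w = len (w * sref g) + 1"
  using len_sref_cases[of g "winv w"] len_winv[of "w * sref g"] by simp

lemma len_sref_less: "len (sref g * w) < len w \<longleftrightarrow> len w = len (sref g * w) + 1"
  "len w < len (sref g * w) \<longleftrightarrow> len (sref g * w) = len w + 1"
  "\<not> len (sref g * w) < len w \<longleftrightarrow> len w < len (sref g * w)"
  using len_sref_cases[of g w] by auto

lemma len_sref_less_right: "len (w * sref g) < len w \<longleftrightarrow> len w = len (w * sref g) + 1"
  "len w < len (w * sref g) \<longleftrightarrow> len (w * sref g) = len w + 1"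
  "\<not> len (w * sref g) < len w \<longleftrightarrow> len w < len (w * sref g)"
  using len_sref_cases_right[of w g] by auto

text \<open>An odd count is positive, so t = g_1 ... g_j ... g_1 for some j, and multiplying the
  word by this t from the left deletes its j-th letter.\<close>

lemma word_crosses_deletion:
  "word_crosses ws t \<Longrightarrow> \<exists>xs g ys. ws = xs @ g # ys \<and> t * word_val ws = word_val (xs @ ys)"
proof (induction ws arbitrary: t)
  case (Cons g ws)
  show ?case
  proof (cases "t = sref g")
    case True
    then show ?thesis by (intro exI[of _ "[]"]) simp
  next
    case False
    then have "word_crosses ws (sref g * t * sref g)" using Cons.prems by simp
    then obtain xs h ys where *: "ws = xs @ h # ys"
      "sref g * t * sref g * word_val ws = word_val (xs @ ys)" using Cons.IH by blast
    have "t * word_val (g # ws) = sref g * (sref g * t * sref g * word_val ws)"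
      by (simp add: mult.assoc)
    also have "\<dots> = word_val ((g # xs) @ ys)" by (simp only: *(2) append_Cons word_val_Cons)
    finally show ?thesis using *(1) by (intro exI[of _ "g # xs"]) auto
  qed
qed simp

lemma crosses_imp_len_less:
  assumes "crosses w t" shows "len (t * w) < len w"
proof -
  obtain ws where ws: "word_val ws = w" "length ws = len w" by (rule ex_minimal_word)
  with assms have "word_crosses ws t" by (metis crosses_word_val)
  then obtain xs g ys where "ws = xs @ g # ys" "t * word_val ws = word_val (xs @ ys)"
    using word_crosses_deletion by blast
  then show ?thesis using ws len_le_length[of "xs @ ys"] by simp
qed

text \<open>A reflection t crosses exactly one of w and t w, by \<open>crosses_mult\<close> and
  \<open>crosses_self\<close>. If it crossed a shorter t w, deletion would make w shorter than t
  w.\<close>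

lemma crosses_iff:
  assumes "t \<in> reflections" shows "crosses w t \<longleftrightarrow> len (t * w) < len w"
proof
  assume less: "len (t * w) < len w"
  show "crosses w t"
  proof (rule ccontr)
    assume "\<not> crosses w t"
    then have "crosses (t * w) t"
      using crosses_mult[of t w t] crosses_self[OF assms] assms by simp
    from crosses_imp_len_less[OF this] show False using less assms by simp
  qed
qed (rule crosses_imp_len_less)

lemma strong_exchange:
  assumes "t \<in> reflections" and "len (t * word_val ws) < len (word_val ws)"
  shows "\<exists>xs g ys. ws = xs @ g # ys \<and> t * word_val ws = word_val (xs @ ys)"
  by (rule word_crosses_deletion) (use assms in \<open>simp add: crosses_iff flip: crosses_word_val\<close>)

lemma strong_exchange_right:
  assumes "t \<in> reflections" and "len (word_val ws * t) < len (word_val ws)"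
  shows "\<exists>xs g ys. ws = xs @ g # ys \<and> word_val ws * t = word_val (xs @ ys)"
  using strong_exchange[OF reflection_conj[OF assms(1), of "word_val ws"], of ws] assms(2)
  by (simp add: mult.assoc)

text \<open>The length condition behind the commutation of the left and right actions of the
  generators on the Hecke algebra.\<close>

lemma mult_sref_eq_sref_mult_up:
  assumes "len w < len (sref g * w)" "len (sref g * w * sref h) = len w"
  and "len (sref g * w) = len (w * sref h)"
  shows "sref g * w = w * sref h"
proof -
  obtain ws where ws: "word_val ws = w" "length ws = len w" by (rule ex_minimal_word)
  have "len (word_val (g # ws) * sref h) < len (word_val (g # ws))"
    using assms ws by simp
  then obtain xs k ys where del: "g # ws = xs @ k # ys"
    "word_val (g # ws) * sref h = word_val (xs @ ys)"
    using strong_exchange_right sref_reflection by blast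
  show ?thesis
  proof (cases xs)
    case Nil
    with del ws have "sref g * w * sref h = w" by simp
    then show ?thesis by (simp add: mult_sref_eq_iff)
  next
    case (Cons g' zs)
    with del ws have "ws = zs @ k # ys" "w * sref h = word_val (zs @ ys)"
      by (auto simp: mult.assoc)
    then have "len (w * sref h) < len w" using len_le_length[of "zs @ ys"] ws(2) by simp
    then show ?thesis using assms by simp
  qed
qed

lemma mult_sref_eq_sref_mult:
  assumes "len (sref g * w * sref h) = len w" "len (sref g * w) = len (w * sref h)"
  shows "sref g * w = w * sref h"
proof (cases "len w < len (sref g * w)")
  case True
  then show ?thesis using assms by (rule mult_sref_eq_sref_mult_up)
next
  case False
  have "sref g * (sref g * w) = sref g * w * sref h"
    by (rule mult_sref_eq_sref_mult_up) (use False len_sref_cases[of g w] assms in auto)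
  then show ?thesis by (metis sref_mult_eq_iff mult.assoc)
qed

lemma finite_len_le: "finite {w. len w \<le> n}"
proof (rule finite_subset)
  show "{w. len w \<le> n} \<subseteq> word_val ` {ws. set ws \<subseteq> {gen_r, gen_s, gen_t} \<and> length ws \<le> n}"
  proof
    fix w assume "w \<in> {w. len w \<le> n}"
    moreover have "set (reduced_word w) \<subseteq> {gen_r, gen_s, gen_t}"
      using gen.exhaust by (intro subsetI) blast
    ultimately show "w \<in> word_val ` {ws. set ws \<subseteq> {gen_r, gen_s, gen_t} \<and> length ws \<le> n}"
      using reduced_word[of w] by (intro image_eqI[of _ _ "reduced_word w"]) auto
  qed
  show "finite (word_val ` {ws. set ws \<subseteq> {gen_r, gen_s, gen_t} \<and> length ws \<le> n})"
    by (intro finite_imageI finite_lists_length_le) simp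
qed


section \<open>Bruhat order and the lifting property\<close>

lemma bruhat_le_refl [simp]: "w \<le>\<^sub>B w"
  by (simp add: bruhat_le_def)

lemma bruhat_le_trans: "x \<le>\<^sub>B y \<Longrightarrow> y \<le>\<^sub>B z \<Longrightarrow> x \<le>\<^sub>B z"
  by (simp add: bruhat_le_def)

lemma bruhat_le_induct [consumes 1, case_names refl step]:
  assumes "a \<le>\<^sub>B b" and "P a"
    and "\<And>x t. a \<le>\<^sub>B x \<Longrightarrow> P x \<Longrightarrow> t \<in> reflections \<Longrightarrow> len x < len (x * t) \<Longrightarrow> P (x * t)"
  shows "P b"
  using assms(1,2) unfolding bruhat_le_def
  by (induction rule: rtranclp_induct) (auto intro: assms(3) simp: bruhat_le_def)

lemma bruhat_le_converse_induct [consumes 1, case_names refl step]: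
  assumes "a \<le>\<^sub>B b" and "P b"
    and "\<And>x t. x * t \<le>\<^sub>B b \<Longrightarrow> P (x * t) \<Longrightarrow> t \<in> reflections \<Longrightarrow> len x < len (x * t) \<Longrightarrow> P x"
  shows "P a"
  using assms(1,2) unfolding bruhat_le_def
  by (induction rule: converse_rtranclp_induct) (auto intro: assms(3) simp: bruhat_le_def)

lemma bruhat_edge: "len x < len (x * t) \<Longrightarrow> t \<in> reflections \<Longrightarrow> x \<le>\<^sub>B x * t"
  unfolding bruhat_le_def by (rule r_into_rtranclp) auto

lemma bruhat_edge_left: "len x < len (t * x) \<Longrightarrow> t \<in> reflections \<Longrightarrow> x \<le>\<^sub>B t * x"
  using bruhat_edge[of x "winv x * t * x"] reflection_conj[of t "winv x"] by (simp flip: mult.assoc)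

lemma bruhat_le_len: "x \<le>\<^sub>B y \<Longrightarrow> x = y \<or> len x < len y"
  by (induction rule: bruhat_le_induct) auto

lemma bruhat_less_len: "x <\<^sub>B y \<Longrightarrow> len x < len y"
  using bruhat_le_len by (auto simp: bruhat_less_def)

lemma bruhat_less_iff: "x <\<^sub>B y \<longleftrightarrow> x \<le>\<^sub>B y \<and> len x < len y"
  using bruhat_le_len by (auto simp: bruhat_less_def)

lemma finite_bruhat_le: "finite {x. x \<le>\<^sub>B w}"
  by (rule finite_subset[OF _ finite_len_le[of "len w"]]) (auto dest: bruhat_le_len)

lemma bruhat_le_winv: "x \<le>\<^sub>B y \<Longrightarrow> winv x \<le>\<^sub>B winv y"
proof (induction rule: bruhat_le_induct)
  case (step y t)
  have "winv y \<le>\<^sub>B t * winv y"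
    by (rule bruhat_edge_left) (use step len_winv[of "y * t"] in auto)
  then show ?case using bruhat_le_trans[OF step.IH] step by simp
qed simp

text \<open>If both alternatives failed, the lengths would be forced: g x t would be as long as x,
  and g x and x t longer by one. Deleting a letter from a reduced word of x t that starts with g
  then gives either x = g x t or a word for g x that is too short.\<close>

lemma bruhat_sref_edge:
  assumes "t \<in> reflections" "len x < len (x * t)"
  shows "sref g * x = x * t \<or> len (sref g * x) < len (sref g * x * t)"
proof (rule ccontr)
  assume contra: "\<not> ?thesis"
  have "len (sref g * x) \<noteq> len (sref g * x * t)"
    using even_len_reflection(2)[OF assms(1), of "sref g * x"] by metis
  with contra have less: "len (sref g * (x * t)) < len (sref g * x)" by (simp add: mult.assoc)
  have parity: "even (len (x * t)) \<longleftrightarrow> odd (len x)" using even_len_reflection(2)[OF assms(1)] .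
  have up: "len (x * t) = len x + 1" "len (x * t) = len (sref g * (x * t)) + 1" "len (sref g * x) = len x + 1"
    using less assms(2) len_sref_cases[of g x] len_sref_cases[of g "x * t"] parity by presburger+
  obtain ws where ws: "word_val ws = sref g * (x * t)" "length ws = len (sref g * (x * t))"
    by (rule ex_minimal_word)
  have val: "word_val (g # ws) = x * t" using ws by simp
  have xtt: "x * t * t = x" using assms(1) by (simp add: mult.assoc)
  have "len (word_val (g # ws) * t) < len (word_val (g # ws))"
    using assms(2) by (simp only: val xtt)
  then obtain xs k ys where del: "g # ws = xs @ k # ys" "word_val (g # ws) * t = word_val (xs @ ys)"
    using strong_exchange_right[OF assms(1)] by blast
  have x: "x = word_val (xs @ ys)" using del(2) by (simp only: val xtt)
  show False
  proof (cases xs)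
    case Nil
    with del x ws have "x = sref g * (x * t)" by simp
    with contra show False by (simp add: sref_mult_eq_iff)
  next
    case (Cons g' zs)
    with del(1) have "ws = zs @ k # ys" "g' = g" by auto
    with x Cons have "sref g * x = word_val (zs @ ys)" by simp
    then have "len (sref g * x) < length ws" using len_le_length[of "zs @ ys"] \<open>ws = _\<close> by simp
    then show False using ws up by simp
  qed
qed

lemma bruhat_le_sref_cases:
  "a \<le>\<^sub>B b \<Longrightarrow> sref g * a \<le>\<^sub>B b \<or> sref g * a \<le>\<^sub>B sref g * b"
proof (induction rule: bruhat_le_converse_induct)
  case (step x t)
  from bruhat_sref_edge[OF step.hyps(2,3), of g] show ?case
  proof
    assume "sref g * x = x * t"
    then show ?thesis using step.hyps(1) by simp
  next
    assume "len (sref g * x) < len (sref g * x * t)"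
    then have "sref g * x \<le>\<^sub>B sref g * (x * t)" using bruhat_edge step.hyps(2) by (metis mult.assoc)
    then show ?thesis using step.IH bruhat_le_trans by blast
  qed
qed simp

lemma bruhat_lift_down:
  assumes "a \<le>\<^sub>B b" "len (sref g * b) < len b" shows "sref g * a \<le>\<^sub>B b"
proof -
  have "sref g * b \<le>\<^sub>B b" using bruhat_edge_left[of "sref g * b" "sref g"] assms(2) by simp
  then show ?thesis using bruhat_le_sref_cases[OF assms(1), of g] bruhat_le_trans by blast
qed

lemma bruhat_lift_up:
  assumes "a \<le>\<^sub>B b" "len b < len (sref g * b)" shows "sref g * a \<le>\<^sub>B sref g * b"
proof -
  have "b \<le>\<^sub>B sref g * b" using bruhat_edge_left[of b "sref g"] assms(2) by simp
  then show ?thesis using bruhat_le_sref_cases[OF assms(1), of g] bruhat_le_trans by blast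
qed

lemma bruhat_less_sref: "sref g * w <\<^sub>B w \<longleftrightarrow> len (sref g * w) < len w"
  using bruhat_edge_left[of "sref g * w" "sref g"] by (auto simp: bruhat_less_iff)

lemma bruhat_sref_less: "w <\<^sub>B sref g * w \<longleftrightarrow> len w < len (sref g * w)"
  using bruhat_edge_left[of w "sref g"] by (auto simp: bruhat_less_iff)

lemma bruhat_less_sref_right: "w * sref g <\<^sub>B w \<longleftrightarrow> len (w * sref g) < len w"
  using bruhat_edge[of "w * sref g" "sref g"] by (auto simp: bruhat_less_iff)

section \<open>Associativity of the Hecke algebra\<close>

lemma poly_mapping_single_induct [case_names zero add single]:
  assumes "P 0" and "\<And>a b. P a \<Longrightarrow> P b \<Longrightarrow> P (a + b)" and "\<And>i n. P (Poly_Mapping.single i n)"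
  shows "P (c :: 'a \<Rightarrow>\<^sub>0 'b :: comm_monoid_add)"
proof -
  have "P (\<Sum>k\<in>A. Poly_Mapping.single k (Poly_Mapping.lookup c k))" if "finite A" for A
    using that by induction (auto intro: assms)
  then have "P (\<Sum>k\<in>Poly_Mapping.keys c. Poly_Mapping.single k (Poly_Mapping.lookup c k))" by simp
  moreover have "(\<Sum>k\<in>Poly_Mapping.keys c. Poly_Mapping.single k (Poly_Mapping.lookup c k)) = c"
    by (rule poly_mapping_eqI) (simp add: lookup_sum lookup_single when_def in_keys_iff)
  ultimately show ?thesis by simp
qed

lemma lookup_vpow_times [simp]: "Poly_Mapping.lookup (vpow i * c) k = Poly_Mapping.lookup c (k - i)"
  by (induction c rule: poly_mapping_single_induct)
    (auto simp: distrib_left lookup_add mult_single lookup_single when_def)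

lemma vpow_mult [simp]: "vpow i * vpow j = vpow (i + j)" "vpow i * (vpow j * c) = vpow (i + j) * c"
  by (simp_all add: mult_single flip: mult.assoc)

lemma lookup_laurent_bar [simp]:
  "Poly_Mapping.lookup (laurent_bar c) k = Poly_Mapping.lookup c (- k)"
  by (simp add: laurent_bar_def map_key.rep_eq)

lemma laurent_bar_add [simp]: "laurent_bar (a + b) = laurent_bar a + laurent_bar b"
  and laurent_bar_diff [simp]: "laurent_bar (a - b) = laurent_bar a - laurent_bar b"
  and laurent_bar_zero [simp]: "laurent_bar 0 = 0"
  and laurent_bar_one [simp]: "laurent_bar 1 = 1"
  and laurent_bar_vpow [simp]: "laurent_bar (vpow i) = vpow (- i)"
  and laurent_bar_bar [simp]: "laurent_bar (laurent_bar a) = a"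
  by (rule poly_mapping_eqI; auto simp: lookup_add lookup_minus lookup_one lookup_single when_def)+

lemma laurent_bar_of_int [simp]: "laurent_bar (of_int n) = of_int n"
  by (rule poly_mapping_eqI) (auto simp: lookup_single when_def simp flip: single_of_int)

lemma laurent_bar_single: "laurent_bar (Poly_Mapping.single i n) = Poly_Mapping.single (- i) n"
  by (rule poly_mapping_eqI) (auto simp: lookup_single when_def)

lemma laurent_bar_mult [simp]: "laurent_bar (a * b) = laurent_bar a * laurent_bar b"
proof (induction a rule: poly_mapping_single_induct)
  case (single i n)
  show ?case
  proof (induction b rule: poly_mapping_single_induct)
    case (single j m)
    show ?case by (simp add: mult_single laurent_bar_single)
  qed (simp_all add: distrib_left)
qed (simp_all add: distrib_right)


section \<open>The free module on the T_w and its linear maps\<close>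

lemma lookup_hscale [simp]: "Poly_Mapping.lookup (hscale c h) x = c * Poly_Mapping.lookup h x"
  by (simp add: hscale_def map.rep_eq when_def)

lemma hscale_add [simp]: "hscale c (h + k) = hscale c h + hscale c k"
  and hscale_diff [simp]: "hscale c (h - k) = hscale c h - hscale c k"
  and hscale_add_left: "hscale (a + b) h = hscale a h + hscale b h"
  and hscale_hscale [simp]: "hscale a (hscale b h) = hscale (a * b) h"
  and hscale_one [simp]: "hscale 1 h = h"
  and hscale_zero [simp]: "hscale c 0 = 0"
  and hscale_zero_left [simp]: "hscale 0 h = 0"
  by (rule poly_mapping_eqI; simp add: lookup_add lookup_minus algebra_simps)+

lemma hscale_sum: "hscale c (\<Sum>i\<in>A. f i) = (\<Sum>i\<in>A. hscale c (f i))"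
  by (rule poly_mapping_eqI) (simp add: lookup_sum sum_distrib_left)

lemma hecke_induct [case_names zero add basis]:
  assumes "P 0" and "\<And>a b. P a \<Longrightarrow> P b \<Longrightarrow> P (a + b)" and "\<And>c w. P (hscale c (T_basis w))"
  shows "P h"
proof (induction h rule: poly_mapping_single_induct)
  case (single w c)
  have "hscale c (T_basis w) = Poly_Mapping.single w c"
    by (rule poly_mapping_eqI) (auto simp: lookup_single when_def)
  then show ?case using assms(3) by metis
qed (use assms in auto)

definition hlinear :: "(hecke \<Rightarrow> hecke) \<Rightarrow> bool" where
  "hlinear F \<longleftrightarrow> (\<forall>h k. F (h + k) = F h + F k) \<and> (\<forall>c h. F (hscale c h) = hscale c (F h))"

lemma hlinearI:
  "(\<And>h k. F (h + k) = F h + F k) \<Longrightarrow> (\<And>c h. F (hscale c h) = hscale c (F h)) \<Longrightarrow> hlinear F"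
  by (simp add: hlinear_def)

lemma hlinear_add: "hlinear F \<Longrightarrow> F (h + k) = F h + F k"
  and hlinear_scale: "hlinear F \<Longrightarrow> F (hscale c h) = hscale c (F h)"
  by (simp_all add: hlinear_def)

lemma hlinear_zero: "hlinear F \<Longrightarrow> F 0 = 0"
  using hlinear_scale[of F 0 0] by simp

lemma hlinear_diff: "hlinear F \<Longrightarrow> F (h - k) = F h - F k"
  using hlinear_add[of F "h - k" k] by (simp add: algebra_simps)

lemma hlinear_sum: "hlinear F \<Longrightarrow> F (\<Sum>i\<in>A. f i) = (\<Sum>i\<in>A. F (f i))"
  by (induction A rule: infinite_finite_induct) (simp_all add: hlinear_zero hlinear_add)

lemma hlinear_id: "hlinear (\<lambda>h. h)"
  and hlinear_hscale: "hlinear F \<Longrightarrow> hlinear (\<lambda>h. hscale c (F h))"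
  and hlinear_plus: "hlinear F \<Longrightarrow> hlinear G \<Longrightarrow> hlinear (\<lambda>h. F h + G h)"
  and hlinear_comp: "hlinear F \<Longrightarrow> hlinear G \<Longrightarrow> hlinear (\<lambda>h. F (G h))"
  by (auto simp: hlinear_def algebra_simps)

lemma hlinear_foldr: "(\<And>g. hlinear (f g)) \<Longrightarrow> hlinear (foldr f ws)"
  by (induction ws) (auto simp: hlinear_def)

lemma hlinear_eq:
  assumes "hlinear F" "hlinear G" "\<And>w. F (T_basis w) = G (T_basis w)"
  shows "F h = G h"
  by (induction h rule: hecke_induct)
    (use assms in \<open>simp_all add: hlinear_zero hlinear_add hlinear_scale\<close>)

lemma hlin_superset:
  assumes "finite A" "Poly_Mapping.keys h \<subseteq> A"
  shows "hlin f h = (\<Sum>w\<in>A. hscale (Poly_Mapping.lookup h w) (f w))"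
  unfolding hlin_def by (rule sum.mono_neutral_left) (use assms in \<open>auto simp: in_keys_iff\<close>)

lemma hlinear_hlin: "hlinear (hlin f)"
proof (rule hlinearI)
  fix h k :: hecke and c
  let ?A = "Poly_Mapping.keys h \<union> Poly_Mapping.keys k"
  have "Poly_Mapping.keys (h + k) \<subseteq> ?A" by (rule keys_add)
  then show "hlin f (h + k) = hlin f h + hlin f k"
    by (simp add: hlin_superset[of ?A] lookup_add hscale_add_left sum.distrib)
  have "Poly_Mapping.keys (hscale c h) \<subseteq> Poly_Mapping.keys h" by (auto simp: in_keys_iff)
  then show "hlin f (hscale c h) = hscale c (hlin f h)"
    by (simp add: hlin_superset[of "Poly_Mapping.keys h"] hscale_sum)
qed

lemma hlin_basis [simp]: "hlin f (T_basis w) = f w"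
  by (simp add: hlin_def)

lemma lookup_hlin:
  "Poly_Mapping.lookup (hlin f h) x =
     (\<Sum>w\<in>Poly_Mapping.keys h. Poly_Mapping.lookup h w * Poly_Mapping.lookup (f w) x)"
  by (simp add: hlin_def lookup_sum)

lemma hlinear_lookup_eq:
  assumes "hlinear F" "\<And>h k. G (h + k) = G h + G k" "\<And>c h. G (hscale c h) = c * G h"
    and "\<And>w. Poly_Mapping.lookup (F (T_basis w)) x = (G (T_basis w) :: laurent)"
  shows "Poly_Mapping.lookup (F h) x = G h"
proof (induction h rule: hecke_induct)
  case zero
  show ?case using assms(3)[of 0 0] by (simp add: hlinear_zero assms(1))
qed (use assms in \<open>simp_all add: hlinear_add hlinear_scale lookup_add\<close>)


lemma hlinear_gen_mult: "hlinear (gen_mult g)"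
  unfolding gen_mult_def by (rule hlinear_hlin)

lemma gen_mult_basis:
  "gen_mult g (T_basis w) = (if len w < len (sref g * w) then T_basis (sref g * w)
     else hscale (qvar - 1) (T_basis w) + hscale qvar (T_basis (sref g * w)))"
  by (simp add: gen_mult_def)

lemma lookup_gen_mult:
  "Poly_Mapping.lookup (gen_mult g h) x = (if len x < len (sref g * x)
     then qvar * Poly_Mapping.lookup h (sref g * x)
     else Poly_Mapping.lookup h (sref g * x) + (qvar - 1) * Poly_Mapping.lookup h x)"
proof (rule hlinear_lookup_eq[OF hlinear_gen_mult])
  fix w
  have "sref g * w = x \<longleftrightarrow> w = sref g * x" by auto
  moreover have "len (sref g * x) \<noteq> len x" using even_len_sref(1)[of g x] by metis
  ultimately show "Poly_Mapping.lookup (gen_mult g (T_basis w)) x = (if len x < len (sref g * x)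
     then qvar * Poly_Mapping.lookup (T_basis w) (sref g * x)
     else Poly_Mapping.lookup (T_basis w) (sref g * x) + (qvar - 1) * Poly_Mapping.lookup (T_basis w) x)"
    by (auto simp: gen_mult_basis lookup_add lookup_single when_def)
qed (simp_all add: lookup_add algebra_simps)

lemma gen_mult_up: "len w < len (sref g * w) \<Longrightarrow> gen_mult g (T_basis w) = T_basis (sref g * w)"
  by (simp add: gen_mult_basis)

lemma gen_mult_quadratic: "gen_mult g (gen_mult g h) = hscale (qvar - 1) (gen_mult g h) + hscale qvar h"
proof (rule poly_mapping_eqI)
  fix x
  have "len (sref g * x) < len x" if "\<not> len x < len (sref g * x)"
    using len_sref_less(3)[of g x] that by auto
  then show "Poly_Mapping.lookup (gen_mult g (gen_mult g h)) x =
      Poly_Mapping.lookup (hscale (qvar - 1) (gen_mult g h) + hscale qvar h) x"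
    by (auto simp: lookup_gen_mult lookup_add algebra_simps)
qed

section \<open>The right action of the generators\<close>

definition hflip :: "hecke \<Rightarrow> hecke" where
  "hflip = hlin (\<lambda>w. T_basis (winv w))"

lemma hlinear_hflip: "hlinear hflip"
  unfolding hflip_def by (rule hlinear_hlin)

lemma hflip_basis [simp]: "hflip (T_basis w) = T_basis (winv w)"
  by (simp add: hflip_def)

lemma hflip_hflip [simp]: "hflip (hflip h) = h"
  by (rule hlinear_eq[OF hlinear_comp[OF hlinear_hflip hlinear_hflip] hlinear_id]) simp

lemma lookup_hflip [simp]: "Poly_Mapping.lookup (hflip h) x = Poly_Mapping.lookup h (winv x)"
proof (rule hlinear_lookup_eq[OF hlinear_hflip])
  fix w show "Poly_Mapping.lookup (hflip (T_basis w)) x = Poly_Mapping.lookup (T_basis w) (winv x)"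
    by (auto simp: lookup_single when_def)
qed (simp_all add: lookup_add)

text \<open>The left action transported along inversion; by \<open>gen_mult_right_eq_hmult\<close>
  it is right multiplication by T_g. Commuting with it makes the product independent of the chosen
  reduced words.\<close>

definition gen_mult_right :: "gen \<Rightarrow> hecke \<Rightarrow> hecke" where
  "gen_mult_right g h = hflip (gen_mult g (hflip h))"

lemma hlinear_gen_mult_right: "hlinear (gen_mult_right g)"
  unfolding gen_mult_right_def
  by (rule hlinear_comp[OF hlinear_hflip hlinear_comp[OF hlinear_gen_mult hlinear_hflip]])

lemma gen_mult_right_basis:
  "gen_mult_right g (T_basis w) = (if len w < len (w * sref g) then T_basis (w * sref g)
     else hscale (qvar - 1) (T_basis w) + hscale qvar (T_basis (w * sref g)))"
proof -
  have "len (sref g * winv w) = len (w * sref g)" using len_winv[of "w * sref g"] by simp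
  then show ?thesis
    by (simp add: gen_mult_right_def gen_mult_basis hlinear_add[OF hlinear_hflip]
        hlinear_scale[OF hlinear_hflip])
qed

lemma len_square_cases:
  fixes a b c d :: nat
  assumes "b = a + 1 \<or> a = b + 1" "c = a + 1 \<or> a = c + 1"
    "d = b + 1 \<or> b = d + 1" "d = c + 1 \<or> c = d + 1" "\<not> (b = c \<and> d = a)"
  shows "b = a + 1 \<and> c = a + 1 \<and> d = a + 2 \<or> b = a + 1 \<and> a = c + 1 \<and> d = a \<or>
    a = b + 1 \<and> c = a + 1 \<and> d = a \<or> a = b + 1 \<and> a = c + 1 \<and> a = d + 2"
  using assms by presburger

text \<open>If the four lengths leave room for g w = w h, that equation holds, both operators agree
  on T_w and T_(gw), and both sides are the square of one operator. Otherwise each operator takes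
  the same branch of its formula at both places where it is applied.\<close>

lemma gen_mult_right_commute: "gen_mult g (gen_mult_right h k) = gen_mult_right h (gen_mult g k)"
proof (rule hlinear_eq[where h = k])
  fix w
  let ?a = "len w" and ?b = "len (sref g * w)" and ?c = "len (w * sref h)" and ?d = "len (sref g * w * sref h)"
  have steps: "?b = ?a + 1 \<or> ?a = ?b + 1" "?c = ?a + 1 \<or> ?a = ?c + 1"
    "?d = ?b + 1 \<or> ?b = ?d + 1" "?d = ?c + 1 \<or> ?c = ?d + 1"
    using len_sref_cases[of g w] len_sref_cases_right[of w h]
      len_sref_cases_right[of "sref g * w" h] len_sref_cases[of g "w * sref h"]
    by (simp_all add: mult.assoc)
  have eq: "sref g * w = w * sref h" if "?d = ?a" "?b = ?c"
    using mult_sref_eq_sref_mult that .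
  have fixed: "sref g * w * sref h = w" if "sref g * w = w * sref h"
    using that by simp
  note lin = hlinear_add[OF hlinear_gen_mult] hlinear_scale[OF hlinear_gen_mult]
    hlinear_add[OF hlinear_gen_mult_right] hlinear_scale[OF hlinear_gen_mult_right]
  show "gen_mult g (gen_mult_right h (T_basis w)) = gen_mult_right h (gen_mult g (T_basis w))"
  proof (cases "?b = ?c \<and> ?d = ?a")
    case True
    then have *: "sref g * w = w * sref h" using eq by simp
    have agree: "gen_mult g (T_basis x) = gen_mult_right h (T_basis x)" if "sref g * x = x * sref h" for x
      by (simp add: gen_mult_basis gen_mult_right_basis that)
    have "gen_mult g (gen_mult g (T_basis w)) = gen_mult_right h (gen_mult g (T_basis w))"
      unfolding gen_mult_basis[of g w] using agree[OF *] agree[of "sref g * w"] fixed[OF *]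
      by (simp add: lin)
    then show ?thesis by (simp only: agree[OF *])
  next
    case False
    consider "?b = ?a + 1" "?c = ?a + 1" "?d = ?a + 2" | "?b = ?a + 1" "?a = ?c + 1" "?d = ?a"
      | "?a = ?b + 1" "?c = ?a + 1" "?d = ?a" | "?a = ?b + 1" "?a = ?c + 1" "?a = ?d + 2"
      using len_square_cases[OF steps False] by blast
    then show ?thesis
      by cases (simp_all add: gen_mult_basis gen_mult_right_basis lin mult.assoc add_ac mult.commute)
  qed
qed (rule hlinear_comp[OF hlinear_gen_mult hlinear_gen_mult_right]
    hlinear_comp[OF hlinear_gen_mult_right hlinear_gen_mult])+


section \<open>Multiplication along reduced words and associativity\<close>

definition word_mult :: "gen list \<Rightarrow> hecke \<Rightarrow> hecke" where
  "word_mult ws = foldr gen_mult ws"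

lemma word_mult_simps [simp]:
  "word_mult [] k = k" "word_mult (g # ws) k = gen_mult g (word_mult ws k)"
  "word_mult (xs @ ys) k = word_mult xs (word_mult ys k)"
  by (simp_all add: word_mult_def)

lemma hlinear_word_mult: "hlinear (word_mult ws)"
  unfolding word_mult_def by (rule hlinear_foldr) (rule hlinear_gen_mult)

definition reduced :: "gen list \<Rightarrow> bool" where
  "reduced ws \<longleftrightarrow> len (word_val ws) = length ws"

lemma reduced_reduced_word [simp]: "reduced (reduced_word w)"
  by (simp add: reduced_def reduced_word)

lemma reduced_ConsD: assumes "reduced (g # ws)"
  shows "reduced ws" and "len (word_val ws) < len (sref g * word_val ws)"
proof -
  have "len (sref g * word_val ws) \<le> len (word_val ws) + 1"
    using len_mult_le[of "sref g" "word_val ws"] by simp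
  then show "reduced ws" "len (word_val ws) < len (sref g * word_val ws)"
    using assms len_le_length[of ws] by (auto simp: reduced_def)
qed

lemma reduced_Cons_iff: "reduced (g # ws) \<longleftrightarrow> reduced ws \<and> len (word_val ws) < len (sref g * word_val ws)"
  using reduced_ConsD[of g ws] len_sref_less(2)[of "word_val ws" g] by (auto simp: reduced_def)

lemma reduced_rev: "reduced (rev ws) \<longleftrightarrow> reduced ws"
  by (simp add: reduced_def flip: winv_word_val)

lemma reduced_append_iff:
  "reduced (xs @ ys) \<longleftrightarrow> reduced xs \<and> reduced ys \<and>
     len (word_val xs * word_val ys) = len (word_val xs) + len (word_val ys)"
  using len_mult_le[of "word_val xs" "word_val ys"] len_le_length[of xs] len_le_length[of ys]
  by (auto simp: reduced_def)

lemma word_mult_one: "reduced ws \<Longrightarrow> word_mult ws (T_basis 1) = T_basis (word_val ws)"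
  by (induction ws) (auto simp: reduced_Cons_iff gen_mult_up)

lemma word_mult_gen_mult_right:
  "word_mult ws (gen_mult_right h k) = gen_mult_right h (word_mult ws k)"
  by (induction ws) (simp_all add: gen_mult_right_commute)

lemma gen_mult_right_up:
  "len w < len (w * sref g) \<Longrightarrow> gen_mult_right g (T_basis w) = T_basis (w * sref g)"
  by (simp add: gen_mult_right_basis)

text \<open>Both sides commute with the right action of the generators, so it is enough to compare
  them on the unit.\<close>

lemma word_mult_cong:
  assumes "reduced xs" "reduced ys" "word_val xs = word_val ys"
  shows "word_mult xs k = word_mult ys k"
proof (rule hlinear_eq[OF hlinear_word_mult hlinear_word_mult])
  fix w
  have "word_mult xs (T_basis (word_val zs)) = word_mult ys (T_basis (word_val zs))" if "reduced zs" for zs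
    using that
  proof (induction zs rule: rev_induct)
    case Nil
    show ?case using assms by (simp add: word_mult_one)
  next
    case (snoc g zs)
    then have "reduced zs" "len (word_val zs) < len (word_val zs * sref g)"
      by (auto simp: reduced_append_iff)
    then show ?case using snoc.IH by (simp add: word_mult_gen_mult_right flip: gen_mult_right_up)
  qed
  from this[of "reduced_word w"] show "word_mult xs (T_basis w) = word_mult ys (T_basis w)"
    by (simp add: reduced_word)
qed

lemma hmult_basis: "reduced ws \<Longrightarrow> T_basis (word_val ws) \<odot> k = word_mult ws k"
  unfolding hmult_def hlin_basis word_mult_def[symmetric]
  by (rule word_mult_cong) (simp_all add: reduced_word)

lemma hlinear_hmult_left: "hlinear (\<lambda>h. h \<odot> k)"
  unfolding hmult_def by (rule hlinear_hlin)

lemma hlinear_hmult: "hlinear ((\<odot>) h)"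
proof (rule hlinearI)
  fix k k' c
  have lin: "hlinear (foldr gen_mult ws)" for ws by (rule hlinear_foldr) (rule hlinear_gen_mult)
  show "h \<odot> (k + k') = h \<odot> k + h \<odot> k'"
    by (simp add: hmult_def hlin_def hlinear_add[OF lin] sum.distrib)
  show "h \<odot> hscale c k = hscale c (h \<odot> k)"
    by (simp add: hmult_def hlin_def hlinear_scale[OF lin] hscale_sum mult.commute)
qed

lemmas hmult_linear =
  hlinear_add[OF hlinear_hmult] hlinear_scale[OF hlinear_hmult] hlinear_diff[OF hlinear_hmult]
  hlinear_add[OF hlinear_hmult_left] hlinear_scale[OF hlinear_hmult_left] hlinear_diff[OF hlinear_hmult_left]
  hlinear_zero[OF hlinear_hmult] hlinear_zero[OF hlinear_hmult_left]

lemma hmult_one_left [simp]: "T_basis 1 \<odot> k = k"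
  using hmult_basis[of "[]"] by (simp add: reduced_def)

lemma hmult_one_right [simp]: "h \<odot> T_basis 1 = h"
proof (rule hlinear_eq[OF hlinear_hmult_left hlinear_id])
  fix w show "T_basis w \<odot> T_basis 1 = T_basis w"
    using hmult_basis[of "reduced_word w" "T_basis 1"] word_mult_one[of "reduced_word w"]
    by (simp add: reduced_word)
qed

lemma gen_mult_hmult: "gen_mult g h \<odot> k = gen_mult g (h \<odot> k)"
proof (rule hlinear_eq[where h = h])
  fix w
  obtain ws where ws: "reduced ws" "word_val ws = w" by (metis reduced_reduced_word reduced_word(1))
  show "gen_mult g (T_basis w) \<odot> k = gen_mult g (T_basis w \<odot> k)"
  proof (cases "len w < len (sref g * w)")
    case True
    then show ?thesis using hmult_basis[of "g # ws" k] hmult_basis[of ws k] ws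
      by (simp add: reduced_Cons_iff gen_mult_up)
  next
    case False
    define y where "y = sref g * w"
    obtain ys where ys: "reduced ys" "word_val ys = y" by (metis reduced_reduced_word reduced_word(1))
    have w: "w = sref g * y" by (simp add: y_def)
    have "len y < len (sref g * y)" using False len_sref_less(3)[of g w] by (simp add: y_def)
    then have "T_basis w \<odot> k = gen_mult g (T_basis y \<odot> k)" "T_basis w = gen_mult g (T_basis y)"
      using hmult_basis[of "g # ys" k] hmult_basis[of ys k] ys
      by (simp_all add: reduced_Cons_iff gen_mult_up w)
    then show ?thesis by (simp add: gen_mult_quadratic hmult_linear)
  qed
qed (rule hlinear_comp[OF hlinear_hmult_left hlinear_gen_mult]
    hlinear_comp[OF hlinear_gen_mult hlinear_hmult_left])+

lemma word_mult_hmult: "word_mult ws h \<odot> k = word_mult ws (h \<odot> k)"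
  by (induction ws) (simp_all add: gen_mult_hmult)

lemma hmult_assoc: "h \<odot> k \<odot> m = h \<odot> (k \<odot> m)"
proof (rule hlinear_eq[where h = h])
  fix w
  have "T_basis w \<odot> x = word_mult (reduced_word w) x" for x
    using hmult_basis[of "reduced_word w" x] by (simp add: reduced_word)
  then show "T_basis w \<odot> k \<odot> m = T_basis w \<odot> (k \<odot> m)" by (simp add: word_mult_hmult)
qed (rule hlinear_comp[OF hlinear_hmult_left hlinear_hmult_left] hlinear_hmult_left)+

lemma hmult_basis_basis:
  assumes "len (x * y) = len x + len y" shows "T_basis x \<odot> T_basis y = T_basis (x * y)"
proof -
  let ?xs = "reduced_word x" and ?ys = "reduced_word y"
  have "reduced (?xs @ ?ys)" using assms by (simp add: reduced_append_iff reduced_word)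
  from word_mult_one[OF this] show ?thesis
    using hmult_basis[of ?xs "T_basis y"] word_mult_one[of ?ys] by (simp add: reduced_word)
qed

lemma gen_mult_right_eq_hmult: "gen_mult_right g h = h \<odot> T_basis (sref g)"
proof (rule hlinear_eq[OF hlinear_gen_mult_right hlinear_hmult_left])
  fix w
  let ?ws = "reduced_word w"
  have "gen_mult_right g (T_basis w) = word_mult ?ws (gen_mult_right g (T_basis 1))"
    by (simp add: word_mult_gen_mult_right word_mult_one reduced_word)
  also have "gen_mult_right g (T_basis 1) = T_basis (sref g)" by (simp add: gen_mult_right_basis)
  finally show "gen_mult_right g (T_basis w) = T_basis w \<odot> T_basis (sref g)"
    using hmult_basis[of ?ws] by (simp add: reduced_word)
qed

lemma hflip_gen_mult: "hflip (gen_mult g k) = hflip k \<odot> T_basis (sref g)"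
  by (simp flip: gen_mult_right_eq_hmult add: gen_mult_right_def)

lemma hflip_hmult: "hflip (h \<odot> k) = hflip k \<odot> hflip h"
proof (rule hlinear_eq[where h = h])
  fix w
  have "hflip (word_mult ws k) = hflip k \<odot> T_basis (winv (word_val ws))" if "reduced ws" for ws
    using that
  proof (induction ws)
    case (Cons g ws)
    then have *: "reduced ws" "len (word_val (g # ws)) = len (word_val ws) + 1"
      using reduced_ConsD[of g ws] by (auto simp: reduced_def)
    have "len (winv (word_val ws) * sref g) = len (winv (word_val ws)) + len (sref g)"
      using *(2) len_winv[of "sref g * word_val ws"] by simp
    then show ?case using Cons.IH[OF *(1)]
      by (simp add: hflip_gen_mult hmult_assoc hmult_basis_basis)
  qed simp
  from this[of "reduced_word w"] show "hflip (T_basis w \<odot> k) = hflip k \<odot> hflip (T_basis w)"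
    using hmult_basis[of "reduced_word w" k] by (simp add: reduced_word)
qed (rule hlinear_comp[OF hlinear_hflip hlinear_hmult_left]
    hlinear_comp[OF hlinear_hmult hlinear_hflip])+

section \<open>The bar involution\<close>

text \<open>By the quadratic relation T_g has the inverse q^-1 T_g + (q^-1 - 1); this is left
  multiplication by it.\<close>

definition gen_mult_inv :: "gen \<Rightarrow> hecke \<Rightarrow> hecke" where
  "gen_mult_inv g h = hscale (vpow (- 2)) (gen_mult g h) + hscale (vpow (- 2) - 1) h"

lemma hlinear_gen_mult_inv: "hlinear (gen_mult_inv g)"
  unfolding gen_mult_inv_def
  by (intro hlinear_plus hlinear_hscale hlinear_gen_mult hlinear_id)

lemma gen_mult_gen_mult_inv [simp]:
  "gen_mult g (gen_mult_inv g h) = h" "gen_mult_inv g (gen_mult g h) = h"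
  unfolding gen_mult_inv_def
  by (rule poly_mapping_eqI; simp add: hlinear_add[OF hlinear_gen_mult]
      hlinear_scale[OF hlinear_gen_mult] gen_mult_quadratic lookup_add algebra_simps)+

lemma gen_mult_inv_hmult: "gen_mult_inv g h \<odot> k = gen_mult_inv g (h \<odot> k)"
  by (simp add: gen_mult_inv_def hmult_linear gen_mult_hmult)

text \<open>For a reduced word of w this is the inverse of T_(w^-1), that is, the bar image of
  T_w.\<close>

definition inv_word :: "gen list \<Rightarrow> hecke" where
  "inv_word ws = foldr gen_mult_inv ws (T_basis 1)"

lemma inv_word_simps [simp]:
  "inv_word [] = T_basis 1" "inv_word (g # ws) = gen_mult_inv g (inv_word ws)"
  by (simp_all add: inv_word_def)

lemma inv_word_inverse:
  assumes "reduced ws"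
  shows "T_basis (winv (word_val ws)) \<odot> inv_word ws = T_basis 1"
    and "inv_word ws \<odot> T_basis (winv (word_val ws)) = T_basis 1"
proof -
  have "T_basis (winv (word_val ws)) \<odot> inv_word ws = word_mult (rev ws) (inv_word ws)"
    using hmult_basis[of "rev ws"] assms by (simp add: reduced_rev winv_word_val)
  also have "\<dots> = T_basis 1" by (induction ws) simp_all
  finally show "T_basis (winv (word_val ws)) \<odot> inv_word ws = T_basis 1" .
  have "foldr gen_mult_inv ws (T_basis 1) \<odot> k = foldr gen_mult_inv ws k" for k
    by (induction ws) (simp_all add: gen_mult_inv_hmult)
  moreover have "T_basis (winv (word_val ws)) = word_mult (rev ws) (T_basis 1)"
    using word_mult_one[of "rev ws"] assms by (simp add: reduced_rev winv_word_val)
  moreover have "foldr gen_mult_inv ws (word_mult (rev ws) k) = k" for k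
    by (induction ws arbitrary: k) simp_all
  ultimately show "inv_word ws \<odot> T_basis (winv (word_val ws)) = T_basis 1"
    by (simp add: inv_word_def)
qed

lemma hinverse_eqI:
  assumes "h \<odot> k = T_basis 1" "k \<odot> h = T_basis 1" shows "hinverse h = k"
  unfolding hinverse_def
proof (rule the_equality)
  show "h \<odot> k = T_basis 1 \<and> k \<odot> h = T_basis 1" using assms ..
  fix k' assume k': "h \<odot> k' = T_basis 1 \<and> k' \<odot> h = T_basis 1"
  then have "k' = k' \<odot> (h \<odot> k)" using assms by simp
  also have "\<dots> = k" using k' by (simp flip: hmult_assoc)
  finally show "k' = k" .
qed

lemma hinverse_basis: "reduced ws \<Longrightarrow> hinverse (T_basis (winv (word_val ws))) = inv_word ws"
  by (intro hinverse_eqI inv_word_inverse)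

lemma hbar_superset:
  assumes "finite A" "Poly_Mapping.keys h \<subseteq> A"
  shows "hbar h = (\<Sum>w\<in>A. hscale (laurent_bar (Poly_Mapping.lookup h w)) (hinverse (T_basis (winv w))))"
  unfolding hbar_def by (rule sum.mono_neutral_left) (use assms in \<open>auto simp: in_keys_iff\<close>)

lemma hbar_add: "hbar (h + k) = hbar h + hbar k"
proof -
  let ?A = "Poly_Mapping.keys h \<union> Poly_Mapping.keys k"
  have "Poly_Mapping.keys (h + k) \<subseteq> ?A" by (rule keys_add)
  then show ?thesis
    by (simp add: hbar_superset[of ?A] lookup_add hscale_add_left sum.distrib)
qed

lemma hbar_scale: "hbar (hscale c h) = hscale (laurent_bar c) (hbar h)"
proof -
  have "Poly_Mapping.keys (hscale c h) \<subseteq> Poly_Mapping.keys h" by (auto simp: in_keys_iff)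
  then show ?thesis
    by (simp add: hbar_superset[of "Poly_Mapping.keys h"] hscale_sum)
qed

lemma hbar_zero [simp]: "hbar 0 = 0"
  by (simp add: hbar_def)

lemma hbar_diff: "hbar (h - k) = hbar h - hbar k"
  using hbar_add[of "h - k" k] by (simp add: algebra_simps)

lemma hbar_sum: "hbar (\<Sum>i\<in>A. f i) = (\<Sum>i\<in>A. hbar (f i))"
  by (induction A rule: infinite_finite_induct) (simp_all add: hbar_add)

lemma hbar_basis: "reduced ws \<Longrightarrow> hbar (T_basis (word_val ws)) = inv_word ws"
  by (simp add: hbar_def hinverse_basis)

text \<open>If g shortens w = g y, then T_g T_w = T_g^2 T_y, and bar turns the quadratic relation of
  T_g into that of T_g^-1.\<close>

lemma hbar_gen_mult: "hbar (gen_mult g h) = gen_mult_inv g (hbar h)"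
proof (induction h rule: hecke_induct)
  case zero
  show ?case by (simp add: hlinear_zero[OF hlinear_gen_mult] hlinear_zero[OF hlinear_gen_mult_inv])
next
  case (add a b)
  then show ?case
    by (simp add: hlinear_add[OF hlinear_gen_mult] hlinear_add[OF hlinear_gen_mult_inv] hbar_add)
next
  case (basis c w)
  have up: "hbar (T_basis (sref g * y)) = gen_mult_inv g (hbar (T_basis y))"
    if "len y < len (sref g * y)" for y
  proof -
    have "reduced (g # reduced_word y)" using that by (simp add: reduced_Cons_iff reduced_word)
    from hbar_basis[OF this] show ?thesis
      using hbar_basis[of "reduced_word y"] by (simp add: reduced_word)
  qed
  have "hbar (gen_mult g (T_basis w)) = gen_mult_inv g (hbar (T_basis w))"
  proof (cases "len w < len (sref g * w)")
    case True
    then show ?thesis using up by (simp add: gen_mult_up)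
  next
    case False
    define y where "y = sref g * w"
    have w: "w = sref g * y" by (simp add: y_def)
    have less: "len y < len (sref g * y)" using False len_sref_less(3)[of g w] by (simp add: y_def)
    have "gen_mult g (T_basis w) = hscale (qvar - 1) (T_basis w) + hscale qvar (T_basis y)"
      using False by (simp add: gen_mult_basis y_def)
    then have "hbar (gen_mult g (T_basis w)) =
        hscale (vpow (- 2) - 1) (gen_mult_inv g (hbar (T_basis y))) + hscale (vpow (- 2)) (hbar (T_basis y))"
      using up[OF less] by (simp add: hbar_add hbar_scale w)
    also have "\<dots> = gen_mult_inv g (gen_mult_inv g (hbar (T_basis y)))"
      by (simp add: gen_mult_inv_def[of g "gen_mult_inv g (hbar (T_basis y))"] add.commute)
    finally show ?thesis using up[OF less] by (simp add: w)
  qed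
  then show ?case
    by (simp add: hlinear_scale[OF hlinear_gen_mult] hlinear_scale[OF hlinear_gen_mult_inv] hbar_scale)
qed

lemma hbar_hflip: "hbar (hflip h) = hflip (hbar h)"
proof (induction h rule: hecke_induct)
  case (basis c w)
  let ?ws = "reduced_word w"
  have 1: "hbar (T_basis w) = inv_word ?ws" "hbar (T_basis (winv w)) = inv_word (rev ?ws)"
    using hbar_basis[of ?ws] hbar_basis[of "rev ?ws"]
    by (simp_all add: reduced_rev reduced_word flip: winv_word_val)
  have "hinverse (T_basis (word_val ?ws)) = hflip (inv_word ?ws)"
  proof (rule hinverse_eqI)
    have *: "T_basis (word_val ?ws) = hflip (T_basis (winv (word_val ?ws)))" by simp
    show "T_basis (word_val ?ws) \<odot> hflip (inv_word ?ws) = T_basis 1"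
      "hflip (inv_word ?ws) \<odot> T_basis (word_val ?ws) = T_basis 1"
      unfolding * hflip_hmult[symmetric] by (simp_all add: inv_word_inverse)
  qed
  moreover have "hinverse (T_basis (word_val ?ws)) = inv_word (rev ?ws)"
    using hinverse_basis[of "rev ?ws"] by (simp add: reduced_rev winv_word_val)
  ultimately show ?case
    by (simp add: 1 hlinear_scale[OF hlinear_hflip] hbar_scale)
qed (simp_all add: hlinear_zero[OF hlinear_hflip] hlinear_add[OF hlinear_hflip] hbar_add)


text \<open>The coefficient of h at the normalised basis element \<open>v\<close>^(-l(x)) \<open>T\<^sub>x\<close>.\<close>

definition ncoeff :: "hecke \<Rightarrow> W \<Rightarrow> laurent" where
  "ncoeff h x = vpow (int (len x)) * Poly_Mapping.lookup h x"

lemma ncoeff_add [simp]: "ncoeff (h + k) x = ncoeff h x + ncoeff k x"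
  and ncoeff_diff [simp]: "ncoeff (h - k) x = ncoeff h x - ncoeff k x"
  and ncoeff_scale [simp]: "ncoeff (hscale c h) x = c * ncoeff h x"
  and ncoeff_zero [simp]: "ncoeff 0 x = 0"
  by (simp_all add: ncoeff_def lookup_add lookup_minus algebra_simps)

lemma ncoeff_sum: "ncoeff (\<Sum>i\<in>A. f i) x = (\<Sum>i\<in>A. ncoeff (f i) x)"
  by (simp add: ncoeff_def lookup_sum sum_distrib_left)

lemma lookup_eq_ncoeff: "Poly_Mapping.lookup h x = vpow (- int (len x)) * ncoeff h x"
  by (simp add: ncoeff_def)

lemma ncoeff_eq_0_iff: "ncoeff h x = 0 \<longleftrightarrow> Poly_Mapping.lookup h x = 0"
proof
  assume "ncoeff h x = 0"
  then show "Poly_Mapping.lookup h x = 0" by (simp add: lookup_eq_ncoeff)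
qed (simp add: ncoeff_def)

lemma ncoeff_eqI: "(\<And>x. ncoeff h x = ncoeff k x) \<Longrightarrow> h = k"
  by (rule poly_mapping_eqI) (simp add: lookup_eq_ncoeff)

lemma ncoeff_hflip [simp]: "ncoeff (hflip h) x = ncoeff h (winv x)"
  by (simp add: ncoeff_def)

lemma ncoeff_basis: "ncoeff (T_basis w) x = (if x = w then vpow (int (len w)) else 0)"
  by (simp add: ncoeff_def lookup_single when_def)

section \<open>Triangularity of the bar involution\<close>

definition len_bounded :: "nat \<Rightarrow> hecke \<Rightarrow> bool" where
  "len_bounded n h \<longleftrightarrow> (\<forall>x. n < len x \<longrightarrow> Poly_Mapping.lookup h x = 0)"

lemma len_boundedD: "len_bounded n h \<Longrightarrow> n < len x \<Longrightarrow> Poly_Mapping.lookup h x = 0"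
  by (simp add: len_bounded_def)

lemma len_bounded_mono: "len_bounded n h \<Longrightarrow> n \<le> m \<Longrightarrow> len_bounded m h"
  by (simp add: len_bounded_def)

lemma len_bounded_gen_mult:
  assumes "len_bounded n h"
  shows "len_bounded (Suc n) (gen_mult g h)"
    and "len x = Suc n \<Longrightarrow> Poly_Mapping.lookup (gen_mult g h) x = Poly_Mapping.lookup h (sref g * x)"
proof -
  have "Poly_Mapping.lookup h (sref g * x) = 0" "Poly_Mapping.lookup h x = 0" if "Suc n < len x" for x
    using that assms len_sref_cases[of g x] by (auto intro!: len_boundedD[OF assms])
  then show "len_bounded (Suc n) (gen_mult g h)"
    by (simp add: len_bounded_def lookup_gen_mult)
  assume "len x = Suc n"
  moreover from this have "Poly_Mapping.lookup h x = 0" by (auto intro!: len_boundedD[OF assms])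
  moreover have "Poly_Mapping.lookup h (sref g * x) = 0" if "len x < len (sref g * x)"
    using that \<open>len x = Suc n\<close> by (auto intro!: len_boundedD[OF assms])
  ultimately show "Poly_Mapping.lookup (gen_mult g h) x = Poly_Mapping.lookup h (sref g * x)"
    by (simp add: lookup_gen_mult)
qed

text \<open>Each factor T_g^-1 = q^-1 T_g + (q^-1 - 1) raises the length by at most one, and in top
  length it acts as q^-1 = v^-2 times a shift by g.\<close>

lemma len_bounded_inv_word:
  "len_bounded (length ws) (inv_word ws) \<and> (\<forall>x. len x = length ws \<longrightarrow>
     Poly_Mapping.lookup (inv_word ws) x = (if x = word_val ws then vpow (- 2 * int (length ws)) else 0))"
proof (induction ws)
  case Nil
  show ?case by (auto simp: len_bounded_def lookup_single when_def)
next
  case (Cons g ws)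
  then have b: "len_bounded (length ws) (inv_word ws)" by simp
  have "Poly_Mapping.lookup (inv_word ws) x = 0" if "Suc (length ws) \<le> len x" for x
    using that by (auto intro!: len_boundedD[OF b])
  moreover have "Poly_Mapping.lookup (inv_word ws) (sref g * x) =
      (if x = word_val (g # ws) then vpow (- 2 * int (length ws)) else 0)"
    if "len x = Suc (length ws)" for x
  proof (cases "len (sref g * x) = length ws")
    case True
    then show ?thesis using Cons by (simp add: sref_mult_eq_iff)
  next
    case False
    then have less: "length ws < len (sref g * x)" using that len_sref_cases[of g x] by auto
    moreover from less have "x \<noteq> word_val (g # ws)" using len_le_length[of ws] by auto
    ultimately show ?thesis using b by (simp add: len_bounded_def)
  qed
  ultimately show ?case
    using Cons len_bounded_gen_mult[OF b, where g = g]
    by (auto simp: len_bounded_def gen_mult_inv_def lookup_add)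
qed

lemma hbar_basis_triangular:
  assumes "len w \<le> len x"
  shows "Poly_Mapping.lookup (hbar (T_basis w)) x = (if x = w then vpow (- 2 * int (len w)) else 0)"
proof -
  have "hbar (T_basis w) = inv_word (reduced_word w)"
    using hbar_basis[of "reduced_word w"] by (simp add: reduced_word)
  then show ?thesis
    using len_bounded_inv_word[of "reduced_word w"] assms
    by (cases "len x = len w") (auto simp: reduced_word len_bounded_def)
qed

definition neg_laurent :: "laurent \<Rightarrow> bool" where
  "neg_laurent c \<longleftrightarrow> (\<forall>k\<ge>0. Poly_Mapping.lookup c k = 0)"

lemma ex_longest_key:
  assumes "(c :: hecke) \<noteq> 0"
  obtains x where "x \<in> Poly_Mapping.keys c" "\<And>w. w \<in> Poly_Mapping.keys c \<Longrightarrow> len w \<le> len x"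
proof -
  have "Max (len ` Poly_Mapping.keys c) \<in> len ` Poly_Mapping.keys c"
    using assms by (intro Max_in) auto
  then obtain x where "x \<in> Poly_Mapping.keys c" "len x = Max (len ` Poly_Mapping.keys c)" by force
  then show thesis by (intro that[of x]) simp_all
qed

text \<open>At a longest x in the support, triangularity makes the normalised coefficient invariant
  under exchanging v and v^-1. Having only negative exponents, it is zero.\<close>

lemma bar_invariant_neg_eq_0:
  assumes bar: "hbar h = h" and neg: "\<And>x. neg_laurent (ncoeff h x)"
  shows "h = 0"
proof (rule ccontr)
  assume "h \<noteq> 0"
  then obtain x where x: "x \<in> Poly_Mapping.keys h" "\<And>y. y \<in> Poly_Mapping.keys h \<Longrightarrow> len y \<le> len x"
    by (rule ex_longest_key) (rule that)
  have "Poly_Mapping.lookup (hbar h) x = (\<Sum>w\<in>Poly_Mapping.keys h.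
      laurent_bar (Poly_Mapping.lookup h w) * Poly_Mapping.lookup (hbar (T_basis w)) x)"
    by (simp add: hbar_def lookup_sum)
  also have "\<dots> = (\<Sum>w\<in>Poly_Mapping.keys h.
      if w = x then vpow (- 2 * int (len x)) * laurent_bar (Poly_Mapping.lookup h w) else 0)"
    by (rule sum.cong) (auto simp: hbar_basis_triangular x mult.commute)
  also have "\<dots> = vpow (- 2 * int (len x)) * laurent_bar (Poly_Mapping.lookup h x)"
    using x(1) by simp
  finally have "Poly_Mapping.lookup h x = vpow (- 2 * int (len x)) * laurent_bar (Poly_Mapping.lookup h x)"
    by (simp add: bar)
  then have "ncoeff h x = vpow (int (len x)) * (vpow (- 2 * int (len x)) * laurent_bar (Poly_Mapping.lookup h x))"
    unfolding ncoeff_def by (rule arg_cong)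
  also have "\<dots> = laurent_bar (ncoeff h x)"
    by (simp add: ncoeff_def)
  finally have "ncoeff h x = laurent_bar (ncoeff h x)" .
  moreover have "Poly_Mapping.lookup (ncoeff h x) k = 0" if "k \<ge> 0" for k
    using neg that by (simp add: neg_laurent_def)
  moreover from calculation have "Poly_Mapping.lookup (ncoeff h x) k = 0" if "k \<le> 0" for k
    using that by (metis lookup_laurent_bar neg_0_le_iff_le)
  ultimately have "ncoeff h x = 0" by (intro poly_mapping_eqI) (metis linear lookup_zero)
  then show False using x(1) by (simp add: ncoeff_eq_0_iff in_keys_iff)
qed

section \<open>The Kazhdan-Lusztig basis\<close>

lemma lookup_of_int: "Poly_Mapping.lookup (of_int a :: laurent) k = (if k = 0 then a else 0)"
  by (simp add: lookup_single when_def flip: single_of_int)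

lemma lookup_of_int_times [simp]:
  "Poly_Mapping.lookup (of_int a * c :: laurent) k = a * Poly_Mapping.lookup c k"
  by (induction c rule: poly_mapping_single_induct)
    (auto simp: distrib_left lookup_add mult_single lookup_single when_def simp flip: single_of_int)

lemma lookup_poly_qvar:
  "Poly_Mapping.lookup (poly (map_poly of_int p) qvar) k =
     (if 0 \<le> k \<and> even k then coeff p (nat (k div 2)) else 0)"
proof (induction p arbitrary: k)
  case (pCons a p)
  have "nat (k div 2) = Suc (nat ((k - 2) div 2))" if "k \<ge> 2" using that by simp
  moreover have "k = 0 \<or> k = 1 \<or> k \<ge> 2" if "k \<ge> 0" using that by linarith
  ultimately show ?case
    using pCons.hyps by (auto simp: map_poly_pCons lookup_add lookup_of_int pCons.IH)
qed simp

lemma ncoeff_kl_element: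
  "ncoeff (kl_element w p) x = (if x \<le>\<^sub>B w
     then vpow (int (len x) - int (len w)) * poly (map_poly of_int (p x)) qvar else 0)"
proof -
  have "Poly_Mapping.lookup (kl_element w p) x =
      vpow (- int (len w)) * (\<Sum>y | y \<le>\<^sub>B w. if y = x then poly (map_poly of_int (p y)) qvar else 0)"
    unfolding kl_element_def lookup_hscale lookup_sum
    by (intro arg_cong2[of _ _ _ _ "(*)"] sum.cong) (auto simp: lookup_single when_def)
  also have "(\<Sum>y | y \<le>\<^sub>B w. if y = x then poly (map_poly of_int (p y)) qvar else 0) =
      (if x \<le>\<^sub>B w then poly (map_poly of_int (p x)) qvar else 0)"
    using finite_bruhat_le[of w] by simp
  finally show ?thesis by (simp add: ncoeff_def)
qed

lemma lookup_ncoeff_kl_element: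
  "x \<le>\<^sub>B w \<Longrightarrow> Poly_Mapping.lookup (ncoeff (kl_element w p) x) (2 * int i + int (len x) - int (len w)) = coeff (p x) i"
  by (simp add: ncoeff_kl_element lookup_poly_qvar)

text \<open>The last conjunct says that v^(l(w) - l(x)) times the coefficient at x is a polynomial in q.\<close>

definition kl_like :: "W \<Rightarrow> hecke \<Rightarrow> bool" where
  "kl_like w h \<longleftrightarrow> hbar h = h \<and> ncoeff h w = 1 \<and> (\<forall>x. x \<noteq> w \<longrightarrow> neg_laurent (ncoeff h x)) \<and>
     (\<forall>x. \<not> x \<le>\<^sub>B w \<longrightarrow> ncoeff h x = 0) \<and>
     (\<forall>x k. Poly_Mapping.lookup (ncoeff h x) k \<noteq> 0 \<longrightarrow>
        even (k - (int (len x) - int (len w))) \<and> int (len x) - int (len w) \<le> k)"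

lemma kl_likeD:
  assumes "kl_like w h"
  shows "hbar h = h" "ncoeff h w = 1"
    and "x \<noteq> w \<Longrightarrow> 0 \<le> k \<Longrightarrow> Poly_Mapping.lookup (ncoeff h x) k = 0"
    and "\<not> x \<le>\<^sub>B w \<Longrightarrow> ncoeff h x = 0"
    and "Poly_Mapping.lookup (ncoeff h x) k \<noteq> 0 \<Longrightarrow> even (k - (int (len x) - int (len w)))"
    and "Poly_Mapping.lookup (ncoeff h x) k \<noteq> 0 \<Longrightarrow> int (len x) - int (len w) \<le> k"
  using assms unfolding kl_like_def neg_laurent_def by blast+

lemma kl_like_unique:
  assumes "kl_like w h" "kl_like w h'" shows "h = h'"
proof -
  have "h - h' = 0"
  proof (rule bar_invariant_neg_eq_0)
    show "hbar (h - h') = h - h'" using assms by (simp add: hbar_diff kl_likeD(1))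
    fix x show "neg_laurent (ncoeff (h - h') x)"
    proof (cases "x = w")
      case False
      then show ?thesis using assms kl_likeD(3) by (simp add: neg_laurent_def lookup_minus)
    qed (use assms kl_likeD(2) in \<open>simp add: neg_laurent_def\<close>)
  qed
  then show ?thesis by simp
qed

text \<open>The coefficient of v^k with k \<ge> 0 has an index beyond the degree d; this turns the
  degree bound on P into support in negative exponents.\<close>

lemma half_degree_less:
  fixes a b d :: nat
  assumes "2 * d + 1 \<le> b - a" "0 \<le> k" "even (k - (int a - int b))"
  shows "d < nat ((k - (int a - int b)) div 2)"
proof -
  obtain m where m: "k - (int a - int b) = 2 * m" using assms(3) by (elim evenE)
  then have "int d < m" using assms(1,2) by linarith
  then show ?thesis by (simp add: m)
qed

lemma half_odd_diff:
  fixes a b :: nat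
  assumes "odd (b - a)" shows "2 * int ((b - a - 1) div 2) + int a - int b = - 1"
proof -
  obtain m where m: "b - a = 2 * m + 1" using assms by (elim oddE)
  then have "int b = int a + 2 * int m + 1" by linarith
  then show ?thesis by (simp add: m)
qed

lemma kl_family_imp_kl_like:
  assumes "is_kl_family w p" shows "kl_like w (kl_element w p)"
  unfolding kl_like_def
proof (intro conjI allI impI)
  note fam = assms[unfolded is_kl_family_def]
  show "hbar (kl_element w p) = kl_element w p" using fam by simp
  show "ncoeff (kl_element w p) w = 1" using fam by (simp add: ncoeff_kl_element)
  show "ncoeff (kl_element w p) x = 0" if "\<not> x \<le>\<^sub>B w" for x using that by (simp add: ncoeff_kl_element)
  show "neg_laurent (ncoeff (kl_element w p) x)" if "x \<noteq> w" for x
  proof (cases "x \<le>\<^sub>B w")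
    case True
    with that have "x <\<^sub>B w" by (simp add: bruhat_less_def)
    with fam have deg: "2 * degree (p x) + 1 \<le> len w - len x" by blast
    have "coeff (p x) (nat ((k - (int (len x) - int (len w))) div 2)) = 0"
      if "k \<ge> 0" "even (k - (int (len x) - int (len w)))" for k
      using half_degree_less[OF deg that] by (rule coeff_eq_0)
    then show ?thesis using True by (simp add: neg_laurent_def ncoeff_kl_element lookup_poly_qvar)
  qed (simp add: ncoeff_kl_element neg_laurent_def)
  show "even (k - (int (len x) - int (len w)))" "int (len x) - int (len w) \<le> k"
    if "Poly_Mapping.lookup (ncoeff (kl_element w p) x) k \<noteq> 0" for x k
    using that by (simp_all add: ncoeff_kl_element lookup_poly_qvar split: if_splits)
qed

lemma kl_family_unique:
  assumes "is_kl_family w p" "is_kl_family w p'" shows "p = p'"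
proof
  fix x
  have eq: "kl_element w p = kl_element w p'"
    using kl_like_unique kl_family_imp_kl_like assms by blast
  show "p x = p' x"
  proof (cases "x \<le>\<^sub>B w")
    case True
    show ?thesis
      by (rule poly_eqI) (metis True eq lookup_ncoeff_kl_element)
  qed (use assms in \<open>simp add: is_kl_family_def\<close>)
qed

lemma kl_like_imp_kl_family:
  assumes h: "kl_like w h" obtains p where "is_kl_family w p" "kl_element w p = h"
proof
  let ?e = "\<lambda>x i. 2 * int i + int (len x) - int (len w)"
  \<comment> \<open>An index above l(w) belongs to a positive exponent, where all coefficients
    vanish, so the finite sum misses nothing.\<close>
  define p where "p x = (\<Sum>i\<le>len w. monom (Poly_Mapping.lookup (ncoeff h x) (?e x i)) i)" for x
  have nonpos: "Poly_Mapping.lookup (ncoeff h x) k = 0" if "k > 0" for x k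
    using kl_likeD(2,3)[OF h] that by (cases "x = w") (auto simp: lookup_one)
  have p: "coeff (p x) i = Poly_Mapping.lookup (ncoeff h x) (?e x i)" for x i
    unfolding p_def coeff_sum coeff_monom by (auto intro!: nonpos)
  show elem: "kl_element w p = h"
  proof (rule ncoeff_eqI)
    fix x
    show "ncoeff (kl_element w p) x = ncoeff h x"
    proof (cases "x \<le>\<^sub>B w")
      case True
      show ?thesis
      proof (rule poly_mapping_eqI)
        fix k
        have "Poly_Mapping.lookup (ncoeff h x) k = 0"
          if "odd (k - (int (len x) - int (len w))) \<or> k < int (len x) - int (len w)"
          using kl_likeD(5,6)[OF h, of x k] that by linarith
        moreover have "?e x (nat ((k - (int (len x) - int (len w))) div 2)) = k"
          if "even (k - (int (len x) - int (len w)))" "k \<ge> int (len x) - int (len w)"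
          using that by simp
        ultimately show "Poly_Mapping.lookup (ncoeff (kl_element w p) x) k = Poly_Mapping.lookup (ncoeff h x) k"
          using True by (auto simp: ncoeff_kl_element lookup_poly_qvar p)
      qed
    next
      case False
      then show ?thesis using kl_likeD(4)[OF h] by (simp add: ncoeff_kl_element)
    qed
  qed
  show "is_kl_family w p"
    unfolding is_kl_family_def
  proof (intro conjI allI impI)
    show "p w = 1"
      by (rule poly_eqI) (simp add: p kl_likeD(2)[OF h] lookup_one when_def coeff_1)
    show "p y = 0" if "\<not> y \<le>\<^sub>B w" for y
      by (rule poly_eqI) (use that kl_likeD(4)[OF h] in \<open>simp add: p\<close>)
    show "hbar (kl_element w p) = kl_element w p" unfolding elem by (rule kl_likeD(1)[OF h])
    fix y assume y: "y <\<^sub>B w"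
    then have less: "len y < len w" "y \<noteq> w" using bruhat_less_len by auto
    have "degree (p y) \<le> (len w - len y - 1) div 2"
      by (rule degree_le) (use less kl_likeD(3)[OF h] in \<open>auto simp: p\<close>)
    then show "2 * degree (p y) + 1 \<le> len w - len y" using less by linarith
  qed
qed

lemma kl_poly_eq:
  assumes "is_kl_family w p" shows "kl_poly x w = p x"
proof -
  have "(THE p. is_kl_family w p) = p"
    using assms kl_family_unique[OF _ assms] by (rule the_equality)
  then show ?thesis by (simp add: kl_poly_def)
qed

lemma kl_like_imp_kl_basis_eq:
  assumes "kl_like w h" shows "kl_basis w = h"
proof -
  obtain p where "is_kl_family w p" "kl_element w p = h"
    using assms by (rule kl_like_imp_kl_family)
  then show ?thesis by (simp add: kl_basis_def kl_poly_eq)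
qed

text \<open>The normalisation sends q^i in P_(u,w) to v^(2i + l(u) - l(w)), so the exponent in the
  definition of \<mu> becomes -1. If the length difference is even or u is not below w, both sides
  vanish.\<close>

lemma kl_like_mu:
  assumes "kl_like w h" shows "mu u w = Poly_Mapping.lookup (ncoeff h u) (- 1)"
proof -
  obtain p where p: "is_kl_family w p" "kl_element w p = h"
    using assms by (rule kl_like_imp_kl_family)
  show ?thesis
  proof (cases "odd (len w - len u) \<and> u \<le>\<^sub>B w")
    case True
    then have "mu u w = coeff (p u) ((len w - len u - 1) div 2)"
      by (simp add: mu_def kl_poly_eq[OF p(1)])
    also have "\<dots> = Poly_Mapping.lookup (ncoeff h u)
        (2 * int ((len w - len u - 1) div 2) + int (len u) - int (len w))"
      using lookup_ncoeff_kl_element[of u w p] True p(2) by simp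
    also have "2 * int ((len w - len u - 1) div 2) + int (len u) - int (len w) = - 1"
      using True half_odd_diff by blast
    finally show ?thesis .
  next
    case False
    have "Poly_Mapping.lookup (ncoeff h u) (- 1) = 0"
    proof (cases "u \<le>\<^sub>B w")
      case le: True
      then have "even (len w - len u)" "len u \<le> len w" using False bruhat_le_len[OF le] by auto
      then have "odd (- 1 - (int (len u) - int (len w)))" by (auto simp: even_diff_nat)
      then show ?thesis using kl_likeD(5)[OF assms] by blast
    qed (use kl_likeD(4)[OF assms] in auto)
    moreover have "mu u w = 0"
      using False p(1) by (auto simp: mu_def kl_poly_eq[OF p(1)] is_kl_family_def)
    ultimately show ?thesis by simp
  qed
qed


text \<open>Left multiplication by C_g = v^-1 (T_g + 1), the Kazhdan-Lusztig basis element of a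
  generator.\<close>

definition gen_kl_mult :: "gen \<Rightarrow> hecke \<Rightarrow> hecke" where
  "gen_kl_mult g h = hscale (vpow (- 1)) (gen_mult g h + h)"

lemma hlinear_gen_kl_mult: "hlinear (gen_kl_mult g)"
  unfolding gen_kl_mult_def
  by (intro hlinear_plus hlinear_hscale hlinear_gen_mult hlinear_id)

lemma ncoeff_gen_kl_mult:
  "ncoeff (gen_kl_mult g h) x = ncoeff h (sref g * x) +
     (if len (sref g * x) < len x then vpow 1 else vpow (- 1)) * ncoeff h x"
proof (cases "len (sref g * x) < len x")
  case True
  then have "len x = len (sref g * x) + 1" using len_sref_less by simp
  then show ?thesis using True
    by (simp add: gen_kl_mult_def ncoeff_def lookup_add lookup_gen_mult algebra_simps)
next
  case False
  then have "len (sref g * x) = len x + 1" using len_sref_cases[of g x] by simp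
  then show ?thesis using False
    by (simp add: gen_kl_mult_def ncoeff_def lookup_add lookup_gen_mult algebra_simps)
qed

lemma hbar_gen_kl_mult: "hbar (gen_kl_mult g h) = gen_kl_mult g (hbar h)"
  by (rule poly_mapping_eqI)
    (simp add: gen_kl_mult_def hbar_scale hbar_add hbar_gen_mult gen_mult_inv_def lookup_add algebra_simps)

lemma gen_kl_mult_twice: "gen_kl_mult g (gen_kl_mult g h) = hscale (vpow 1 + vpow (- 1)) (gen_kl_mult g h)"
  by (rule poly_mapping_eqI)
    (simp add: gen_kl_mult_def hlinear_add[OF hlinear_gen_mult] hlinear_scale[OF hlinear_gen_mult]
      gen_mult_quadratic lookup_add algebra_simps)

section \<open>Existence of the Kazhdan-Lusztig basis\<close>

lemma kl_like_one: "kl_like 1 (T_basis 1)"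
proof -
  have "hbar (T_basis 1) = T_basis 1" using hbar_basis[of "[]"] by (simp add: reduced_def)
  then show ?thesis
    by (auto simp: kl_like_def ncoeff_basis neg_laurent_def lookup_one when_def)
qed

text \<open>C_g h has the right leading term and support, but at each z with g z < z the factor v
  moves the coefficient of v^-1 to exponent 0. The sum removes exactly these constant terms by
  bar-invariant elements; letting z range over the keys of h keeps it finite.\<close>

lemma kl_like_step:
  assumes h: "kl_like y h" and up: "len y < len (sref g * y)"
    and C: "\<And>z. len z \<le> len y \<Longrightarrow> kl_like z (C z)"
  shows "kl_like (sref g * y) (gen_kl_mult g h - (\<Sum>z | z \<in> Poly_Mapping.keys h \<and> len (sref g * z) < len z.
           hscale (of_int (Poly_Mapping.lookup (ncoeff h z) (- 1))) (C z)))"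
    (is "kl_like ?w (_ - sum ?f ?Z)")
proof -
  let ?D = "gen_kl_mult g h - sum ?f ?Z"
  let ?m = "\<lambda>z. Poly_Mapping.lookup (ncoeff h z) (- 1)"
  have fin: "finite ?Z" by simp
  have Z: "z \<le>\<^sub>B y" "len z \<le> len y" "z \<noteq> y" if "z \<in> ?Z" for z
  proof -
    have "ncoeff h z \<noteq> 0" using that by (auto simp: ncoeff_eq_0_iff in_keys_iff)
    then show "z \<le>\<^sub>B y" using kl_likeD(4)[OF h] by blast
    then show "len z \<le> len y" using bruhat_le_len by fastforce
    show "z \<noteq> y" using that up by auto
  qed
  have yw: "y \<le>\<^sub>B ?w" using bruhat_sref_less[of y g] up unfolding bruhat_less_def by blast
  have lw: "len ?w = len y + 1" using up len_sref_less by simp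
  have look: "Poly_Mapping.lookup (ncoeff ?D x) k = Poly_Mapping.lookup (ncoeff h (sref g * x)) k +
      Poly_Mapping.lookup (ncoeff h x) (if len (sref g * x) < len x then k - 1 else k + 1) -
      (\<Sum>z\<in>?Z. ?m z * Poly_Mapping.lookup (ncoeff (C z) x) k)" for x k
    by (simp add: ncoeff_gen_kl_mult ncoeff_sum lookup_minus lookup_add lookup_sum)
  have supp: "ncoeff h (sref g * x) = 0 \<and> ncoeff h x = 0 \<and> (\<forall>z\<in>?Z. ncoeff (C z) x = 0)" if "\<not> x \<le>\<^sub>B ?w" for x
  proof (intro conjI ballI)
    have "\<not> sref g * x \<le>\<^sub>B y" using that bruhat_lift_up[OF _ up, of "sref g * x"] by auto
    then show "ncoeff h (sref g * x) = 0" by (rule kl_likeD(4)[OF h])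
    have xy: "\<not> x \<le>\<^sub>B y" using that yw bruhat_le_trans by blast
    then show "ncoeff h x = 0" by (rule kl_likeD(4)[OF h])
    fix z assume z: "z \<in> ?Z"
    then have "\<not> x \<le>\<^sub>B z" using Z(1) xy bruhat_le_trans by blast
    then show "ncoeff (C z) x = 0" using kl_likeD(4)[OF C] Z(2)[OF z] by blast
  qed
  show ?thesis
    unfolding kl_like_def
  proof (intro conjI allI impI)
    have "hbar (C z) = C z" if "z \<in> ?Z" for z using kl_likeD(1)[OF C] Z(2)[OF that] by blast
    then show "hbar ?D = ?D"
      by (simp add: hbar_diff hbar_gen_kl_mult hbar_sum hbar_scale kl_likeD(1)[OF h])
    show "ncoeff ?D x = 0" if "\<not> x \<le>\<^sub>B ?w" for x
      using supp[OF that] by (simp add: ncoeff_gen_kl_mult ncoeff_sum)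
    have "\<not> ?w \<le>\<^sub>B z" if "len z \<le> len y" for z using bruhat_le_len[of ?w z] lw that by auto
    then have "ncoeff h ?w = 0" "\<And>z. z \<in> ?Z \<Longrightarrow> ncoeff (C z) ?w = 0"
      using kl_likeD(4)[OF h] kl_likeD(4)[OF C] Z(2) by auto
    then show "ncoeff ?D ?w = 1"
      by (simp add: ncoeff_gen_kl_mult ncoeff_sum kl_likeD(2)[OF h])
    show "neg_laurent (ncoeff ?D x)" if "x \<noteq> ?w" for x
      unfolding neg_laurent_def
    proof (intro allI impI)
      fix k :: int assume k: "0 \<le> k"
      have "sref g * x \<noteq> y" using that by auto
      then have 1: "Poly_Mapping.lookup (ncoeff h (sref g * x)) k = 0" using kl_likeD(3)[OF h _ k] by simp
      \<comment> \<open>At nonnegative exponents \<open>C z\<close> has nothing but the constant 1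
        at z itself.\<close>
      have "(\<Sum>z\<in>?Z. ?m z * Poly_Mapping.lookup (ncoeff (C z) x) k) =
          (\<Sum>z\<in>?Z. if z = x then (if k = 0 then ?m x else 0) else 0)"
      proof (rule sum.cong)
        fix z assume "z \<in> ?Z"
        then have "kl_like z (C z)" using C Z(2) by blast
        then show "?m z * Poly_Mapping.lookup (ncoeff (C z) x) k = (if z = x then (if k = 0 then ?m x else 0) else 0)"
          using kl_likeD(2,3)[of z "C z"] k by (auto simp: lookup_one when_def)
      qed simp
      also have "\<dots> = (if len (sref g * x) < len x \<and> k = 0 then ?m x else 0)"
        by (auto simp: in_keys_iff ncoeff_def)
      finally have 2: "(\<Sum>z\<in>?Z. ?m z * Poly_Mapping.lookup (ncoeff (C z) x) k) = \<dots>" .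
      show "Poly_Mapping.lookup (ncoeff ?D x) k = 0"
      proof (cases "len (sref g * x) < len x")
        case True
        then have "x \<noteq> y" using up by auto
        then show ?thesis using True k kl_likeD(3)[OF h, of x "k - 1"] unfolding look 1 2 by auto
      next
        case False
        then show ?thesis using k kl_likeD(2)[OF h] kl_likeD(3)[OF h, of x "k + 1"] unfolding look 1 2
          by (cases "x = y") (auto simp: lookup_one)
      qed
    qed
    fix x k
    assume "Poly_Mapping.lookup (ncoeff ?D x) k \<noteq> 0"
    then consider "Poly_Mapping.lookup (ncoeff h (sref g * x)) k \<noteq> 0"
      | "Poly_Mapping.lookup (ncoeff h x) (if len (sref g * x) < len x then k - 1 else k + 1) \<noteq> 0"
      | z where "z \<in> ?Z" "?m z \<noteq> 0" "Poly_Mapping.lookup (ncoeff (C z) x) k \<noteq> 0"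
      unfolding look by (metis (no_types, lifting) add_0 diff_0 mult_eq_0_iff neg_equal_0_iff_equal sum.neutral)
    then have "even (k - (int (len x) - int (len ?w))) \<and> int (len x) - int (len ?w) \<le> k"
    proof cases
      case 1
      then show ?thesis using kl_likeD(5,6)[OF h 1] lw len_sref_cases[of g x] by auto
    next
      case 2
      then show ?thesis using kl_likeD(5,6)[OF h 2] lw by (auto split: if_splits)
    next
      case 3
      then show ?thesis
        using kl_likeD(5)[OF h 3(2)] kl_likeD(5,6)[OF C 3(3)] Z(2)[OF 3(1)] lw by auto
    qed
    then show "even (k - (int (len x) - int (len ?w)))" "int (len x) - int (len ?w) \<le> k" by auto
  qed
qed

lemma ex_descent: assumes "w \<noteq> 1" obtains g where "len (sref g * w) < len w"
proof -
  obtain ws where ws: "word_val ws = w" "length ws = len w" by (rule ex_minimal_word)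
  with assms obtain g vs where "ws = g # vs" by (cases ws) auto
  with ws have "sref g * w = word_val vs" "length vs < len w" by auto
  then show thesis using len_le_length[of vs] that[of g] by simp
qed

lemma kl_like_kl_basis: "kl_like w (kl_basis w)"
proof (induction "len w" arbitrary: w rule: less_induct)
  case less
  have "\<exists>h. kl_like w h"
  proof (cases "w = 1")
    case True
    then show ?thesis using kl_like_one by blast
  next
    case False
    then obtain g where g: "len (sref g * w) < len w" by (rule ex_descent)
    have "kl_like (sref g * w) (kl_basis (sref g * w))" by (rule less) (rule g)
    from kl_like_step[OF this, of g kl_basis] less g show ?thesis by fastforce
  qed
  then show ?case using kl_like_imp_kl_basis_eq by blast
qed

section \<open>Descents, Kazhdan-Lusztig coefficients and \<mu>\<close>

definition kl_coeff :: "W \<Rightarrow> W \<Rightarrow> laurent" where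
  "kl_coeff x w = ncoeff (kl_basis w) x"

lemma mu_eq: "mu x w = Poly_Mapping.lookup (kl_coeff x w) (- 1)"
  unfolding kl_coeff_def by (rule kl_like_mu[OF kl_like_kl_basis])

lemma kl_coeff_self [simp]: "kl_coeff w w = 1"
  and kl_coeff_nonneg: "x \<noteq> w \<Longrightarrow> 0 \<le> k \<Longrightarrow> Poly_Mapping.lookup (kl_coeff x w) k = 0"
  and kl_coeff_not_le: "\<not> x \<le>\<^sub>B w \<Longrightarrow> kl_coeff x w = 0"
  using kl_likeD(2-4)[OF kl_like_kl_basis] by (simp_all add: kl_coeff_def)

lemma kl_coeff_pos: "0 < k \<Longrightarrow> Poly_Mapping.lookup (kl_coeff x w) k = 0"
  by (cases "x = w") (simp_all add: kl_coeff_nonneg lookup_one)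

lemma mu_nonzeroD: assumes "mu x w \<noteq> 0" shows "x \<le>\<^sub>B w" "odd (len w - len x)" "len x < len w" "x <\<^sub>B w"
proof -
  show "x \<le>\<^sub>B w" using assms kl_coeff_not_le by (force simp: mu_eq)
  show *: "odd (len w - len x)" using assms by (auto simp: mu_def split: if_splits)
  then show "len x < len w" by (cases "len x < len w") auto
  with \<open>x \<le>\<^sub>B w\<close> show "x <\<^sub>B w" by (simp add: bruhat_less_iff)
qed

lemma gen_kl_mult_kl_basis_up:
  assumes "len y < len (sref g * y)"
  shows "gen_kl_mult g (kl_basis y) = kl_basis (sref g * y) +
    (\<Sum>z | z \<in> Poly_Mapping.keys (kl_basis y) \<and> len (sref g * z) < len z. hscale (of_int (mu z y)) (kl_basis z))"
  using kl_like_imp_kl_basis_eq[OF kl_like_step[OF kl_like_kl_basis assms kl_like_kl_basis]]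
  by (simp add: mu_eq kl_coeff_def)

text \<open>C_w is C_g C_(gw) minus multiples of C_z with z shorter than w and g z < z. Both parts
  are eigenvectors of C_g, by C_g^2 = (v + v^-1) C_g and by induction.\<close>

lemma gen_kl_mult_kl_basis_down:
  "len (sref g * w) < len w \<Longrightarrow> gen_kl_mult g (kl_basis w) = hscale (vpow 1 + vpow (- 1)) (kl_basis w)"
proof (induction "len w" arbitrary: w rule: less_induct)
  case less
  let ?y = "sref g * w"
  let ?Z = "{z. z \<in> Poly_Mapping.keys (kl_basis ?y) \<and> len (sref g * z) < len z}"
  let ?S = "\<Sum>z\<in>?Z. hscale (of_int (mu z ?y)) (kl_basis z)"
  have Cw: "kl_basis w = gen_kl_mult g (kl_basis ?y) - ?S"
    using gen_kl_mult_kl_basis_up[of ?y g] less.prems by simp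
  have "gen_kl_mult g (kl_basis z) = hscale (vpow 1 + vpow (- 1)) (kl_basis z)" if "z \<in> ?Z" for z
  proof (rule less.hyps)
    have "kl_coeff z ?y \<noteq> 0" using that by (simp add: kl_coeff_def ncoeff_eq_0_iff in_keys_iff)
    then have "z \<le>\<^sub>B ?y" using kl_coeff_not_le by blast
    then show "len z < len w" using less.prems bruhat_le_len by fastforce
  qed (use that in simp)
  then have "gen_kl_mult g ?S = hscale (vpow 1 + vpow (- 1)) ?S"
    by (simp add: hlinear_sum[OF hlinear_gen_kl_mult] hlinear_scale[OF hlinear_gen_kl_mult] hscale_sum mult.commute)
  then show ?case
    by (simp only: Cw hlinear_diff[OF hlinear_gen_kl_mult] gen_kl_mult_twice hscale_diff)
qed

text \<open>The normalised form of P_(x,w) = P_(gx,w), read off from the coefficient at x in C_g C_w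
  = (v + v^-1) C_w.\<close>

lemma kl_coeff_descent:
  assumes "len (sref g * w) < len w" "len x < len (sref g * x)"
  shows "kl_coeff x w = vpow (- 1) * kl_coeff (sref g * x) w"
proof -
  have "ncoeff (gen_kl_mult g (kl_basis w)) x = (vpow 1 + vpow (- 1)) * kl_coeff x w"
    by (simp add: gen_kl_mult_kl_basis_down[OF assms(1)] kl_coeff_def)
  then have "kl_coeff (sref g * x) w = vpow 1 * kl_coeff x w"
    using assms(2) by (simp add: ncoeff_gen_kl_mult kl_coeff_def algebra_simps)
  then show ?thesis by simp
qed

text \<open>The factor v^-1 in \<open>kl_coeff_descent\<close> makes \<mu>(x, w) the constant term
  of the coefficient at g x, which vanishes unless g x = w.\<close>

lemma mu_descent:
  assumes "len (sref g * w) < len w" "len x < len (sref g * x)"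
  shows "mu x w = (if sref g * x = w then 1 else 0)"
  by (simp add: mu_eq kl_coeff_descent[OF assms] kl_coeff_nonneg lookup_one)

lemma kl_basis_winv: "kl_basis (winv w) = hflip (kl_basis w)"
proof (rule kl_like_imp_kl_basis_eq)
  note C = kl_likeD[OF kl_like_kl_basis[of w]]
  have "\<not> winv x \<le>\<^sub>B w" if "\<not> x \<le>\<^sub>B winv w" for x
    using that bruhat_le_winv[of "winv x" w] by auto
  then show "kl_like (winv w) (hflip (kl_basis w))"
    unfolding kl_like_def neg_laurent_def using C
    by (metis (no_types, lifting) hbar_hflip len_winv ncoeff_hflip winv_winv)
qed

lemma mu_winv [simp]: "mu (winv x) (winv w) = mu x w"
  by (simp add: mu_eq kl_coeff_def kl_basis_winv)

lemma mu_descent_right: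
  assumes "len (w * sref g) < len w" "len x < len (x * sref g)"
  shows "mu x w = (if x * sref g = w then 1 else 0)"
proof -
  have "len (sref g * winv y) = len (y * sref g)" for y using len_winv[of "y * sref g"] by simp
  moreover have "sref g * winv x = winv w \<longleftrightarrow> x * sref g = w"
    by (metis winv_mult winv_sref winv_winv)
  ultimately show ?thesis using mu_descent[of g "winv w" "winv x"] assms by simp
qed

section \<open>Dihedral parabolic subgroups\<close>

text \<open>The generators act on the plane by the reflections in the lines x = 1/2, x = y and y = 0; the
  orbit of a generic point tells apart the short elements.\<close>

fun gen_act :: "gen \<Rightarrow> int \<times> int \<Rightarrow> int \<times> int" where
  "gen_act gen_r (a, b) = (1 - a, b)"
| "gen_act gen_s (a, b) = (b, a)"
| "gen_act gen_t (a, b) = (a, - b)"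

lemma gen_act_relation: "relation xs ys \<Longrightarrow> foldr gen_act xs p = foldr gen_act ys p"
proof (induction rule: relation.induct)
  case (1 g)
  show ?case by (cases g; cases p) simp_all
qed (cases p; simp)+

lemma gen_act_word_eq: "word_eq xs ys \<Longrightarrow> foldr gen_act xs = foldr gen_act ys"
  by (induction rule: word_eq.induct) (simp_all add: fun_eq_iff gen_act_relation)

lift_definition W_act :: "W \<Rightarrow> int \<times> int \<Rightarrow> int \<times> int" is "foldr gen_act"
  by (rule gen_act_word_eq)

lemma W_act_word_val: "W_act (word_val ws) = foldr gen_act ws"
  unfolding word_val_eq_abs_W by (simp add: W_act.abs_eq)

lemma sref_eq_iff [simp]: "sref g = sref h \<longleftrightarrow> g = h"
proof
  assume "sref g = sref h"
  then have "word_val [g] = word_val [h]" by simp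
  \<comment> \<open>The coordinates 5 and 20 are chosen so that the short words compared here and in
    \<open>len_braid\<close> move the point to different places.\<close>
  then have "foldr gen_act [g] (5, 20) = foldr gen_act [h] (5, 20)" by (metis W_act_word_val)
  then show "g = h" by (cases g; cases h) simp_all
qed simp

definition bond4 :: "gen \<Rightarrow> gen \<Rightarrow> bool" where
  "bond4 g h \<longleftrightarrow> (g = gen_s) \<noteq> (h = gen_s)"

lemma bond4_sym: "bond4 g h \<Longrightarrow> bond4 h g"
  by (auto simp: bond4_def)

lemma bond4_simps [simp]:
  "bond4 gen_s gen_r" "bond4 gen_s gen_t" "bond4 gen_r gen_s" "bond4 gen_t gen_s"
  "\<not> bond4 gen_r gen_t" "\<not> bond4 gen_t gen_r" "\<not> bond4 g g"
  by (auto simp: bond4_def)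

lemma gen_pair_cases: "g \<noteq> h \<Longrightarrow> bond4 g h \<or> {g, h} = {gen_r, gen_t}"
  by (cases g; cases h) auto

lemma braid:
  assumes "bond4 g h"
  shows "sref g * (sref h * (sref g * (sref h * x))) = sref h * (sref g * (sref h * (sref g * x)))"
proof -
  have flip: "sref b * (sref a * (sref b * (sref a * x))) = sref a * (sref b * (sref a * (sref b * x)))"
    if "relation [a, b, a, b, a, b, a, b] []" for a b
    using dihedral_relation[OF that, of "sref b * (sref a * (sref b * (sref a * x)))"] by simp
  have "relation [g, h, g, h, g, h, g, h] [] \<or> relation [h, g, h, g, h, g, h, g] []"
    using assms by (cases g; cases h) (auto intro: relation.intros)
  then show ?thesis using flip[of g h] flip[of h g] by auto
qed

text \<open>Parity and the given word leave the lengths 0, 2 and 4; the action on the plane rules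
  out 0 and 2.\<close>

lemma len_braid:
  assumes "bond4 g h" shows "len (sref g * (sref h * (sref g * sref h))) = 4"
proof -
  let ?w = "word_val [g, h, g, h]"
  have le: "len ?w \<le> 4" using len_le_length[of "[g, h, g, h]"] by simp
  have even: "even (len ?w)" by (simp only: flip: even_elt_iff) (simp only: even_elt_word_val; simp)
  obtain ws where ws: "word_val ws = ?w" "length ws = len ?w" by (rule ex_minimal_word)
  then have act: "foldr gen_act ws (5, 20) = foldr gen_act [g, h, g, h] (5, 20)"
    by (metis W_act_word_val)
  have "len ?w \<noteq> 0"
  proof
    assume "len ?w = 0"
    then show False using ws act assms by (cases g; cases h) auto
  qed
  moreover have "len ?w \<noteq> 2"
  proof
    assume "len ?w = 2"
    then obtain a b where "ws = [a, b]" using ws(2) by (auto simp: length_Suc_conv numeral_2_eq_2)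
    then show False using act assms by (cases g; cases h; cases a; cases b) auto
  qed
  moreover have "n = 4" if "n \<le> 4" "even n" "n \<noteq> 0" "n \<noteq> 2" for n :: nat
    using that by presburger
  ultimately have "len ?w = 4" using le even by blast
  then show ?thesis by simp
qed

lemma len_dihedral:
  assumes "bond4 g h"
  shows "len (sref h * sref g) = 2" "len (sref g * (sref h * sref g)) = 3"
proof -
  have "reduced [h, g, h, g]"
    using len_braid[OF bond4_sym[OF assms]] by (simp add: reduced_def)
  then have "reduced [g, h, g]" by (rule reduced_ConsD)
  then show "len (sref g * (sref h * sref g)) = 3" by (simp add: reduced_def)
  have "reduced [h, g]" using \<open>reduced [g, h, g]\<close> by (rule reduced_ConsD)
  then show "len (sref h * sref g) = 2" by (simp add: reduced_def)
qed

lemma len_r_t: "len (sref gen_r * sref gen_t) = 2"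
proof -
  have "even (len (sref gen_r * sref gen_t))" by (simp add: even_len_mult)
  moreover have "len (sref gen_r * sref gen_t) \<le> 2" using len_mult_le[of "sref gen_r" "sref gen_t"] by simp
  moreover have "len (sref gen_r * sref gen_t) \<noteq> 0"
    using mult_sref_eq_iff[of "sref gen_r" gen_t 1] by auto
  moreover have "n = 2" if "even n" "n \<le> 2" "n \<noteq> 0" for n :: nat using that by presburger
  ultimately show ?thesis by blast
qed

section \<open>Parabolic subgroups and minimal coset representatives\<close>

definition parabolic :: "gen set \<Rightarrow> W set" where
  "parabolic I = word_val ` {ws. set ws \<subseteq> I}"

lemma parabolic_one [simp]: "1 \<in> parabolic I"
  unfolding parabolic_def by (rule image_eqI[of _ _ "[]"]) auto

lemma parabolic_mult:
  assumes "a \<in> parabolic I" "b \<in> parabolic I" shows "a * b \<in> parabolic I"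
proof -
  obtain xs ys where "a = word_val xs" "set xs \<subseteq> I" "b = word_val ys" "set ys \<subseteq> I"
    using assms by (auto simp: parabolic_def)
  then show ?thesis unfolding parabolic_def by (intro image_eqI[of _ _ "xs @ ys"]) auto
qed

lemma parabolic_sref: "g \<in> I \<Longrightarrow> sref g \<in> parabolic I"
  unfolding parabolic_def by (rule image_eqI[of _ _ "[g]"]) auto

lemma parabolic_winv: "a \<in> parabolic I \<Longrightarrow> winv a \<in> parabolic I"
  unfolding parabolic_def by (elim imageE) (rule image_eqI[of _ _ "rev _"]; auto simp: winv_word_val)

text \<open>If g shortens j a, the letter deleted by exchange lies either in the word of j, so that
  g shortens j as well, or in the word of a, which gives an element of the coset shorter than the
  minimal a.\<close>

lemma parabolic_len_add:
  assumes min: "\<And>j. j \<in> parabolic I \<Longrightarrow> len a \<le> len (j * a)" and "i \<in> parabolic I"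
  shows "len (i * a) = len i + len a"
proof -
  have "len (word_val ws * a) = len (word_val ws) + len a" if "set ws \<subseteq> I" for ws
    using that
  proof (induction ws)
    case (Cons g ws)
    let ?j = "word_val ws"
    have IH: "len (?j * a) = len ?j + len a" and g: "g \<in> I" and j: "?j \<in> parabolic I"
      using Cons by (auto simp: parabolic_def)
    have "len (sref g * (?j * a)) \<le> len (sref g * ?j) + len a"
      using len_mult_le[of "sref g * ?j" a] by (simp add: mult.assoc)
    moreover have False if up: "len ?j < len (sref g * ?j)" and down: "len (sref g * (?j * a)) < len (?j * a)"
    proof -
      let ?js = "reduced_word ?j" and ?as = "reduced_word a"
      have val: "word_val (?js @ ?as) = ?j * a" by (simp add: reduced_word)
      obtain xs k ys where del: "?js @ ?as = xs @ k # ys" "sref g * (?j * a) = word_val (xs @ ys)"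
        using strong_exchange[of "sref g" "?js @ ?as"] down unfolding val by auto
      from del(1) consider zs where "?js = xs @ k # zs" "ys = zs @ ?as"
        | zs where "xs = ?js @ zs" "?as = zs @ k # ys"
        by (auto simp: append_eq_append_conv2 append_eq_Cons_conv)
      then show False
      proof cases
        case 1
        then have "sref g * ?j * a = word_val (xs @ zs) * a"
          using del(2) by (simp add: reduced_word mult.assoc)
        then have "sref g * ?j = word_val (xs @ zs)" by simp
        then have "len (sref g * ?j) \<le> length (xs @ zs)" using len_le_length by metis
        also have "\<dots> < length ?js" using 1 by simp
        finally show False using up by (simp add: reduced_word)
      next
        case 2
        then have "sref g * (?j * a) = ?j * word_val (zs @ ys)"
          using del(2) by (simp add: reduced_word)
        then have "(winv ?j * (sref g * ?j)) * a = word_val (zs @ ys)"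
          by (simp add: mult.assoc)
        moreover have "winv ?j * (sref g * ?j) \<in> parabolic I"
          using j g by (intro parabolic_mult parabolic_winv parabolic_sref)
        ultimately have "len a \<le> length (zs @ ys)"
          using min len_le_length[of "zs @ ys"] by (metis le_trans)
        also have "\<dots> < length ?as" using 2 by simp
        finally show False by (simp add: reduced_word)
      qed
    qed
    ultimately show ?case
      using IH len_sref_cases[of g ?j] len_sref_cases[of g "?j * a"]
      by (auto simp: mult.assoc)
  qed simp
  then show ?thesis using assms(2) by (auto simp: parabolic_def)
qed

lemma parabolic_factor:
  obtains i a where "x = i * a" "i \<in> parabolic I" "\<And>j. j \<in> parabolic I \<Longrightarrow> len (j * a) = len j + len a"
proof -
  define P where "P a \<longleftrightarrow> (\<exists>j\<in>parabolic I. a = j * x)" for a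
  have "P x" unfolding P_def by (intro bexI[of _ 1]) simp_all
  then obtain a where a: "P a" "\<And>b. P b \<Longrightarrow> len a \<le> len b"
    using ex_has_least_nat[of P x len] by auto
  then obtain j where j: "j \<in> parabolic I" "a = j * x" by (auto simp: P_def)
  have min: "len a \<le> len (k * a)" if "k \<in> parabolic I" for k
    by (rule a(2)) (use j that parabolic_mult in \<open>auto simp: P_def simp flip: mult.assoc\<close>)
  show thesis
    by (rule that[of "winv j" a]) (use j parabolic_winv parabolic_len_add[OF min] in auto)
qed

lemma parabolic_dihedral:
  assumes "bond4 g h" "i \<in> parabolic {g, h}"
  shows "i \<in> {1, sref g, sref h, sref g * sref h, sref h * sref g, sref g * (sref h * sref g),
    sref h * (sref g * sref h), sref g * (sref h * (sref g * sref h))}"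
proof -
  have "word_val ws \<in> {1, sref g, sref h, sref g * sref h, sref h * sref g, sref g * (sref h * sref g),
    sref h * (sref g * sref h), sref g * (sref h * (sref g * sref h))}" if "set ws \<subseteq> {g, h}" for ws
    using that
  proof (induction ws)
    case (Cons k ws)
    then show ?case using braid[OF assms(1), of 1] braid[OF assms(1), of "sref g"]
      by auto
  qed simp
  then show ?thesis using assms(2) unfolding parabolic_def by blast
qed

lemma parabolic_dihedral_cases:
  assumes "bond4 g h" "i \<in> parabolic {g, h}"
  shows "i = 1 \<or> i = sref g * (sref h * (sref g * sref h)) \<or>
    (len (sref g * i) < len i) \<noteq> (len (sref h * i) < len i)"
proof -
  note lens = len_dihedral[OF assms(1)] len_dihedral[OF bond4_sym[OF assms(1)]]
    len_braid[OF assms(1)] len_braid[OF bond4_sym[OF assms(1)]]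
  show ?thesis using parabolic_dihedral[OF assms] lens by auto
qed

lemma parabolic_r_t:
  assumes "i \<in> parabolic {gen_r, gen_t}"
  shows "i \<in> {1, sref gen_r, sref gen_t, sref gen_r * sref gen_t}"
proof -
  have *: "sref gen_t * (sref gen_r * sref gen_t) = sref gen_r"
    by (metis sref_r_t sref_sref_left)
  have "word_val ws \<in> {1, sref gen_r, sref gen_t, sref gen_r * sref gen_t}"
    if "set ws \<subseteq> {gen_r, gen_t}" for ws
    using that by (induction ws) (auto simp: * simp flip: sref_r_t)
  then show ?thesis using assms unfolding parabolic_def by blast
qed

section \<open>Descent sets and pairs of descents\<close>

definition ld :: "W \<Rightarrow> gen set" where
  "ld w = {g. len (sref g * w) < len w}"

definition rd :: "W \<Rightarrow> gen set" where
  "rd w = {g. len (w * sref g) < len w}"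

lemma rd_eq_ld_winv: "rd w = ld (winv w)"
proof -
  have "len (sref g * winv w) = len (w * sref g)" for g using len_winv[of "w * sref g"] by simp
  then show ?thesis by (simp add: rd_def ld_def)
qed

lemma ld_iff: "g \<in> ld w \<longleftrightarrow> len w = len (sref g * w) + 1" "g \<notin> ld w \<longleftrightarrow> len (sref g * w) = len w + 1"
  using len_sref_cases[of g w] by (auto simp: ld_def)

lemma rd_iff: "g \<in> rd w \<longleftrightarrow> len w = len (w * sref g) + 1" "g \<notin> rd w \<longleftrightarrow> len (w * sref g) = len w + 1"
  using len_sref_cases_right[of w g] by (auto simp: rd_def)

lemma ld_sref_iff: "g \<in> ld (sref g * w) \<longleftrightarrow> g \<notin> ld w"
  using ld_iff[of g w] by (auto simp: ld_def)

lemma ld_one [simp]: "ld 1 = {}"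
  by (simp add: ld_def)

lemma ld_empty_iff: "ld w = {} \<longleftrightarrow> w = 1"
  using ex_descent[of w] by (auto simp: ld_def)

text \<open>Write x = i a with a minimal in its coset. Both generators shorten i, and only the
  longest element of the dihedral group has this property.\<close>

lemma dihedral_factor:
  assumes "bond4 g h" "g \<in> ld x" "h \<in> ld x"
  obtains a where "x = sref g * (sref h * (sref g * (sref h * a)))" "len x = 4 + len a"
proof -
  obtain i a where x: "x = i * a" "i \<in> parabolic {g, h}"
    "\<And>j. j \<in> parabolic {g, h} \<Longrightarrow> len (j * a) = len j + len a"
    by (rule parabolic_factor[of x "{g, h}"]) (rule that)
  have "len (sref k * i) < len i" if "k \<in> {g, h}" for k
  proof -
    have "len (sref k * i * a) = len (sref k * i) + len a"
      using that x(2) by (intro x(3) parabolic_mult parabolic_sref)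
    moreover have "len (sref k * (i * a)) < len (i * a)" using that assms x(1) by (auto simp: ld_def)
    ultimately show ?thesis using x(2,3) by (simp add: mult.assoc)
  qed
  from this[of g] this[of h] have i: "i = sref g * (sref h * (sref g * sref h))"
    using parabolic_dihedral_cases[OF assms(1) x(2)] by auto
  have "len x = 4 + len a" using x(1) x(3)[OF x(2)] i len_braid[OF assms(1)] by simp
  then show thesis using x(1) i by (intro that[of a]) (simp_all add: mult.assoc)
qed

lemma dihedral_minimal:
  assumes "bond4 g h" "g \<notin> ld z" "h \<notin> ld z" "j \<in> parabolic {g, h}"
  shows "len (j * z) = len j + len z"
proof -
  obtain i a where z: "z = i * a" "i \<in> parabolic {g, h}"
    "\<And>j. j \<in> parabolic {g, h} \<Longrightarrow> len (j * a) = len j + len a"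
    by (rule parabolic_factor[of z "{g, h}"]) (rule that)
  have "\<not> len (sref k * i) < len i" if "k \<in> {g, h}" for k
  proof -
    have "len (sref k * i * a) = len (sref k * i) + len a"
      using that z(2) by (intro z(3) parabolic_mult parabolic_sref)
    moreover have "\<not> len (sref k * (i * a)) < len (i * a)" using that assms z(1) by (auto simp: ld_def)
    ultimately show ?thesis using z(2,3) by (simp add: mult.assoc)
  qed
  from this[of g] this[of h] have "i = 1"
    using parabolic_dihedral_cases[OF assms(1) z(2)] len_braid[OF assms(1)] len_dihedral[OF bond4_sym[OF assms(1)]]
    by auto
  then show ?thesis using z assms(4) by simp
qed

lemma r_t_factor:
  assumes "gen_r \<in> ld x" "gen_t \<in> ld x"
  obtains a where "x = sref gen_r * (sref gen_t * a)" "len x = 2 + len a"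
proof -
  obtain i a where x: "x = i * a" "i \<in> parabolic {gen_r, gen_t}"
    "\<And>j. j \<in> parabolic {gen_r, gen_t} \<Longrightarrow> len (j * a) = len j + len a"
    by (rule parabolic_factor[of x "{gen_r, gen_t}"]) (rule that)
  have "len (sref k * i) < len i" if "k \<in> {gen_r, gen_t}" for k
  proof -
    have "len (sref k * i * a) = len (sref k * i) + len a"
      using that x(2) by (intro x(3) parabolic_mult parabolic_sref)
    moreover have "len (sref k * (i * a)) < len (i * a)" using that assms x(1) by (auto simp: ld_def)
    ultimately show ?thesis using x(2,3) by (simp add: mult.assoc)
  qed
  from this[of gen_r] this[of gen_t] have i: "i = sref gen_r * sref gen_t"
    using parabolic_r_t[OF x(2)] len_r_t sref_r_t by auto
  have "len x = 2 + len a" using x(1) x(3)[OF x(2)] i len_r_t by simp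
  then show thesis using x(1) i by (intro that[of a]) (simp_all add: mult.assoc)
qed

text \<open>The longest element of the subgroup generated by g and h is a left factor of y; what
  remains of it after removing a first letter g begins with h.\<close>

lemma two_descents:
  assumes "g \<in> ld y" "h \<in> ld y" "g \<noteq> h" shows "h \<in> ld (sref g * y)"
proof (cases "bond4 g h")
  case True
  then obtain a where a: "y = sref g * (sref h * (sref g * (sref h * a)))" "len y = 4 + len a"
    using assms by (elim dihedral_factor)
  have "len (sref h * (sref g * y)) \<le> 2 + len a"
    using len_mult_le[of "sref g * sref h" a] len_mult_le[of "sref g" "sref h"] by (simp add: a mult.assoc)
  moreover have "len y = len (sref g * y) + 1" using assms(1) by (simp only: ld_iff)
  ultimately show ?thesis using a(2) unfolding ld_def mem_Collect_eq by linarith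
next
  case False
  then have gh: "{g, h} = {gen_r, gen_t}" using gen_pair_cases[OF assms(3)] by auto
  then obtain a where a: "y = sref gen_r * (sref gen_t * a)" "len y = 2 + len a"
    using assms r_t_factor[of y] by (auto simp: doubleton_eq_iff)
  have "sref h * (sref g * y) = a"
    using gh by (auto simp: doubleton_eq_iff a(1)) (metis mult.assoc sref_r_t sref_sref_left)
  moreover have "len y = len (sref g * y) + 1" using assms(1) by (simp only: ld_iff)
  ultimately show ?thesis using a(2) by (simp add: ld_def)
qed


section \<open>Invariance of the \<open>\<mu>\<close>-function under star operations\<close>

lemma kl_coeff_ld:
  "g \<in> ld w \<Longrightarrow> g \<notin> ld x \<Longrightarrow> kl_coeff x w = vpow (- 1) * kl_coeff (sref g * x) w"
  by (rule kl_coeff_descent) (simp_all add: ld_def len_sref_less(3))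

lemma mu_ld: "g \<in> ld w \<Longrightarrow> g \<notin> ld x \<Longrightarrow> mu x w = (if sref g * x = w then 1 else 0)"
  by (rule mu_descent) (simp_all add: ld_def len_sref_less(3))

lemma mu_rd: "g \<in> rd w \<Longrightarrow> g \<notin> rd x \<Longrightarrow> mu x w = (if x * sref g = w then 1 else 0)"
  by (rule mu_descent_right) (simp_all add: rd_def len_sref_less_right(3))

lemma lookup_gen_kl_mult_kl_basis:
  assumes "g \<notin> ld y"
  shows "Poly_Mapping.lookup (ncoeff (gen_kl_mult g (kl_basis y)) x) (- 1) = mu x (sref g * y) +
    (\<Sum>z | z \<in> Poly_Mapping.keys (kl_basis y) \<and> g \<in> ld z. mu z y * mu x z)"
proof -
  have "len y < len (sref g * y)" using assms by (simp add: ld_def len_sref_less(3))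
  from gen_kl_mult_kl_basis_up[OF this] show ?thesis
    by (simp add: ld_def ncoeff_sum lookup_add lookup_sum mu_eq kl_coeff_def)
qed

text \<open>Two applications of \<open>kl_coeff_ld\<close> put v^-2 in front of a coefficient
  without positive exponents, so v^-1 does not occur.\<close>

lemma mu_zero_of_two_descents:
  assumes "g \<in> ld z" "h \<in> ld z" "g \<notin> ld x" "h \<notin> ld (sref g * x)"
  shows "mu x z = 0"
proof -
  have "kl_coeff x z = vpow (- 1) * (vpow (- 1) * kl_coeff (sref h * (sref g * x)) z)"
    using kl_coeff_ld[of g z x] kl_coeff_ld[of h z "sref g * x"] assms by simp
  then show ?thesis by (simp add: mu_eq kl_coeff_pos)
qed

text \<open>Both auxiliary equations compare coefficients of \<open>v\<^sup>-\<^sup>1\<close> in products of a generator with an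
  element of the Kazhdan-Lusztig basis. A summand \<open>C\<^sub>z\<close> with both g and h left descents of z does not
  contribute.\<close>

lemma mu_star:
  assumes gh: "bond4 g h" and a: "g \<notin> ld a" "h \<notin> ld a" and b: "g \<notin> ld b" "h \<notin> ld b"
  shows "mu (sref g * a) (sref g * (sref h * (sref g * b))) =
    mu (sref g * (sref h * (sref g * a))) (sref g * b)"
proof -
  \<comment> \<open>Two strings climbing the cosets of a and b. The claim is \<mu>(x1, y3) =
    \<mu>(x3, y1); both sides are compared with \<mu>(x2, y2).\<close>
  define x1 x2 x3 where "x1 = sref g * a" "x2 = sref h * x1" "x3 = sref g * x2"
  define y1 y2 y3 where "y1 = sref g * b" "y2 = sref h * y1" "y3 = sref g * y2"
  note xdefs = x1_x2_x3_def and ydefs = y1_y2_y3_def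
  have par: "sref g \<in> parabolic {g, h}" "sref h \<in> parabolic {g, h}" by (auto intro: parabolic_sref)
  note lens = len_dihedral[OF gh] len_dihedral[OF bond4_sym[OF gh]]
    len_braid[OF gh] len_braid[OF bond4_sym[OF gh]]
  have len_chain: "len (sref g * c) = 1 + len c" "len (sref h * c) = 1 + len c"
      "len (sref h * (sref g * c)) = 2 + len c"
      "len (sref g * (sref h * (sref g * c))) = 3 + len c"
      "len (sref h * (sref g * (sref h * (sref g * c)))) = 4 + len c" if "g \<notin> ld c" "h \<notin> ld c" for c
    using dihedral_minimal[OF gh that, of "sref g"] dihedral_minimal[OF gh that, of "sref h"]
      dihedral_minimal[OF gh that, of "sref h * sref g"]
      dihedral_minimal[OF gh that, of "sref g * (sref h * sref g)"]
      dihedral_minimal[OF gh that, of "sref h * (sref g * (sref h * sref g))"]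
    by (simp_all add: par lens parabolic_mult mult.assoc)
  note xl = len_chain[OF a] and yl = len_chain[OF b]
  have up: "h \<notin> ld x1" "g \<notin> ld x2" "h \<notin> ld x3" "h \<notin> ld y1" "g \<notin> ld y2"
    and down: "g \<in> ld x1" "h \<in> ld x2" "g \<in> ld y1" "h \<in> ld y2"
    using xl yl by (simp_all add: ld_def xdefs ydefs)
  have one: "mu x2 y2 = mu x1 y1 + mu x3 y1"
  proof -
    \<comment> \<open>If g is not a descent of z, a nonzero \<mu>(z, y1) would force g z = y1, hence
      z = b, which lacks the descent h.\<close>
    have zero: "mu z y1 * mu x2 z = 0" if "h \<in> ld z" for z
    proof (cases "g \<in> ld z")
      case True
      have "mu x2 z = 0"
        by (rule mu_zero_of_two_descents[of g z h]) (use that True up in \<open>simp_all add: xdefs\<close>)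
      then show ?thesis by simp
    next
      case False
      have "sref g * z \<noteq> y1" using that b(2) by (auto simp: ydefs)
      then have "mu z y1 = 0" using mu_ld[of g y1 z] down False by simp
      then show ?thesis by simp
    qed
    have "kl_coeff x2 y1 = vpow (- 1) * kl_coeff x3 y1"
      using kl_coeff_ld[of g y1 x2] up down by (simp add: xdefs)
    then have "ncoeff (gen_kl_mult h (kl_basis y1)) x2 = kl_coeff x1 y1 + kl_coeff x3 y1"
      using down(2) by (simp add: ncoeff_gen_kl_mult ld_def flip: kl_coeff_def) (simp add: xdefs)
    then show ?thesis
      using lookup_gen_kl_mult_kl_basis[OF up(4), of x2] zero
      by (simp add: lookup_add flip: mu_eq ydefs(2))
  qed
  have two: "mu x1 y1 + mu x1 y3 = mu x2 y2"
  proof -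
    have muy: "mu y1 y2 = 1"
      using mu_ld[of h y2 y1] up down by (simp add: ydefs)
    have term_eq: "mu z y2 * mu x1 z = (if z = y1 then mu x1 y1 else 0)" if "g \<in> ld z" for z
    proof (cases "h \<in> ld z")
      case True
      have "mu x1 z = 0"
        by (rule mu_zero_of_two_descents[of h z g]) (use that True up in \<open>simp_all add: xdefs\<close>)
      moreover have "z \<noteq> y1" using True up by auto
      ultimately show ?thesis by simp
    next
      case False
      have "sref h * z = y2 \<longleftrightarrow> z = y1" by (simp add: ydefs)
      then show ?thesis
        using mu_ld[of h y2 z] down False by simp
    qed
    have "y1 \<in> Poly_Mapping.keys (kl_basis y2)"
    proof (rule ccontr)
      assume "y1 \<notin> Poly_Mapping.keys (kl_basis y2)"
      then have "kl_coeff y1 y2 = 0" by (simp add: kl_coeff_def ncoeff_def in_keys_iff)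
      then show False using muy by (simp add: mu_eq)
    qed
    then have sum: "(\<Sum>z | z \<in> Poly_Mapping.keys (kl_basis y2) \<and> g \<in> ld z. mu z y2 * mu x1 z) = mu x1 y1"
      using down by (subst sum.cong[OF refl term_eq]) auto
    \<comment> \<open>The coefficient at a contributes nothing: h a = y2 would mean a = g b, which
      has the descent g.\<close>
    have "sref h * a \<noteq> y2"
      using a(1) b(1) down(3) by (auto simp: ydefs)
    then have "Poly_Mapping.lookup (kl_coeff a y2) (- 1) = 0"
      using kl_coeff_ld[of h y2 a] down a(2) kl_coeff_nonneg[of "sref h * a" y2 0] by simp
    moreover have "kl_coeff x1 y2 = vpow (- 1) * kl_coeff x2 y2"
      using kl_coeff_ld[of h y2 x1] up down by (simp add: xdefs)
    then have "ncoeff (gen_kl_mult g (kl_basis y2)) x1 = kl_coeff a y2 + kl_coeff x2 y2"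
      using down(1) by (simp add: ncoeff_gen_kl_mult ld_def flip: kl_coeff_def) (simp add: xdefs)
    ultimately show ?thesis
      using lookup_gen_kl_mult_kl_basis[OF up(5), of x1] sum
      by (simp add: lookup_add flip: mu_eq ydefs(3))
  qed
  show ?thesis using one two by (simp add: xdefs ydefs)
qed

lemma len_not_ld: "g \<notin> ld w \<Longrightarrow> len (sref g * w) = len w + 1"
  and len_ld: "g \<in> ld w \<Longrightarrow> len w = len (sref g * w) + 1"
  and len_not_rd: "g \<notin> rd w \<Longrightarrow> len (w * sref g) = len w + 1"
  using ld_iff rd_iff by auto

section \<open>Left cells\<close>

lemma left_descents_eq: "left_descents w = sref ` ld w"
  by (auto simp: left_descents_def simple_refls_def ld_def bruhat_less_sref)

lemma right_descents_eq: "right_descents w = sref ` rd w"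
  by (auto simp: right_descents_def simple_refls_def rd_def bruhat_less_sref_right)

lemma inj_sref: "inj sref"
  by (simp add: inj_def)

lemma left_descents_subset: "left_descents x \<subseteq> left_descents y \<longleftrightarrow> ld x \<subseteq> ld y"
  by (simp add: left_descents_eq inj_image_subset_iff[OF inj_sref])

lemma right_descents_subset: "right_descents x \<subseteq> right_descents y \<longleftrightarrow> rd x \<subseteq> rd y"
  by (simp add: right_descents_eq inj_image_subset_iff[OF inj_sref])

definition cell_step :: "W \<Rightarrow> W \<Rightarrow> bool" where
  "cell_step x y \<longleftrightarrow> (mu x y \<noteq> 0 \<or> mu y x \<noteq> 0) \<and> \<not> ld x \<subseteq> ld y"

lemma cell_le_L_eq: "cell_le_L = cell_step\<^sup>*\<^sup>*"
proof -
  have "joined x y \<longleftrightarrow> mu x y \<noteq> 0 \<or> mu y x \<noteq> 0" for x y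
    unfolding joined_def using mu_nonzeroD(4) by blast
  then show ?thesis by (simp add: cell_le_L_def cell_step_def[abs_def] left_descents_subset)
qed

lemma cell_le_L_refl [simp]: "x \<le>\<^sub>L x"
  by (simp add: cell_le_L_eq)

lemma cell_le_L_trans: "x \<le>\<^sub>L y \<Longrightarrow> y \<le>\<^sub>L z \<Longrightarrow> x \<le>\<^sub>L z"
  by (simp add: cell_le_L_eq)

lemma cell_step_le_L: "cell_step x y \<Longrightarrow> x \<le>\<^sub>L y"
  by (auto simp: cell_le_L_eq)

lemma cell_eq_L_refl [simp]: "x \<sim>\<^sub>L x"
  by (simp add: cell_eq_L_def)

lemma cell_eq_L_sym: "x \<sim>\<^sub>L y \<Longrightarrow> y \<sim>\<^sub>L x"
  by (simp add: cell_eq_L_def)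

lemma cell_eq_L_trans: "x \<sim>\<^sub>L y \<Longrightarrow> y \<sim>\<^sub>L z \<Longrightarrow> x \<sim>\<^sub>L z"
  using cell_le_L_trans by (auto simp: cell_eq_L_def)

lemma cell_eq_R_iff: "x \<sim>\<^sub>R y \<longleftrightarrow> winv x \<sim>\<^sub>L winv y"
  by (simp add: cell_eq_R_def cell_le_R_def cell_eq_L_def)

lemma mu_sref: "g \<notin> ld y \<Longrightarrow> mu y (sref g * y) = 1"
  by (simp add: mu_ld[of g] ld_sref_iff)

lemma sref_mult_le_L: "g \<notin> ld y \<Longrightarrow> sref g * y \<le>\<^sub>L y"
  using ld_sref_iff[of g y] by (intro cell_step_le_L) (auto simp: cell_step_def mu_sref)

lemma le_L_sref_mult: "g \<notin> ld y \<Longrightarrow> \<not> ld y \<subseteq> ld (sref g * y) \<Longrightarrow> y \<le>\<^sub>L sref g * y"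
  by (intro cell_step_le_L) (auto simp: cell_step_def mu_sref)

lemma sref_mult_eq_L: "g \<notin> ld y \<Longrightarrow> \<not> ld y \<subseteq> ld (sref g * y) \<Longrightarrow> sref g * y \<sim>\<^sub>L y"
  by (simp add: cell_eq_L_def sref_mult_le_L le_L_sref_mult)

text \<open>Some left descent g of x is missing from y, so by \<open>mu_ld\<close> a nonzero
  \<mu>(y, x) is possible only for x = g y.\<close>

lemma cell_step_cases:
  assumes "cell_step x y"
  obtains (up) g where "g \<notin> ld y" "x = sref g * y" | (down) "mu x y \<noteq> 0"
proof (cases "mu x y = 0")
  case True
  then obtain g where "g \<in> ld x" "g \<notin> ld y" "mu y x \<noteq> 0" using assms by (auto simp: cell_step_def)
  then show thesis using mu_ld[of g x y] up[of g] by (auto split: if_splits)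
qed (use down in blast)

text \<open>Going up, right descents survive a lengthening multiplication from the left. Going down,
  a right descent h of y that x lacks would force y = x h, and then the left descents of x would be
  left descents of y.\<close>

lemma cell_step_rd: assumes "cell_step x y" shows "rd y \<subseteq> rd x"
  using assms
proof (cases rule: cell_step_cases)
  case (up g)
  show ?thesis
  proof
    fix h assume "h \<in> rd y"
    have "len (sref g * (y * sref h)) \<le> 1 + len (y * sref h)"
      using len_mult_le[of "sref g" "y * sref h"] by simp
    also have "\<dots> = len y" using \<open>h \<in> rd y\<close> by (simp add: rd_iff)
    also have "\<dots> < len (sref g * y)" using up(1) by (simp add: len_not_ld)
    finally show "h \<in> rd x" by (simp add: rd_def up(2) mult.assoc)
  qed
next
  case down
  show ?thesis
  proof (rule ccontr)
    assume "\<not> rd y \<subseteq> rd x"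
    then obtain h where h: "h \<in> rd y" "h \<notin> rd x" by blast
    then have y: "y = x * sref h" using mu_rd[of h y x] down by (auto split: if_splits)
    obtain g where g: "g \<in> ld x" "g \<notin> ld y" using assms by (auto simp: cell_step_def)
    have "len (sref g * x * sref h) \<le> len (sref g * x) + 1"
      using len_mult_le[of "sref g * x" "sref h"] by simp
    also have "\<dots> = len x" using g(1) by (simp add: ld_iff)
    also have "\<dots> < len y" using h(2) by (simp add: y len_not_rd)
    finally show False using g(2) by (simp add: y ld_def mult.assoc)
  qed
qed

lemma cell_le_L_rd: "x \<le>\<^sub>L y \<Longrightarrow> rd y \<subseteq> rd x"
  unfolding cell_le_L_eq by (induction rule: rtranclp_induct) (use cell_step_rd in blast)+

lemma cell_eq_L_rd: "x \<sim>\<^sub>L y \<Longrightarrow> rd x = rd y"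
  using cell_le_L_rd by (auto simp: cell_eq_L_def)

lemma cell_eq_R_ld: "x \<sim>\<^sub>R y \<Longrightarrow> ld x = ld y"
  using cell_eq_L_rd by (fastforce simp: cell_eq_R_iff rd_eq_ld_winv)


section \<open>Elements with a unique reduced word\<close>

definition unique_word :: "W \<Rightarrow> bool" where
  "unique_word w \<longleftrightarrow>
     (\<forall>xs ys. reduced xs \<and> reduced ys \<and> word_val xs = w \<and> word_val ys = w \<longrightarrow> xs = ys)"

lemma unique_word_one [simp]: "unique_word 1"
proof -
  have "reduced xs \<Longrightarrow> word_val xs = 1 \<Longrightarrow> xs = []" for xs
    by (simp add: reduced_def)
  then show ?thesis unfolding unique_word_def by metis
qed

lemma reduced_Cons_ld: "reduced (g # ws) \<longleftrightarrow> reduced ws \<and> g \<notin> ld (word_val ws)"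
  using len_sref_less(3)[of g "word_val ws"] by (auto simp: reduced_Cons_iff ld_def)

lemma unique_word_sref_mult:
  assumes "unique_word w" "g \<in> ld w" shows "unique_word (sref g * w)"
  unfolding unique_word_def
proof (intro allI impI)
  fix xs ys
  assume *: "reduced xs \<and> reduced ys \<and> word_val xs = sref g * w \<and> word_val ys = sref g * w"
  then have "reduced (g # xs)" "reduced (g # ys)" using assms(2) by (auto simp: reduced_Cons_ld ld_sref_iff)
  moreover have "word_val (g # xs) = w" "word_val (g # ys) = w" using * by auto
  ultimately have "g # xs = g # ys" using assms(1) unfolding unique_word_def by blast
  then show "xs = ys" by simp
qed

lemma reduced_word_starting_with:
  assumes "g \<in> ld w" obtains ws where "reduced (g # ws)" "word_val (g # ws) = w"
  using that[of "reduced_word (sref g * w)"] assms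
  by (simp add: reduced_Cons_ld reduced_word ld_sref_iff)

lemma unique_word_ld:
  assumes "unique_word w" "g \<in> ld w" "h \<in> ld w" shows "g = h"
proof -
  obtain xs ys where "reduced (g # xs)" "word_val (g # xs) = w" "reduced (h # ys)" "word_val (h # ys) = w"
    using reduced_word_starting_with assms(2,3) by metis
  then have "g # xs = h # ys" using assms(1) unfolding unique_word_def by blast
  then show ?thesis by simp
qed

lemma unique_wordI:
  assumes "unique_word (sref g * w)" "ld w \<subseteq> {g}" shows "unique_word w"
  unfolding unique_word_def
proof (intro allI impI)
  fix xs ys
  assume *: "reduced xs \<and> reduced ys \<and> word_val xs = w \<and> word_val ys = w"
  show "xs = ys"
  proof (cases "w = 1")
    case True
    then show ?thesis using * unique_word_one unfolding unique_word_def by blast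
  next
    case False
    have "\<exists>vs. ws = g # vs \<and> reduced vs \<and> word_val vs = sref g * w" if "reduced ws" "word_val ws = w" for ws
    proof -
      obtain k vs where ws: "ws = k # vs" using \<open>word_val ws = w\<close> False by (cases ws) auto
      with that have "k \<in> ld w" by (auto simp: reduced_Cons_ld ld_sref_iff)
      then have "k = g" using assms(2) by blast
      then show ?thesis using ws that by (auto simp: reduced_Cons_ld)
    qed
    then show ?thesis using * assms(1) unfolding unique_word_def by metis
  qed
qed

lemma unique_word_winv: "unique_word (winv w) \<longleftrightarrow> unique_word w"
proof -
  have "unique_word (winv w)" if "unique_word w" for w
    unfolding unique_word_def
  proof (intro allI impI)
    fix xs ys
    assume "reduced xs \<and> reduced ys \<and> word_val xs = winv w \<and> word_val ys = winv w"
    then have "reduced (rev xs)" "reduced (rev ys)" "word_val (rev xs) = w" "word_val (rev ys) = w"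
      by (simp_all add: reduced_rev flip: winv_word_val)
    then have "rev xs = rev ys" using that unfolding unique_word_def by blast
    then show "xs = ys" by simp
  qed
  from this[of w] this[of "winv w"] show ?thesis by auto
qed

text \<open>In the descending case suppose x has a unique reduced word, with first letter g. A left
  descent h of y is not one of x, so \<mu> forces y = h x. As y has several reduced words, it has a
  second descent k, which by \<open>two_descents\<close> remains one of x. So k = g, although g is
  not a descent of y.\<close>

lemma cell_step_unique_word:
  assumes step: "cell_step x y" and y: "\<not> unique_word y" shows "\<not> unique_word x"
  using step
proof (cases rule: cell_step_cases)
  case (up g)
  then show ?thesis using unique_word_sref_mult[of x g] y by (auto simp: ld_sref_iff)
next
  case down
  show ?thesis
  proof
    assume x: "unique_word x"
    obtain g where g: "g \<in> ld x" "g \<notin> ld y" using step by (auto simp: cell_step_def)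
    have ldx: "k = g" if "k \<in> ld x" for k using unique_word_ld[OF x that g(1)] .
    have "ld y \<noteq> {}" using y by (auto simp: ld_empty_iff)
    then obtain h where h: "h \<in> ld y" by blast
    then have "h \<notin> ld x" using ldx g by blast
    then have y_eq: "x = sref h * y" using mu_ld[of h y x] h down by (auto split: if_splits)
    then have "\<not> ld y \<subseteq> {h}" using unique_wordI[of h y] x y by auto
    then obtain k where k: "k \<in> ld y" "k \<noteq> h" by blast
    then have "k \<in> ld x" unfolding y_eq using two_descents[OF h k(1)] by simp
    then show False using ldx k(1) g(2) by blast
  qed
qed

lemma cell_le_L_unique_word: "x \<le>\<^sub>L y \<Longrightarrow> unique_word x \<Longrightarrow> unique_word y"
  unfolding cell_le_L_eq by (induction rule: rtranclp_induct) (use cell_step_unique_word in blast)+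

lemma cell_eq_R_unique_word: "x \<sim>\<^sub>R y \<Longrightarrow> unique_word x \<longleftrightarrow> unique_word y"
  using cell_le_L_unique_word by (metis cell_eq_L_def cell_eq_R_iff unique_word_winv)

text \<open>Removing the first letter stays within the left cell, since the second letter becomes a
  descent that was absent before; the last letter remains.\<close>

lemma unique_word_cell:
  assumes "unique_word z" "z \<noteq> 1" shows "\<exists>g. z \<sim>\<^sub>L sref g"
  using assms
proof (induction "len z" arbitrary: z rule: less_induct)
  case less
  obtain g where g: "g \<in> ld z" using less.prems(2) ld_empty_iff by blast
  let ?y = "sref g * z"
  have z: "z = sref g * ?y" and gy: "g \<notin> ld ?y" using g ld_sref_iff[of g ?y] by auto
  show ?case
  proof (cases "?y = 1")
    case True
    then have "z = sref g" using z by simp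
    then show ?thesis using cell_eq_L_refl by blast
  next
    case False
    then obtain h where h: "h \<in> ld ?y" using ld_empty_iff by blast
    have "h \<notin> ld z" using unique_word_ld[OF less.prems(1) g, of h] h gy by auto
    then have "\<not> ld ?y \<subseteq> ld (sref g * ?y)" using h by auto
    from sref_mult_eq_L[OF gy this] have "z \<sim>\<^sub>L ?y" using z by simp
    moreover have "\<exists>k. ?y \<sim>\<^sub>L sref k"
      using less.hyps[of ?y] g False unique_word_sref_mult[OF less.prems(1) g] by (simp add: ld_def)
    ultimately show ?thesis using cell_eq_L_trans by blast
  qed
qed

lemma unique_word_rd:
  assumes "unique_word z" "g \<in> rd z" "h \<in> rd z" shows "g = h"
  using assms unique_word_ld[of "winv z"] by (simp add: unique_word_winv rd_eq_ld_winv)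

lemma unique_word_rd_cell:
  assumes "unique_word u" "unique_word w" "u \<noteq> 1" "w \<noteq> 1" "rd u = rd w" shows "u \<sim>\<^sub>L w"
proof -
  obtain g h where gh: "u \<sim>\<^sub>L sref g" "w \<sim>\<^sub>L sref h" using assms unique_word_cell by metis
  then have "g \<in> rd u" "h \<in> rd w" by (auto dest!: cell_eq_L_rd simp: rd_def)
  then have "g = h" using unique_word_rd assms by blast
  then show ?thesis using gh cell_eq_L_sym cell_eq_L_trans by blast
qed


section \<open>Braid-free elements\<close>

text \<open>These are the fully commutative elements: no reduced word contains a braid word of
  length 4.\<close>

definition braid_free :: "W \<Rightarrow> bool" where
  "braid_free z \<longleftrightarrow> (\<nexists>a g h b. bond4 g h \<and> z = a * (sref g * (sref h * (sref g * (sref h * b)))) \<and>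
     len z = len a + 4 + len b)"

lemma braid_free_suffix:
  assumes "braid_free (x * y)" "len (x * y) = len x + len y" shows "braid_free y"
  unfolding braid_free_def
proof
  assume "\<exists>a g h b. bond4 g h \<and> y = a * (sref g * (sref h * (sref g * (sref h * b)))) \<and> len y = len a + 4 + len b"
  then obtain a g h b where *: "bond4 g h" "y = a * (sref g * (sref h * (sref g * (sref h * b))))"
    "len y = len a + 4 + len b" by blast
  have "len (x * y) \<le> len (x * a) + len (sref g * (sref h * (sref g * (sref h * b))))"
    using len_mult_le[of "x * a"] by (simp add: *(2) mult.assoc)
  moreover have "len (sref g * (sref h * (sref g * (sref h * b)))) \<le> 4 + len b"
    using len_mult_le[of "sref g * (sref h * (sref g * sref h))" b] len_braid[OF *(1)] by (simp add: mult.assoc)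
  ultimately have "len (x * y) = len (x * a) + 4 + len b"
    using assms(2) *(3) len_mult_le[of x a] by linarith
  then show False
    using assms(1) *(1,2) unfolding braid_free_def by (metis mult.assoc)
qed

lemma braid_free_winv: "braid_free (winv z) \<longleftrightarrow> braid_free z"
proof -
  have "braid_free (winv z)" if "braid_free z" for z
    unfolding braid_free_def
  proof
    assume "\<exists>a g h b. bond4 g h \<and> winv z = a * (sref g * (sref h * (sref g * (sref h * b)))) \<and>
      len (winv z) = len a + 4 + len b"
    then obtain a g h b where *: "bond4 g h" "winv z = a * (sref g * (sref h * (sref g * (sref h * b))))"
      "len (winv z) = len a + 4 + len b" by blast
    from *(2) have "winv (winv z) = winv (a * (sref g * (sref h * (sref g * (sref h * b)))))" by simp
    then have "z = winv b * (sref h * (sref g * (sref h * (sref g * winv a))))"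
      by (simp only: winv_winv winv_mult winv_sref mult.assoc)
    then show False
      using that bond4_sym[OF *(1)] *(3) unfolding braid_free_def
      by (metis add.commute add.left_commute len_winv)
  qed
  from this[of z] this[of "winv z"] show ?thesis by auto
qed

lemma braid_free_ld:
  assumes "braid_free z" "g \<in> ld z" "h \<in> ld z" shows "\<not> bond4 g h"
proof
  assume "bond4 g h"
  then obtain a where "z = sref g * (sref h * (sref g * (sref h * a)))" "len z = 4 + len a"
    using assms(2,3) by (rule dihedral_factor)
  then have "z = 1 * (sref g * (sref h * (sref g * (sref h * a))))" "len z = len 1 + 4 + len a" by simp_all
  then show False using assms(1) \<open>bond4 g h\<close> unfolding braid_free_def by blast
qed

lemma braid_free_rd:
  assumes "braid_free z" "g \<in> rd z" "h \<in> rd z" shows "\<not> bond4 g h"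
  using braid_free_ld[of "winv z" g h] assms by (simp add: rd_eq_ld_winv braid_free_winv)

lemma braid_free_sref_mult:
  assumes "braid_free z" "g \<in> ld z" shows "braid_free (sref g * z)"
  using braid_free_suffix[of "sref g" "sref g * z"] assms by (simp add: ld_iff(1))

lemma braid_free_sref_multD:
  assumes "braid_free (sref g * z)" "g \<notin> ld z" shows "braid_free z"
  using braid_free_sref_mult[OF assms(1), of g] assms(2) by (simp add: ld_sref_iff)

text \<open>Ordered versions of the pair r, t, so that arguments symmetric in r and t are made
  once.\<close>

definition commuting_gens :: "gen \<Rightarrow> gen \<Rightarrow> bool" where
  "commuting_gens p q \<longleftrightarrow> p = gen_r \<and> q = gen_t \<or> p = gen_t \<and> q = gen_r"

lemma commuting_gens_sym: "commuting_gens p q \<Longrightarrow> commuting_gens q p"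
  by (auto simp: commuting_gens_def)

lemma commuting_gensD:
  assumes "commuting_gens p q"
  shows "sref p * (sref q * x) = sref q * (sref p * x)" "p \<noteq> q" "bond4 p gen_s" "bond4 gen_s p"
    "bond4 q gen_s" "bond4 gen_s q" "g = p \<or> g = q \<or> g = gen_s"
  using assms sref_r_t by (auto simp: commuting_gens_def simp flip: mult.assoc) (cases g; simp)+

lemma commuting_factor:
  assumes "commuting_gens p q" "p \<in> ld z" "q \<in> ld z"
  obtains a where "z = sref p * (sref q * a)" "len z = 2 + len a" "p \<notin> ld a" "q \<notin> ld a"
    "p \<notin> ld (sref q * a)" "q \<notin> ld (sref p * a)"
proof -
  have "gen_r \<in> ld z" "gen_t \<in> ld z" using assms by (auto simp: commuting_gens_def)
  then obtain a where "z = sref gen_r * (sref gen_t * a)" and len: "len z = 2 + len a" by (rule r_t_factor)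
  then have z: "z = sref p * (sref q * a)" "z = sref q * (sref p * a)"
    using assms(1) commuting_gensD(1)[OF assms(1), of a] by (auto simp: commuting_gens_def)
  have l: "len (sref p * a) \<le> 1 + len a" "len (sref q * a) \<le> 1 + len a"
    using len_mult_le[of "sref p" a] len_mult_le[of "sref q" a] by simp_all
  have "len (sref p * (sref q * a)) = 2 + len a" "len (sref q * (sref p * a)) = 2 + len a"
    using len z by simp_all
  then show thesis
    using l len_mult_le[of "sref p" "sref q * a"] len_mult_le[of "sref q" "sref p * a"]
    by (intro that[of a] z len) (auto simp: ld_def)
qed

section \<open>Braid-free elements starting with rt\<close>

definition rt_start :: "W \<Rightarrow> bool" where
  "rt_start z \<longleftrightarrow> braid_free z \<and> gen_r \<in> ld z \<and> gen_t \<in> ld z"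

lemma rt_startD:
  assumes "rt_start z" "commuting_gens p q" shows "braid_free z" "p \<in> ld z" "q \<in> ld z"
  using assms by (auto simp: rt_start_def commuting_gens_def)

lemma rt_start_s: assumes "rt_start z" shows "gen_s \<notin> ld z"
  using braid_free_ld[of z gen_r gen_s] assms by (auto simp: rt_start_def)

lemma rt_start_sref_mult_s:
  assumes "rt_start z" "commuting_gens p q" shows "gen_s \<notin> ld (sref p * z)"
proof
  assume s: "gen_s \<in> ld (sref p * z)"
  note z = rt_startD[OF assms]
  have "q \<in> ld (sref p * z)" using two_descents[of p z q] z commuting_gensD(2)[OF assms(2)] by simp
  then show False
    using braid_free_ld[OF braid_free_sref_mult[OF z(1,2)] s] commuting_gensD(6)[OF assms(2)] by simp
qed

text \<open>Braid-freeness is not given for s z, so the contradiction is moved to p z: from s z = s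
  p s p a follows p z = s p a, with s as a left descent.\<close>

lemma rt_start_s_mult:
  assumes z: "rt_start z" and pq: "commuting_gens p q"
  shows "p \<notin> ld (sref gen_s * z)"
proof
  assume p: "p \<in> ld (sref gen_s * z)"
  have "gen_s \<in> ld (sref gen_s * z)" using rt_start_s[OF z] by (simp add: ld_sref_iff)
  from dihedral_factor[OF commuting_gensD(4)[OF pq] this p] obtain a
    where a: "sref gen_s * z = sref gen_s * (sref p * (sref gen_s * (sref p * a)))"
      "len (sref gen_s * z) = 4 + len a" .
  then have pz: "sref p * z = sref gen_s * (sref p * a)" by simp
  have "len (sref p * z) = 2 + len a"
    using a(2) len_not_ld[OF rt_start_s[OF z]] len_ld[OF rt_startD(2)[OF z pq]] by simp
  moreover have "len (sref p * a) \<le> 1 + len a" using len_mult_le[of "sref p" a] by simp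
  ultimately have "gen_s \<in> ld (sref p * z)" by (simp add: pz ld_def)
  then show False using rt_start_sref_mult_s[OF z pq] by simp
qed

text \<open>A descent s would again make s a descent of p z; a descent q would survive the removal
  of p and be a descent of s z.\<close>

lemma rt_start_ps_mult:
  assumes z: "rt_start z" and pq: "commuting_gens p q"
  shows "gen_s \<notin> ld (sref p * (sref gen_s * z))" "q \<notin> ld (sref p * (sref gen_s * z))"
proof -
  have p: "p \<in> ld (sref p * (sref gen_s * z))" using rt_start_s_mult[OF z pq] by (simp add: ld_sref_iff)
  show "gen_s \<notin> ld (sref p * (sref gen_s * z))"
  proof
    assume "gen_s \<in> ld (sref p * (sref gen_s * z))"
    from dihedral_factor[OF commuting_gensD(3)[OF pq] p this] obtain a
      where a: "sref p * (sref gen_s * z) = sref p * (sref gen_s * (sref p * (sref gen_s * a)))"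
        "len (sref p * (sref gen_s * z)) = 4 + len a" .
    then have pz: "sref p * z = sref gen_s * a" by simp
    have "len (sref p * z) = 1 + len a"
      using a(2) len_not_ld[OF rt_start_s[OF z]] len_ld[OF rt_startD(2)[OF z pq]]
        len_not_ld[OF rt_start_s_mult[OF z pq]] by simp
    then have "gen_s \<in> ld (sref p * z)" by (simp add: pz ld_def)
    then show False using rt_start_sref_mult_s[OF z pq] by simp
  qed
  show "q \<notin> ld (sref p * (sref gen_s * z))"
  proof
    assume "q \<in> ld (sref p * (sref gen_s * z))"
    then have "q \<in> ld (sref p * (sref p * (sref gen_s * z)))"
      using two_descents[OF p] commuting_gensD(2)[OF pq] by blast
    then show False using rt_start_s_mult[OF z commuting_gens_sym[OF pq]] by simp
  qed
qed

lemma commuting_r_t: "commuting_gens gen_r gen_t" "commuting_gens gen_t gen_r"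
  by (simp_all add: commuting_gens_def)

text \<open>The way back from z to \<open>z\<^sub>1\<close> uses an edge of length difference 5, which the star operation turns
  into the covering of \<open>t s z\<^sub>1\<close> by z.\<close>

lemma rt_start_cell:
  assumes z1: "rt_start z1" and z: "rt_start z" "z = sref gen_r * (sref gen_t * (sref gen_s * z1))"
  shows "z \<sim>\<^sub>L z1"
proof -
  let ?y = "sref gen_t * (sref gen_s * z1)"
  note s = rt_start_s and st = rt_start_s_mult[OF _ commuting_r_t(2)]
    and ts = rt_start_ps_mult[OF _ commuting_r_t(2)]
  have y_z1: "?y \<le>\<^sub>L z1"
    using sref_mult_le_L[OF s[OF z1]] sref_mult_le_L[OF st[OF z1]] cell_le_L_trans by blast
  have "z \<le>\<^sub>L ?y" unfolding z(2) by (rule sref_mult_le_L) (rule ts(2)[OF z1])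
  then have le: "z \<le>\<^sub>L z1" using y_z1 cell_le_L_trans by blast
  have tt: "gen_t \<notin> ld (sref gen_t * x)" if "rt_start x" for x
    using that by (simp add: ld_sref_iff rt_start_def)
  \<comment> \<open>\<open>mu_star\<close> is used with a = t \<open>z1\<close> and b = t z, so that
    t a = \<open>z1\<close> and t s t b = t s z.\<close>
  have "mu z1 (sref gen_t * (sref gen_s * z)) = mu ?y z"
    using mu_star[of gen_t gen_s "sref gen_t * z1" "sref gen_t * z"] tt z1 z(1)
      rt_start_sref_mult_s[OF _ commuting_r_t(2)] by simp
  also have "\<dots> = 1" unfolding z(2) by (rule mu_sref) (rule ts(2)[OF z1])
  finally have "mu z1 (sref gen_t * (sref gen_s * z)) \<noteq> 0" by simp
  moreover have "\<not> ld z1 \<subseteq> ld (sref gen_t * (sref gen_s * z))"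
    using ts(2)[OF z(1)] z1 by (auto simp: rt_start_def)
  ultimately have "z1 \<le>\<^sub>L sref gen_t * (sref gen_s * z)"
    by (intro cell_step_le_L) (simp add: cell_step_def)
  also note [trans] = cell_le_L_trans
  have "sref gen_t * (sref gen_s * z) \<le>\<^sub>L sref gen_s * z" by (rule sref_mult_le_L) (rule st[OF z(1)])
  also have "sref gen_s * z \<le>\<^sub>L z" by (rule sref_mult_le_L) (rule s[OF z(1)])
  finally show ?thesis using le by (simp add: cell_eq_L_def)
qed

text \<open>The braid-free elements starting with rt are \<open>(rts)\<^sup>m b\<close> with one of the following four elements b,
  which are told apart by their right descents.\<close>

definition rt_base :: "W \<Rightarrow> bool" where
  "rt_base b \<longleftrightarrow> braid_free b \<and>
     (b = word_val [gen_r, gen_t] \<and> len b = 2 \<or> b = word_val [gen_r, gen_t, gen_s] \<and> len b = 3 \<or>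
      b = word_val [gen_r, gen_t, gen_s, gen_r] \<and> len b = 4 \<or>
      b = word_val [gen_r, gen_t, gen_s, gen_t] \<and> len b = 4)"

text \<open>After rt the element ends or continues with s, so z = r t s b. If r and t are both
  descents of b, then b starts with rt again; if just one of them is, braid-freeness forces b to be
  that single letter.\<close>

lemma rt_start_step:
  assumes "rt_start z"
  shows "rt_base z \<or> (\<exists>z1. rt_start z1 \<and> z = sref gen_r * (sref gen_t * (sref gen_s * z1)) \<and> len z = 3 + len z1)"
proof -
  have z: "braid_free z" "gen_r \<in> ld z" "gen_t \<in> ld z" using assms by (auto simp: rt_start_def)
  from commuting_factor[OF commuting_r_t(1) z(2,3)] obtain a where
    a: "z = sref gen_r * (sref gen_t * a)" "len z = 2 + len a" "gen_r \<notin> ld a" "gen_t \<notin> ld a"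
      "gen_r \<notin> ld (sref gen_t * a)" .
  have fa: "braid_free a"
    using z(1) a by (metis braid_free_sref_multD)
  show ?thesis
  proof (cases "a = 1")
    case True
    then show ?thesis using a z(1) by (simp add: rt_base_def)
  next
    case False
    then obtain k where "k \<in> ld a" using ld_empty_iff by blast
    then have s: "gen_s \<in> ld a" using a(3,4) by (cases k) auto
    define b where "b = sref gen_s * a"
    have b: "a = sref gen_s * b" "len a = 1 + len b" "gen_s \<notin> ld b" "braid_free b"
      using s fa braid_free_sref_mult by (auto simp: b_def ld_iff(1) ld_sref_iff)
    \<comment> \<open>A letter after p could only be s, since q commutes with p and would be a
      descent of b. Then p s p s occurs in z once its initial r t is written as q p.\<close>
    have one_sided: "b = sref p \<and> len b = 1" if pq: "commuting_gens p q" and p: "p \<in> ld b" and q: "q \<notin> ld b" for p q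
    proof -
      define c where "c = sref p * b"
      have c: "b = sref p * c" "len b = 1 + len c" using p by (simp_all add: c_def ld_iff(1))
      have "c = 1"
      proof (rule ccontr)
        assume "c \<noteq> 1"
        then obtain k where k: "k \<in> ld c" using ld_empty_iff by blast
        have "k \<noteq> p" using k p by (auto simp: c_def ld_sref_iff)
        moreover have "k \<noteq> q"
        proof
          assume "k = q"
          have "len (sref q * b) \<le> 1 + len (sref q * c)"
            using len_mult_le[of "sref p" "sref q * c"] by (simp add: c(1) commuting_gensD(1)[OF pq, symmetric])
          also have "\<dots> = len c" using k by (simp add: \<open>k = q\<close> ld_iff(1))
          finally have "len (sref q * b) < len b" using c(2) by simp
          then show False using q by (simp add: ld_def)
        qed
        ultimately have "k = gen_s" using commuting_gensD(7)[OF pq] by blast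
        define d where "d = sref gen_s * c"
        have d: "c = sref gen_s * d" "len c = 1 + len d" using k by (simp_all add: d_def \<open>k = gen_s\<close> ld_iff(1))
        have z_pq: "z = sref q * (sref p * a)"
          using pq a(1) commuting_gensD(1)[OF pq, of a] by (auto simp: commuting_gens_def)
        have "z = sref q * (sref p * (sref gen_s * (sref p * (sref gen_s * d))))" "len z = len (sref q) + 4 + len d"
          using z_pq a(2) b c d by simp_all
        then show False using z(1) commuting_gensD(3)[OF pq] unfolding braid_free_def by blast
      qed
      then show ?thesis using c by simp
    qed
    have zb: "z = sref gen_r * (sref gen_t * (sref gen_s * b))" "len z = 3 + len b" using a b by simp_all
    consider "gen_r \<in> ld b" "gen_t \<in> ld b" | "gen_r \<in> ld b" "gen_t \<notin> ld b" | "gen_t \<in> ld b" "gen_r \<notin> ld b"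
      | "gen_r \<notin> ld b" "gen_t \<notin> ld b" by blast
    then show ?thesis
    proof cases
      case 1
      then show ?thesis using b zb by (auto simp: rt_start_def)
    next
      case 2
      then show ?thesis using one_sided[OF commuting_r_t(1)] zb z(1) by (simp add: rt_base_def)
    next
      case 3
      then show ?thesis using one_sided[OF commuting_r_t(2)] zb z(1) by (simp add: rt_base_def)
    next
      case 4
      have "ld b = {}"
      proof (rule equals0I)
        fix k assume "k \<in> ld b" then show False using 4 b(3) by (cases k) auto
      qed
      then have "b = 1" by (simp add: ld_empty_iff)
      then show ?thesis using zb z(1) by (simp add: rt_base_def)
    qed
  qed
qed

lemma rt_start_normal_form:
  assumes "rt_start z"
  shows "\<exists>m b. rt_base b \<and> z = word_val [gen_r, gen_t, gen_s] ^ m * b \<and> len z = 3 * m + len b \<and> z \<sim>\<^sub>L b"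
  using assms
proof (induction "len z" arbitrary: z rule: less_induct)
  case less
  show ?case
  proof (cases "rt_base z")
    case True
    then show ?thesis by (intro exI[of _ 0] exI[of _ z]) simp
  next
    case False
    then obtain z1 where z1: "rt_start z1" "z = sref gen_r * (sref gen_t * (sref gen_s * z1))" "len z = 3 + len z1"
      using rt_start_step[OF less.prems] by blast
    then obtain m b where mb: "rt_base b" "z1 = word_val [gen_r, gen_t, gen_s] ^ m * b"
      "len z1 = 3 * m + len b" "z1 \<sim>\<^sub>L b"
      using less.hyps[of z1] by auto
    have "z \<sim>\<^sub>L b" using rt_start_cell[OF z1(1) less.prems z1(2)] mb(4) by (rule cell_eq_L_trans)
    moreover have "z = word_val [gen_r, gen_t, gen_s] ^ Suc m * b" using z1(2) mb(2) by (simp add: mult.assoc)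
    ultimately show ?thesis using mb z1(3) by (intro exI[of _ "Suc m"] exI[of _ b]) simp
  qed
qed

text \<open>Without its last letter p the element ends in s. A right descent q would survive the
  removal of p and stand beside s, against braid-freeness.\<close>

lemma rt_base_rd_last:
  assumes b: "braid_free (word_val (ws @ [gen_s, p]))" "len (word_val (ws @ [gen_s, p])) = length ws + 2"
    and pq: "commuting_gens p q"
  shows "rd (word_val (ws @ [gen_s, p])) = {p}"
proof -
  let ?b = "word_val (ws @ [gen_s, p])" and ?c = "word_val (ws @ [gen_s])"
  have c: "?b * sref p = ?c" by (simp add: mult.assoc)
  have "len ?c < len ?b" using b(2) len_le_length[of "ws @ [gen_s]"] by simp
  then have p: "p \<in> rd ?b" unfolding rd_def mem_Collect_eq c .
  have red: "reduced (ws @ [gen_s, p])" using b(2) by (simp add: reduced_def)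
  have "gen_s \<in> rd ?c"
  proof -
    have "reduced ((ws @ [gen_s]) @ [p])" using red by simp
    then have "reduced (ws @ [gen_s])" unfolding reduced_append_iff by blast
    then have "len ?c = length ws + 1" by (simp add: reduced_def)
    moreover have "?c * sref gen_s = word_val ws" by (simp add: mult.assoc)
    ultimately show ?thesis using len_le_length[of ws] by (simp add: rd_def)
  qed
  moreover have "braid_free ?c"
  proof -
    have "braid_free (winv ?b)" "p \<in> ld (winv ?b)"
      using b(1) p by (simp_all only: braid_free_winv rd_eq_ld_winv)
    from braid_free_sref_mult[OF this] show ?thesis
      by (metis braid_free_winv c winv_mult winv_sref)
  qed
  ultimately have "q \<notin> rd ?c" using braid_free_rd[of ?c gen_s q] commuting_gensD(6)[OF pq] by blast
  moreover have "q \<in> rd ?c" if "q \<in> rd ?b"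
  proof -
    have "q \<in> ld (sref p * winv ?b)"
      using two_descents[of p "winv ?b" q] p that commuting_gensD(2)[OF pq] by (simp only: rd_eq_ld_winv) blast
    then show ?thesis by (metis rd_eq_ld_winv c winv_mult winv_sref)
  qed
  moreover have "gen_s \<notin> rd ?b" using braid_free_rd[OF b(1) p] commuting_gensD(3)[OF pq] by blast
  ultimately show ?thesis using p commuting_gensD(7)[OF pq] by blast
qed

lemma rt_base_rd_inj:
  assumes "rt_base b" "rt_base c" "rd b = rd c" shows "b = c"
proof -
  have rd: "b = word_val [gen_r, gen_t] \<and> {gen_r, gen_t} \<subseteq> rd b \<or>
      b = word_val [gen_r, gen_t, gen_s] \<and> gen_s \<in> rd b \<and> gen_r \<notin> rd b \<or>
      b = word_val [gen_r, gen_t, gen_s, gen_r] \<and> rd b = {gen_r} \<or>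
      b = word_val [gen_r, gen_t, gen_s, gen_t] \<and> rd b = {gen_t}" if b: "rt_base b" for b
  proof -
    have fc: "braid_free b" using b by (simp add: rt_base_def)
    consider "b = word_val [gen_r, gen_t]" "len b = 2" | "b = word_val [gen_r, gen_t, gen_s]" "len b = 3"
      | "b = word_val [gen_r, gen_t, gen_s, gen_r]" "len b = 4"
      | "b = word_val [gen_r, gen_t, gen_s, gen_t]" "len b = 4"
      using b unfolding rt_base_def by blast
    then show ?thesis
    proof cases
      case 1
      have "b * sref gen_t = sref gen_r" "b * sref gen_r = sref gen_t"
        using 1 sref_r_t by (simp_all add: mult.assoc)
      then show ?thesis using 1 by (simp add: rd_def)
    next
      case 2
      have "b * sref gen_s = word_val [gen_r, gen_t]" using 2 by (simp add: mult.assoc)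
      then have "gen_s \<in> rd b" using 2(2) len_le_length[of "[gen_r, gen_t]"] by (simp add: rd_def)
      then show ?thesis using 2(1) braid_free_rd[OF fc, of gen_s gen_r] by auto
    next
      case 3
      then show ?thesis
        using rt_base_rd_last[of "[gen_r, gen_t]" gen_r gen_t] fc commuting_r_t by simp
    next
      case 4
      then show ?thesis
        using rt_base_rd_last[of "[gen_r, gen_t]" gen_t gen_r] fc commuting_r_t by simp
    qed
  qed
  have s: "gen_s \<notin> rd b" if "rt_base b" "{gen_r, gen_t} \<subseteq> rd b" for b
    using braid_free_rd[of b gen_s gen_r] that by (auto simp: rt_base_def)
  show ?thesis using rd[OF assms(1)] rd[OF assms(2)] s[OF assms(1)] s[OF assms(2)] assms(3) by auto
qed

lemma rt_start_rd_cell: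
  assumes "rt_start x" "rt_start y" "rd x = rd y" shows "x \<sim>\<^sub>L y"
proof -
  obtain b c where "rt_base b" "x \<sim>\<^sub>L b" "rt_base c" "y \<sim>\<^sub>L c"
    using rt_start_normal_form assms(1,2) by metis
  moreover from this have "b = c" using rt_base_rd_inj cell_eq_L_rd assms(3) by metis
  ultimately show ?thesis using cell_eq_L_sym cell_eq_L_trans by blast
qed

text \<open>A braid-free element with two first letters starts with rt. Otherwise its only first
  letter is removed, and the rest still has several reduced words. In front of p s y no letter fits:
  p would cancel, q would commute with p and make p a second first letter, and s would produce s p s
  p, as y starts with p.\<close>

lemma braid_free_decompose:
  assumes "braid_free z" "\<not> unique_word z"
  obtains y where "rt_start y" "z = y" | y where "rt_start y" "z = sref gen_s * y"
    | p q y where "commuting_gens p q" "rt_start y" "z = sref p * (sref gen_s * y)"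
proof -
  have "\<exists>y. rt_start y \<and> (z = y \<or> z = sref gen_s * y \<or>
      (\<exists>p q. commuting_gens p q \<and> z = sref p * (sref gen_s * y)))"
    using assms
  proof (induction "len z" arbitrary: z rule: less_induct)
    case less
    have "z \<noteq> 1" using less.prems(2) by auto
    then obtain g where g: "g \<in> ld z" using ld_empty_iff by blast
    define x where "x = sref g * z"
    have x: "z = sref g * x" "len z = 1 + len x" "g \<notin> ld x" "braid_free x"
      using g less.prems(1) braid_free_sref_mult by (auto simp: x_def ld_iff(1) ld_sref_iff)
    show ?case
    proof (cases "rt_start z")
      case True
      then show ?thesis by blast
    next
      case False
      have "h = g" if "h \<in> ld z" for h
        using gen_pair_cases[of g h] braid_free_ld[OF less.prems(1) g that] g that False less.prems(1)
        by (auto simp: rt_start_def doubleton_eq_iff)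
      then have ldz: "ld z \<subseteq> {g}" by blast
      then have "\<not> unique_word x" using unique_wordI[of g z] less.prems(2) by (auto simp: x_def)
      then obtain y where y: "rt_start y" "x = y \<or> x = sref gen_s * y \<or>
          (\<exists>p q. commuting_gens p q \<and> x = sref p * (sref gen_s * y))"
        using less.hyps[of x] x by auto
      note g_cases = commuting_gensD(7)[OF commuting_r_t(1), of g]
      from y(2) consider "x = y" | "x = sref gen_s * y"
        | p q where "commuting_gens p q" "x = sref p * (sref gen_s * y)" by blast
      then show ?thesis
      proof cases
        case 1
        then have "g = gen_s" using x(3) y(1) g_cases by (auto simp: rt_start_def)
        then show ?thesis using x(1) 1 y(1) by blast
      next
        case 2
        then have "g \<noteq> gen_s" using x(3) rt_start_s[OF y(1)] by (auto simp: ld_sref_iff)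
        then have "\<exists>q. commuting_gens g q" using g_cases commuting_r_t by blast
        then show ?thesis using x(1) 2 y(1) by blast
      next
        case (3 p q)
        note pq = commuting_gensD[OF 3(1)]
        have up: "p \<notin> ld (sref gen_s * y)" "gen_s \<notin> ld y"
          using rt_start_s_mult[OF y(1) 3(1)] rt_start_s[OF y(1)] by auto
        have "g \<noteq> p" using x(3) up by (auto simp: 3(2) ld_sref_iff)
        moreover have "g \<noteq> q"
        proof
          assume "g = q"
          have "sref p * z = sref q * (sref gen_s * y)"
            by (simp add: x(1) 3(2) \<open>g = q\<close> flip: pq(1))
          then have "len (sref p * z) \<le> 1 + len (sref gen_s * y)"
            using len_mult_le[of "sref q" "sref gen_s * y"] by simp
          moreover have "len z = 2 + len (sref gen_s * y)" using x(2) up(1) by (simp add: 3(2) len_not_ld)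
          ultimately have "p \<in> ld z" by (simp add: ld_def)
          then show False using ldz \<open>g = q\<close> pq(2) by blast
        qed
        moreover have "g \<noteq> gen_s"
        proof
          assume "g = gen_s"
          define y' where "y' = sref p * y"
          have y': "y = sref p * y'" "len y = 1 + len y'"
            using rt_startD(2)[OF y(1) 3(1)] by (simp_all add: y'_def ld_iff(1))
          have "len z = 3 + len y" using x(2) up by (simp add: 3(2) len_not_ld)
          then have "z = 1 * (sref gen_s * (sref p * (sref gen_s * (sref p * y'))))" "len z = len 1 + 4 + len y'"
            using x(1) 3(2) \<open>g = gen_s\<close> y' by simp_all
          then show False using less.prems(1) pq(4) unfolding braid_free_def by blast
        qed
        ultimately show ?thesis using pq(7)[of g] by blast
      qed
    qed
  qed
  then show thesis using that by blast
qed

text \<open>Prefixing s destroys the descent r, and prefixing p destroys the descent s, so both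
  steps stay in the left cell.\<close>

lemma rt_start_prefix_cell:
  assumes y: "rt_start y"
  shows "sref gen_s * y \<sim>\<^sub>L y" and "commuting_gens p q \<Longrightarrow> sref p * (sref gen_s * y) \<sim>\<^sub>L y"
proof -
  have r: "gen_r \<notin> ld (sref gen_s * y)" by (rule rt_start_s_mult[OF y commuting_r_t(1)])
  then have "\<not> ld y \<subseteq> ld (sref gen_s * y)" using y by (auto simp: rt_start_def)
  with rt_start_s[OF y] show sy: "sref gen_s * y \<sim>\<^sub>L y" by (rule sref_mult_eq_L)
  assume pq: "commuting_gens p q"
  have "gen_s \<in> ld (sref gen_s * y)" using rt_start_s[OF y] by (simp add: ld_sref_iff)
  then have "\<not> ld (sref gen_s * y) \<subseteq> ld (sref p * (sref gen_s * y))"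
    using rt_start_ps_mult(1)[OF y pq] by blast
  with rt_start_s_mult[OF y pq] have "sref p * (sref gen_s * y) \<sim>\<^sub>L sref gen_s * y" by (rule sref_mult_eq_L)
  then show "sref p * (sref gen_s * y) \<sim>\<^sub>L y" using sy by (rule cell_eq_L_trans)
qed

lemma braid_free_rd_cell:
  assumes "braid_free u" "\<not> unique_word u" "braid_free w" "\<not> unique_word w" "rd u = rd w"
  shows "u \<sim>\<^sub>L w"
proof -
  have "\<exists>y. rt_start y \<and> z \<sim>\<^sub>L y" if "braid_free z" "\<not> unique_word z" for z
    using braid_free_decompose[OF that] rt_start_prefix_cell cell_eq_L_refl by metis
  then obtain x y where xy: "rt_start x" "u \<sim>\<^sub>L x" "rt_start y" "w \<sim>\<^sub>L y" using assms by metis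
  then have "rd x = rd y" using cell_eq_L_rd assms(5) by metis
  then have "x \<sim>\<^sub>L y" using rt_start_rd_cell xy by blast
  then show ?thesis using xy cell_eq_L_sym cell_eq_L_trans by blast
qed


section \<open>The values of the \<open>\<mu>\<close>-function\<close>

text \<open>A length difference of 1 already forces w = u g: the lifting property gives u g \<le> w,
  and the lengths agree.\<close>

lemma mu_rd_not_subset:
  assumes "u \<le>\<^sub>B w" "\<not> rd w \<subseteq> rd u"
  shows "mu u w = (if len w - len u = 1 then 1 else 0)"
proof -
  obtain g where g: "g \<in> rd w" "g \<notin> rd u" using assms(2) by blast
  have "u * sref g = w \<longleftrightarrow> len w - len u = 1"
  proof
    assume "u * sref g = w"
    then show "len w - len u = 1" using g(2) by (auto simp: len_not_rd)
  next
    assume diff: "len w - len u = 1"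
    have "sref g * winv u \<le>\<^sub>B winv w"
      by (rule bruhat_lift_down) (use assms(1) g(1) bruhat_le_winv in \<open>auto simp: rd_eq_ld_winv ld_def\<close>)
    then have "u * sref g \<le>\<^sub>B w" using bruhat_le_winv[of "sref g * winv u" "winv w"] by simp
    then show "u * sref g = w" using bruhat_le_len[of "u * sref g" w] diff g(2) by (auto simp: len_not_rd)
  qed
  then show ?thesis using mu_rd[OF g] by simp
qed

lemma mu_rd_subset:
  assumes u: "braid_free u" and w: "braid_free w"
    and le: "u \<le>\<^sub>B w" and R: "u \<sim>\<^sub>R w" and L: "\<not> u \<sim>\<^sub>L w" and rd: "rd w \<subseteq> rd u"
  shows "mu u w = (if len w - len u = 5 then 1 else 0)"
proof -
  have w1: "w \<noteq> 1"
  proof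
    assume "w = 1"
    then have "u = w" using bruhat_le_len[OF le] by auto
    then show False using L by simp
  qed
  have u1: "u \<noteq> 1"
  proof
    assume "u = 1"
    then have "ld w = {}" using cell_eq_R_ld[OF R] by simp
    then show False using w1 ld_empty_iff by simp
  qed
  \<comment> \<open>The right cell puts u and w in the same class, unique reduced word or not; equal
    right descents would then put them in one left cell.\<close>
  have ne: "rd w \<noteq> rd u"
    using unique_word_rd_cell[of u w] braid_free_rd_cell[of u w] cell_eq_R_unique_word[OF R] u w u1 w1 L
    by metis
  have "rd w \<noteq> {}" using w1 ld_empty_iff[of "winv w"] by (simp add: rd_eq_ld_winv)
  then obtain p where p: "p \<in> rd w" by blast
  obtain q where q: "q \<in> rd u" "q \<notin> rd w" using ne rd by blast
  have pu: "p \<in> rd u" using p rd by blast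
  have "p \<noteq> q" using p q by blast
  \<comment> \<open>Two right descents of the braid-free u cannot include s.\<close>
  then have pq: "commuting_gens p q"
    using gen_pair_cases[of p q] braid_free_rd[OF u pu q(1)]
    by (auto simp: commuting_gens_def doubleton_eq_iff)
  define U where "U = winv u"
  define V where "V = winv w"
  have U: "rt_start U"
    using u pu q(1) pq by (auto simp: U_def rt_start_def braid_free_winv rd_eq_ld_winv commuting_gens_def)
  have Vp: "p \<in> ld V" "q \<notin> ld V" "gen_s \<notin> ld V"
    using p q(2) braid_free_rd[OF w p, of gen_s] commuting_gensD(3)[OF pq]
    by (auto simp: V_def rd_eq_ld_winv)
  have nuV: "\<not> unique_word V"
  proof -
    have "\<not> unique_word u" using unique_word_rd[of u p q] pu q(1) \<open>p \<noteq> q\<close> by blast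
    then show ?thesis using cell_eq_R_unique_word[OF R] by (simp add: V_def unique_word_winv)
  qed
  have "braid_free V" using w by (simp add: V_def braid_free_winv)
  \<comment> \<open>The left descents of V are p alone, which excludes the shapes y and s y.\<close>
  from this nuV have "\<exists>Y. rt_start Y \<and> V = sref p * (sref gen_s * Y)"
  proof (cases rule: braid_free_decompose)
    case (1 y)
    then show ?thesis using Vp pq by (auto simp: rt_start_def commuting_gens_def)
  next
    case (2 y)
    then show ?thesis using Vp rt_start_s[of y] by (auto simp: ld_sref_iff)
  next
    case (3 p' q' y)
    have "p' \<in> ld V" unfolding 3(3) ld_sref_iff by (rule rt_start_s_mult[OF 3(2,1)])
    then have "p' = p" using Vp commuting_gensD(7)[OF pq] by metis
    then show ?thesis using 3 by blast
  qed
  then obtain Y where Y: "rt_start Y" "V = sref p * (sref gen_s * Y)" by blast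
  have lenV: "len V = 2 + len Y"
    using rt_start_s[OF Y(1)] rt_start_s_mult[OF Y(1) pq] by (simp add: Y(2) len_not_ld)
  have pp: "p \<notin> ld (sref p * x)" if "rt_start x" for x
    using rt_startD(2)[OF that pq] by (simp add: ld_sref_iff)
  have "mu u w = mu U V" by (simp add: U_def V_def)
  \<comment> \<open>This is \<open>mu_star\<close> with a = p U and b = p Y, which have neither p
    nor s as left descents.\<close>
  also have "\<dots> = mu (sref p * (sref gen_s * U)) Y"
    using mu_star[OF commuting_gensD(3)[OF pq] pp[OF U] rt_start_sref_mult_s[OF U pq]
        pp[OF Y(1)] rt_start_sref_mult_s[OF Y(1) pq]]
    by (simp add: Y(2))
  also have "\<dots> = (if sref q * (sref p * (sref gen_s * U)) = Y then 1 else 0)"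
    by (rule mu_ld) (use rt_startD(3)[OF Y(1) pq] rt_start_ps_mult(2)[OF U pq] in auto)
  also have "sref q * (sref p * (sref gen_s * U)) = word_val [gen_r, gen_t, gen_s] * U"
    using pq commuting_gensD(1)[OF pq, of "sref gen_s * U"] by (auto simp: commuting_gens_def mult.assoc)
  \<comment> \<open>U and Y have the same right descents, hence the same base b, so lengths
    determine the exponents: 2 + 3n - 3m = 5 exactly for n = m + 1.\<close>
  also have "word_val [gen_r, gen_t, gen_s] * U = Y \<longleftrightarrow> len w - len u = 5"
  proof -
    obtain m b where m: "rt_base b" "U = word_val [gen_r, gen_t, gen_s] ^ m * b" "len U = 3 * m + len b" "U \<sim>\<^sub>L b"
      using rt_start_normal_form[OF U] by blast
    obtain n c where n: "rt_base c" "Y = word_val [gen_r, gen_t, gen_s] ^ n * c" "len Y = 3 * n + len c" "Y \<sim>\<^sub>L c"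
      using rt_start_normal_form[OF Y(1)] by blast
    have "rd U = rd V" using cell_eq_R_ld[OF R] by (simp add: U_def V_def rd_eq_ld_winv)
    also have "\<dots> = rd Y" using cell_eq_L_rd[OF rt_start_prefix_cell(2)[OF Y(1) pq]] by (simp add: Y(2))
    finally have bc: "b = c" using rt_base_rd_inj m n cell_eq_L_rd by metis
    have lens: "len w = 2 + (3 * n + len b)" "len u = 3 * m + len b"
      using lenV m(3) n(3) bc by (simp_all add: U_def V_def)
    show ?thesis
    proof
      assume "word_val [gen_r, gen_t, gen_s] * U = Y"
      then have Y_eq: "sref q * (sref p * (sref gen_s * U)) = Y"
        using pq commuting_gensD(1)[OF pq, of "sref gen_s * U"] by (auto simp: commuting_gens_def mult.assoc)
      have "len Y = 3 + len U"
        using rt_start_s[OF U] rt_start_s_mult[OF U pq] rt_start_ps_mult(2)[OF U pq]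
        by (simp add: len_not_ld flip: Y_eq)
      then show "len w - len u = 5" using lenV by (simp add: U_def V_def)
    next
      assume "len w - len u = 5"
      then have "n = Suc m" using lens by linarith
      then show "word_val [gen_r, gen_t, gen_s] * U = Y" using m n bc by (simp add: mult.assoc)
    qed
  qed
  finally show ?thesis .
qed

section \<open>A lower bound for the a-function\<close>

text \<open>At a longest index x no other C_w in the sum has x in its support, and C_x has the
  coefficient 1 there.\<close>

lemma ncoeff_hlin_kl_basis:
  assumes "\<And>w. w \<in> Poly_Mapping.keys c \<Longrightarrow> len w \<le> len x"
  shows "ncoeff (hlin kl_basis c) x = Poly_Mapping.lookup c x"
proof -
  have "ncoeff (hlin kl_basis c) x = (\<Sum>w\<in>Poly_Mapping.keys c. Poly_Mapping.lookup c w * kl_coeff x w)"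
    by (simp add: hlin_def ncoeff_sum kl_coeff_def)
  also have "\<dots> = (\<Sum>w\<in>Poly_Mapping.keys c. if w = x then Poly_Mapping.lookup c w else 0)"
  proof (rule sum.cong)
    fix w assume "w \<in> Poly_Mapping.keys c"
    then have "kl_coeff x w = 0" if "w \<noteq> x"
      using assms[of w] that bruhat_le_len[of x w] by (intro kl_coeff_not_le) auto
    then show "Poly_Mapping.lookup c w * kl_coeff x w = (if w = x then Poly_Mapping.lookup c w else 0)"
      by auto
  qed simp
  also have "\<dots> = Poly_Mapping.lookup c x" by (simp add: in_keys_iff)
  finally show ?thesis .
qed

lemma len_bounded_hlin_kl_basis:
  assumes "len_bounded n (hlin kl_basis c)" "w \<in> Poly_Mapping.keys c" shows "len w \<le> n"
proof -
  have "c \<noteq> 0" using assms(2) by auto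
  then obtain x where x: "x \<in> Poly_Mapping.keys c" "\<And>w. w \<in> Poly_Mapping.keys c \<Longrightarrow> len w \<le> len x"
    by (rule ex_longest_key) (rule that)
  have "ncoeff (hlin kl_basis c) x \<noteq> 0"
    using x(1) ncoeff_hlin_kl_basis[OF x(2), of c] by (simp add: in_keys_iff)
  then have "len x \<le> n" using assms(1) by (force simp: ncoeff_eq_0_iff len_bounded_def not_le)
  then show ?thesis using x(2)[OF assms(2)] by simp
qed

lemma hlin_kl_basis_inj:
  assumes "hlin kl_basis c = hlin kl_basis d" shows "c = d"
proof (rule ccontr)
  assume "c \<noteq> d"
  then have "c - d \<noteq> 0" by simp
  then obtain x where x: "x \<in> Poly_Mapping.keys (c - d)"
    "\<And>w. w \<in> Poly_Mapping.keys (c - d) \<Longrightarrow> len w \<le> len x"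
    by (rule ex_longest_key) (rule that)
  have "ncoeff (hlin kl_basis (c - d)) x = 0"
    using assms by (simp add: hlinear_diff[OF hlinear_hlin])
  then show False using x(1) ncoeff_hlin_kl_basis[OF x(2), of "c - d"] by (simp add: in_keys_iff)
qed

lemma hecke_eq_sum_basis: "h = (\<Sum>w\<in>Poly_Mapping.keys h. hscale (Poly_Mapping.lookup h w) (T_basis w))"
  by (rule poly_mapping_eqI) (simp add: lookup_sum lookup_single when_def in_keys_iff
      if_distrib[where f = "(*) _"] cong: if_cong)

lemma hscale_minus_one: "hscale (- 1) h = - h"
  by (rule poly_mapping_eqI) simp

text \<open>The C_w are triangular in the T_w with invertible diagonal v^(-l(w)). With injectivity,
  this gives the unique expansion that \<open>struct_const\<close> describes.\<close>

lemma hlin_kl_basis_surj: "\<exists>c. h = hlin kl_basis c"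
proof -
  define S where "S = range (hlin kl_basis)"
  have S_zero: "0 \<in> S" using hlinear_zero[OF hlinear_hlin, of kl_basis] unfolding S_def by (metis rangeI)
  have S_add: "a + b \<in> S" if "a \<in> S" "b \<in> S" for a b
    using that by (auto simp: S_def simp flip: hlinear_add[OF hlinear_hlin])
  have S_scale: "hscale k a \<in> S" if "a \<in> S" for a k
    using that by (auto simp: S_def simp flip: hlinear_scale[OF hlinear_hlin])
  have S_sum: "(\<Sum>i\<in>A. f i) \<in> S" if "\<And>i. i \<in> A \<Longrightarrow> f i \<in> S" for A and f :: "W \<Rightarrow> hecke"
    using that by (induction A rule: infinite_finite_induct) (auto intro: S_zero S_add)
  have S_basis: "T_basis w \<in> S" for w
  proof (induction "len w" arbitrary: w rule: less_induct)
    case less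
    let ?K = "Poly_Mapping.keys (kl_basis w)"
    let ?t = "\<lambda>x. hscale (Poly_Mapping.lookup (kl_basis w) x) (T_basis x)"
    have "ncoeff (kl_basis w) w = 1" using kl_coeff_self[of w] unfolding kl_coeff_def .
    then have lw: "Poly_Mapping.lookup (kl_basis w) w = vpow (- int (len w))"
      by (simp add: lookup_eq_ncoeff)
    have wK: "w \<in> ?K" unfolding in_keys_iff lw by simp
    have "?t x \<in> S" if "x \<in> ?K - {w}" for x
    proof (rule S_scale, rule less)
      have "kl_coeff x w \<noteq> 0" using that by (simp add: kl_coeff_def ncoeff_eq_0_iff in_keys_iff)
      then show "len x < len w" using kl_coeff_not_le bruhat_le_len that by blast
    qed
    define R where "R = (\<Sum>x\<in>?K - {w}. ?t x)"
    have rest: "R \<in> S" unfolding R_def by (rule S_sum) (rule \<open>\<And>x. x \<in> ?K - {w} \<Longrightarrow> ?t x \<in> S\<close>)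
    have "kl_basis w = (\<Sum>x\<in>?K. ?t x)" by (rule hecke_eq_sum_basis)
    also have "\<dots> = hscale (vpow (- int (len w))) (T_basis w) + R"
      by (simp only: sum.remove[OF finite_keys wK] lw R_def)
    finally have "hscale (vpow (- int (len w))) (T_basis w) = kl_basis w + hscale (- 1) R"
      by (simp add: hscale_minus_one)
    moreover have "kl_basis w \<in> S" unfolding S_def by (rule range_eqI[of _ _ "T_basis w"]) simp
    ultimately have "hscale (vpow (int (len w))) (hscale (vpow (- int (len w))) (T_basis w)) \<in> S"
      using rest by (metis S_scale S_add)
    then show ?case by simp
  qed
  have "(\<Sum>w\<in>Poly_Mapping.keys h. hscale (Poly_Mapping.lookup h w) (T_basis w)) \<in> S"
    by (intro S_sum S_scale S_basis)
  then have "h \<in> S" by (simp only: hecke_eq_sum_basis[symmetric])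
  then show ?thesis by (auto simp: S_def)
qed

text \<open>No C_w with w longer than z occurs in the product, so the coefficient of C_z is visible
  as the normalised coefficient at z.\<close>

lemma struct_const_longest:
  assumes "len_bounded (len z) (kl_basis x \<odot> kl_basis y)"
  shows "struct_const x y z = ncoeff (kl_basis x \<odot> kl_basis y) z"
proof -
  obtain c where c: "kl_basis x \<odot> kl_basis y = hlin kl_basis c" using hlin_kl_basis_surj by blast
  have "(THE c. kl_basis x \<odot> kl_basis y = hlin kl_basis c) = c"
  proof (rule the_equality)
    fix d assume d: "kl_basis x \<odot> kl_basis y = hlin kl_basis d"
    show "d = c" by (rule hlin_kl_basis_inj[OF trans[OF d[symmetric] c]])
  qed (rule c)
  moreover have "ncoeff (hlin kl_basis c) z = Poly_Mapping.lookup c z"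
    by (rule ncoeff_hlin_kl_basis) (rule len_bounded_hlin_kl_basis, use assms c in auto)
  ultimately show ?thesis by (simp add: struct_const_def c)
qed

section \<open>Leading terms of products\<close>

lemma len_bounded_word_mult:
  assumes "len_bounded m k"
  shows "len_bounded (length ws + m) (word_mult ws k) \<and> (\<forall>x. len x = length ws + m \<longrightarrow>
    Poly_Mapping.lookup (word_mult ws k) x = Poly_Mapping.lookup k (winv (word_val ws) * x))"
proof (induction ws)
  case Nil
  then show ?case using assms by simp
next
  case (Cons g ws)
  let ?k = "word_mult ws k"
  have b: "len_bounded (length ws + m) ?k" using Cons by simp
  have "Poly_Mapping.lookup (gen_mult g ?k) x = Poly_Mapping.lookup k (winv (word_val ws) * (sref g * x))"
    if x: "len x = Suc (length ws + m)" for x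
  proof -
    have top: "Poly_Mapping.lookup (gen_mult g ?k) x = Poly_Mapping.lookup ?k (sref g * x)"
      using len_bounded_gen_mult(2)[OF b x] .
    show ?thesis
    proof (cases "len (sref g * x) = length ws + m")
      case True
      then show ?thesis using top Cons by simp
    next
      case False
      then have long: "length ws + m < len (sref g * x)" using x len_sref_cases[of g x] by linarith
      have "len (sref g * x) \<le> len (word_val ws) + len (winv (word_val ws) * (sref g * x))"
        using len_mult_le[of "word_val ws" "winv (word_val ws) * (sref g * x)"] by simp
      then have "m < len (winv (word_val ws) * (sref g * x))"
        using long len_le_length[of ws] by linarith
      then show ?thesis using top long len_boundedD[OF b] len_boundedD[OF assms] by simp
    qed
  qed
  then show ?case using len_bounded_gen_mult(1)[OF b, of g] by (simp add: mult.assoc)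
qed

text \<open>In top length the product behaves as in the group algebra: T_e T_f contributes only
  through T_(ef), with l(e) = n.\<close>

lemma len_bounded_hmult:
  assumes "len_bounded n h" "len_bounded m k"
  shows "len_bounded (n + m) (h \<odot> k)"
    and "len x = n + m \<Longrightarrow> Poly_Mapping.lookup (h \<odot> k) x = (\<Sum>e | e \<in> Poly_Mapping.keys h \<and> len e = n.
      Poly_Mapping.lookup h e * Poly_Mapping.lookup k (winv e * x))"
proof -
  have mult: "T_basis e \<odot> k = word_mult (reduced_word e) k" for e
    using hmult_basis[of "reduced_word e" k] by (simp add: reduced_word)
  have look: "Poly_Mapping.lookup (h \<odot> k) x = (\<Sum>e\<in>Poly_Mapping.keys h.
      Poly_Mapping.lookup h e * Poly_Mapping.lookup (word_mult (reduced_word e) k) x)" for x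
    by (simp add: hmult_def lookup_hlin word_mult_def)
  have le: "len e \<le> n" if "e \<in> Poly_Mapping.keys h" for e
    using that len_boundedD[OF assms(1), of e] by (force simp: in_keys_iff not_le)
  have zero: "Poly_Mapping.lookup (word_mult (reduced_word e) k) x = 0" if "len e + m < len x" for e x
    using len_bounded_word_mult[OF assms(2), of "reduced_word e"] that
    by (simp add: reduced_word len_bounded_def)
  show "len_bounded (n + m) (h \<odot> k)"
    unfolding len_bounded_def look using le zero
    by (intro allI impI sum.neutral ballI) (metis add_le_mono1 le_less_trans mult_zero_right)
  assume x: "len x = n + m"
  have "Poly_Mapping.lookup (h \<odot> k) x = (\<Sum>e\<in>Poly_Mapping.keys h.
      if len e = n then Poly_Mapping.lookup h e * Poly_Mapping.lookup k (winv e * x) else 0)"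
    unfolding look
  proof (rule sum.cong)
    fix e assume e: "e \<in> Poly_Mapping.keys h"
    show "Poly_Mapping.lookup h e * Poly_Mapping.lookup (word_mult (reduced_word e) k) x =
        (if len e = n then Poly_Mapping.lookup h e * Poly_Mapping.lookup k (winv e * x) else 0)"
      using le[OF e] zero[of e x] x len_bounded_word_mult[OF assms(2), of "reduced_word e"]
      by (auto simp: reduced_word)
  qed simp
  then show "Poly_Mapping.lookup (h \<odot> k) x = (\<Sum>e | e \<in> Poly_Mapping.keys h \<and> len e = n.
      Poly_Mapping.lookup h e * Poly_Mapping.lookup k (winv e * x))"
    by (simp add: sum.inter_filter)
qed

lemma len_bounded_kl_basis: "len_bounded (len w) (kl_basis w)"
  unfolding len_bounded_def
proof (intro allI impI)
  fix x assume "len w < len x"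
  then have "\<not> x \<le>\<^sub>B w" using bruhat_le_len[of x w] by auto
  then show "Poly_Mapping.lookup (kl_basis w) x = 0"
    using kl_coeff_not_le by (simp add: kl_coeff_def ncoeff_eq_0_iff)
qed

text \<open>Only e with l(e) = l(a) matter. Then e^-1 a y is at least as long as y, so it lies in
  the support of C_y only if it equals y, that is, e = a.\<close>

lemma ncoeff_hmult_kl_basis:
  assumes "len_bounded (len a) h" "len (a * y) = len a + len y"
  shows "ncoeff (h \<odot> kl_basis y) (a * y) = ncoeff h a"
proof -
  let ?K = "{e. e \<in> Poly_Mapping.keys h \<and> len e = len a}"
  have "Poly_Mapping.lookup (h \<odot> kl_basis y) (a * y) =
      (\<Sum>e\<in>?K. Poly_Mapping.lookup h e * Poly_Mapping.lookup (kl_basis y) (winv e * (a * y)))"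
    by (rule len_bounded_hmult(2)[OF assms(1) len_bounded_kl_basis assms(2)])
  also have "\<dots> = (\<Sum>e\<in>?K. if e = a then Poly_Mapping.lookup h e * Poly_Mapping.lookup (kl_basis y) y else 0)"
  proof (rule sum.cong)
    fix e assume e: "e \<in> ?K"
    have "Poly_Mapping.lookup (kl_basis y) (winv e * (a * y)) = 0" if "e \<noteq> a"
    proof -
      have "len y \<le> len (winv e * (a * y))"
        using len_mult_le[of e "winv e * (a * y)"] e assms(2) by simp
      moreover have "winv e * (a * y) \<noteq> y"
      proof
        assume "winv e * (a * y) = y"
        then have "(winv e * a) * y = 1 * y" by (simp add: mult.assoc)
        then have "winv e * a = 1" by (simp only: W_right_cancel)
        then show False using that by (metis winv_unique winv_winv)
      qed
      ultimately have "\<not> winv e * (a * y) \<le>\<^sub>B y" using bruhat_le_len by fastforce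
      then show ?thesis using kl_coeff_not_le by (simp add: kl_coeff_def ncoeff_eq_0_iff)
    qed
    then show "Poly_Mapping.lookup h e * Poly_Mapping.lookup (kl_basis y) (winv e * (a * y)) =
        (if e = a then Poly_Mapping.lookup h e * Poly_Mapping.lookup (kl_basis y) y else 0)"
      by auto
  qed simp
  also have "\<dots> = Poly_Mapping.lookup h a * Poly_Mapping.lookup (kl_basis y) y"
    by (simp add: in_keys_iff)
  also have "\<dots> = vpow (- int (len y)) * Poly_Mapping.lookup h a"
  proof -
    have "ncoeff (kl_basis y) y = 1" using kl_coeff_self[of y] unfolding kl_coeff_def .
    then show ?thesis by (simp add: lookup_eq_ncoeff[of "kl_basis y"] mult.commute)
  qed
  finally show ?thesis using assms(2) by (simp add: ncoeff_def)
qed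

section \<open>Structure constants at the longest element of a dihedral subgroup\<close>

abbreviation dihedral_longest :: "gen \<Rightarrow> gen \<Rightarrow> W" where
  "dihedral_longest g h \<equiv> sref g * (sref h * (sref g * sref h))"

lemma gen_kl_mult_hmult: "gen_kl_mult g h \<odot> k = gen_kl_mult g (h \<odot> k)"
  by (simp add: gen_kl_mult_def hmult_linear gen_mult_hmult)

lemma rd_mult_dihedral_longest:
  assumes "bond4 g h" "len (a * dihedral_longest g h) = len a + 4"
  shows "g \<in> rd (a * dihedral_longest g h)" "h \<in> rd (a * dihedral_longest g h)"
proof -
  have "len (a * (sref g * (sref h * sref g))) \<le> len a + 3"
    using len_mult_le[of a "sref g * (sref h * sref g)"] len_dihedral(2)[OF assms(1)] by simp
  then show "h \<in> rd (a * dihedral_longest g h)"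
    using assms(2) by (simp add: rd_def mult.assoc)
  have "a * dihedral_longest g h * sref g = a * (sref h * (sref g * sref h))"
    using braid[OF assms(1), of 1] by (simp add: mult.assoc)
  moreover have "len (a * (sref h * (sref g * sref h))) \<le> len a + 3"
    using len_mult_le[of a "sref h * (sref g * sref h)"] len_dihedral(2)[OF bond4_sym[OF assms(1)]] by simp
  ultimately show "g \<in> rd (a * dihedral_longest g h)"
    using assms(2) by (simp add: rd_def)
qed

lemma dihedral_factor_right:
  assumes "bond4 g h" "g \<in> rd x" "h \<in> rd x"
  obtains a where "x = a * dihedral_longest g h" "len x = len a + 4"
proof -
  obtain a where a: "winv x = sref g * (sref h * (sref g * (sref h * a)))" "len (winv x) = 4 + len a"
    using dihedral_factor[OF assms(1), of "winv x"] assms(2,3) unfolding rd_eq_ld_winv by blast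
  have len: "len x = len a + 4" using a(2) len_winv[of x] by linarith
  have "x = winv (sref g * (sref h * (sref g * (sref h * a))))" by (metis a(1) winv_winv)
  also have "\<dots> = winv a * dihedral_longest h g" by (simp add: mult.assoc)
  also have "dihedral_longest h g = dihedral_longest g h" using braid[OF assms(1), of 1] by simp
  finally show thesis using len by (intro that[of "winv a"]) simp_all
qed

text \<open>C_(a w0) lies in the left ideal generated by C_(w0), where w0 is
  \<open>dihedral_longest g h\<close>. In the induction the correction terms C_z of C_k C_x must lie
  there too: k is a left descent of z but not of x, so \<mu>(z, x) \<noteq> 0 passes every right
  descent of x on to z, whence z = c w0. The leading coefficient of E is carried along for the
  product computed later.\<close>

lemma kl_basis_factor:
  assumes gh: "bond4 g h" and "len (a * dihedral_longest g h) = len a + 4"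
  shows "\<exists>E. kl_basis (a * dihedral_longest g h) = E \<odot> kl_basis (dihedral_longest g h) \<and>
    len_bounded (len a) E \<and> ncoeff E a = 1"
  using assms(2)
proof (induction "len a" arbitrary: a rule: less_induct)
  case less
  let ?w = "dihedral_longest g h"
  show ?case
  proof (cases "a = 1")
    case True
    then show ?thesis
      by (intro exI[of _ "T_basis 1"]) (simp add: len_bounded_def lookup_single when_def ncoeff_basis)
  next
    case False
    then obtain k where k: "k \<in> ld a" using ld_empty_iff by blast
    define b where "b = sref k * a"
    let ?x = "b * ?w"
    let ?Z = "{z. z \<in> Poly_Mapping.keys (kl_basis ?x) \<and> len (sref k * z) < len z}"
    have a: "a = sref k * b" "len a = len b + 1" using k by (simp_all add: b_def len_ld)
    have len_le: "len (a * ?w) \<le> 1 + len ?x"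
      using len_mult_le[of "sref k" ?x] by (simp add: a(1) mult.assoc)
    have len_x: "len ?x = len b + 4"
      using len_mult_le[of b ?w] len_le less.prems a(2) len_braid[OF gh] by linarith
    have kx: "k \<notin> ld ?x"
      using less.prems a(2) len_x by (simp add: ld_def a(1) mult.assoc)
    have "\<exists>E. \<forall>c. len c < len a \<and> len (c * ?w) = len c + 4 \<longrightarrow>
        kl_basis (c * ?w) = E c \<odot> kl_basis ?w \<and> len_bounded (len c) (E c) \<and> ncoeff (E c) c = 1"
      by (rule choice) (use less.hyps in blast)
    then obtain E where E: "\<And>c. len c < len a \<Longrightarrow> len (c * ?w) = len c + 4 \<Longrightarrow>
        kl_basis (c * ?w) = E c \<odot> kl_basis ?w \<and> len_bounded (len c) (E c) \<and> ncoeff (E c) c = 1"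
      by blast
    have Eb: "kl_basis ?x = E b \<odot> kl_basis ?w" "len_bounded (len b) (E b)" "ncoeff (E b) b = 1"
      using E[of b] a(2) len_x by auto
    have Z: "\<exists>c. z = c * ?w \<and> len z = len c + 4 \<and> len c < len b" if "z \<in> ?Z" "mu z ?x \<noteq> 0" for z
    proof -
      have kz: "k \<in> ld z" using that(1) by (simp add: ld_def)
      have rd: "f \<in> rd z" if f: "f \<in> rd ?x" for f
      proof (rule ccontr)
        assume fz: "f \<notin> rd z"
        then have x: "?x = z * sref f" using mu_rd[OF f fz] \<open>mu z ?x \<noteq> 0\<close> by (auto split: if_splits)
        have "len (sref k * z * sref f) \<le> len (sref k * z) + 1"
          using len_mult_le[of "sref k * z" "sref f"] by simp
        also have "\<dots> = len z" using kz len_ld by simp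
        also have "\<dots> < len ?x" using fz by (simp add: x len_not_rd)
        finally show False using kx unfolding ld_def x by (simp add: mult.assoc)
      qed
      obtain c where c: "z = c * ?w" "len z = len c + 4"
        using dihedral_factor_right[OF gh] rd rd_mult_dihedral_longest[OF gh len_x] by blast
      then show ?thesis using mu_nonzeroD(3)[OF that(2)] len_x by auto
    qed
    define F where "F = gen_kl_mult k (E b) - (\<Sum>z\<in>?Z. hscale (of_int (mu z ?x)) (E (z * winv ?w)))"
    have Zw: "hscale (of_int (mu z ?x)) (E (z * winv ?w)) \<odot> kl_basis ?w = hscale (of_int (mu z ?x)) (kl_basis z)"
      "len_bounded (len b) (hscale (of_int (mu z ?x)) (E (z * winv ?w)))" if "z \<in> ?Z" for z
    proof -
      \<comment> \<open>Where \<mu> vanishes nothing is known about this value of E, but it is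
        scaled by 0.\<close>
      have "(E (z * winv ?w) \<odot> kl_basis ?w = kl_basis z \<and> len_bounded (len b) (E (z * winv ?w))) \<or> mu z ?x = 0"
      proof (cases "mu z ?x = 0")
        case False
        then obtain c where c: "z = c * ?w" "len z = len c + 4" "len c < len b" using Z \<open>z \<in> ?Z\<close> by blast
        have "z * winv ?w = c" unfolding c(1) by (simp only: mult.assoc winv_cancel(1) mult_1_right)
        then show ?thesis using E[of c] c a(2) by (auto intro: len_bounded_mono)
      qed simp
      then show "hscale (of_int (mu z ?x)) (E (z * winv ?w)) \<odot> kl_basis ?w = hscale (of_int (mu z ?x)) (kl_basis z)"
        "len_bounded (len b) (hscale (of_int (mu z ?x)) (E (z * winv ?w)))"
        by (auto simp: hmult_linear len_bounded_def)
    qed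
    have "kl_basis (a * ?w) = F \<odot> kl_basis ?w"
    proof -
      have "len ?x < len (sref k * ?x)" using len_not_ld[OF kx] by simp
      from gen_kl_mult_kl_basis_up[OF this]
      have "kl_basis (a * ?w) = gen_kl_mult k (kl_basis ?x) - (\<Sum>z\<in>?Z. hscale (of_int (mu z ?x)) (kl_basis z))"
        by (simp add: a(1) mult.assoc)
      also have "(\<Sum>z\<in>?Z. hscale (of_int (mu z ?x)) (kl_basis z)) =
          (\<Sum>z\<in>?Z. hscale (of_int (mu z ?x)) (E (z * winv ?w))) \<odot> kl_basis ?w"
        unfolding hlinear_sum[OF hlinear_hmult_left] by (rule sum.cong) (simp_all only: Zw)
      finally show ?thesis
        by (simp only: F_def hmult_linear(6) gen_kl_mult_hmult Eb(1))
    qed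
    moreover have "len_bounded (len a) F"
    proof -
      have "len_bounded (Suc (len b)) (gen_mult k (E b))" by (rule len_bounded_gen_mult(1)[OF Eb(2)])
      then show ?thesis
        using Eb(2) Zw(2) a(2)
        by (auto simp: F_def len_bounded_def gen_kl_mult_def lookup_minus lookup_add lookup_sum intro!: sum.neutral)
    qed
    moreover have "ncoeff F a = 1"
    proof -
      have "ncoeff (E b) a = 0" using len_boundedD[OF Eb(2), of a] a(2) by (simp add: ncoeff_eq_0_iff)
      moreover have "ncoeff (hscale (of_int (mu z ?x)) (E (z * winv ?w))) a = 0" if "z \<in> ?Z" for z
        using len_boundedD[OF Zw(2)[OF that], of a] a(2) unfolding ncoeff_eq_0_iff by simp
      ultimately show ?thesis
        using Eb(3)
        by (auto simp: F_def ncoeff_gen_kl_mult ncoeff_sum b_def[symmetric] intro!: sum.neutral)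
    qed
    ultimately show ?thesis by blast
  qed
qed

lemma parabolic_bruhat_le: "x \<le>\<^sub>B y \<Longrightarrow> y \<in> parabolic I \<Longrightarrow> x \<in> parabolic I"
proof (induction rule: bruhat_le_converse_induct)
  case (step x t)
  then obtain ws where ws: "set ws \<subseteq> I" "x * t = word_val ws" by (auto simp: parabolic_def)
  have x: "word_val ws * t = x" using step.hyps(2) by (simp add: mult.assoc flip: ws(2))
  then have "len (word_val ws * t) < len (word_val ws)" using step.hyps(3) ws(2) by simp
  then obtain xs g ys where "ws = xs @ g # ys" "word_val ws * t = word_val (xs @ ys)"
    using strong_exchange_right[OF step.hyps(2)] by blast
  then have "set (xs @ ys) \<subseteq> I" "x = word_val (xs @ ys)" using ws(1) x by auto
  then show ?case unfolding parabolic_def by blast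
qed simp

lemma gen_mult_kl_basis:
  assumes "g \<in> ld y" shows "gen_mult g (kl_basis y) = hscale qvar (kl_basis y)"
proof -
  have "gen_kl_mult g (kl_basis y) = hscale (vpow 1 + vpow (- 1)) (kl_basis y)"
    using assms by (intro gen_kl_mult_kl_basis_down) (simp add: ld_def)
  then have "hscale (vpow 1) (gen_kl_mult g (kl_basis y)) = hscale (vpow 1) (hscale (vpow 1 + vpow (- 1)) (kl_basis y))"
    by simp
  then show ?thesis by (simp add: gen_kl_mult_def distrib_left hscale_add_left)
qed

lemma parabolic_hmult_kl_basis:
  assumes gh: "bond4 g h" and ld: "g \<in> ld y" "h \<in> ld y" and i: "i \<in> parabolic {g, h}"
  shows "T_basis i \<odot> kl_basis y = hscale (vpow (2 * int (len i))) (kl_basis y)"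
proof -
  note lens = len_dihedral[OF gh] len_dihedral[OF bond4_sym[OF gh]] len_braid[OF gh]
  have word: "T_basis (word_val ws) \<odot> kl_basis y = hscale (vpow (2 * int (len (word_val ws)))) (kl_basis y)"
    if "reduced ws" "set ws \<subseteq> {g, h}" for ws
  proof -
    have "word_mult ws (kl_basis y) = hscale (vpow (2 * int (length ws))) (kl_basis y)"
      using that(2)
    proof (induction ws)
      case (Cons k ws)
      then have "k \<in> ld y" using ld by auto
      then show ?case using Cons
        by (simp add: hlinear_scale[OF hlinear_gen_mult] gen_mult_kl_basis algebra_simps)
    qed simp
    then show ?thesis using hmult_basis[OF that(1)] that(1) by (simp add: reduced_def)
  qed
  have "\<exists>ws. reduced ws \<and> set ws \<subseteq> {g, h} \<and> word_val ws = i"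
  proof -
    have "reduced []" "reduced [g]" "reduced [h]" "reduced [g, h]" "reduced [h, g]" "reduced [g, h, g]"
      "reduced [h, g, h]" "reduced [g, h, g, h]"
      using lens by (simp_all add: reduced_def)
    moreover have "i \<in> word_val ` {[], [g], [h], [g, h], [h, g], [g, h, g], [h, g, h], [g, h, g, h]}"
      using parabolic_dihedral[OF gh i] by simp
    ultimately show ?thesis by (elim imageE) auto
  qed
  then show ?thesis using word by blast
qed

text \<open>Each T_i with i in the dihedral group acts on C_y as q^(l(i)), so C_(w0) acts as the sum
  \<eta> of v^(l(i)) times normalised coefficients. These have no positive exponents, so v^4 comes
  from w0 alone, the only element of length 4.\<close>

lemma kl_basis_dihedral_longest_hmult:
  assumes gh: "bond4 g h" and ld: "g \<in> ld y" "h \<in> ld y"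
  shows "\<exists>\<eta>. kl_basis (dihedral_longest g h) \<odot> kl_basis y = hscale \<eta> (kl_basis y) \<and>
    Poly_Mapping.lookup \<eta> 4 = 1"
proof -
  let ?w = "dihedral_longest g h"
  let ?K = "Poly_Mapping.keys (kl_basis ?w)"
  define \<eta> where "\<eta> = (\<Sum>i\<in>?K. vpow (int (len i)) * kl_coeff i ?w)"
  have w: "?w \<in> parabolic {g, h}" by (intro parabolic_mult parabolic_sref) simp_all
  have K: "i \<in> parabolic {g, h}" if "i \<in> ?K" for i
  proof -
    have "kl_coeff i ?w \<noteq> 0" using that by (simp add: kl_coeff_def ncoeff_eq_0_iff in_keys_iff)
    then show ?thesis using kl_coeff_not_le parabolic_bruhat_le w by blast
  qed
  have "kl_basis ?w \<odot> kl_basis y =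
      (\<Sum>i\<in>?K. hscale (Poly_Mapping.lookup (kl_basis ?w) i) (T_basis i)) \<odot> kl_basis y"
    by (simp flip: hecke_eq_sum_basis)
  also have "\<dots> = (\<Sum>i\<in>?K. hscale (vpow (int (len i)) * kl_coeff i ?w) (kl_basis y))"
    unfolding hlinear_sum[OF hlinear_hmult_left]
    by (rule sum.cong)
      (simp_all add: hmult_linear parabolic_hmult_kl_basis[OF gh ld K] kl_coeff_def ncoeff_def mult.commute)
  also have "\<dots> = hscale \<eta> (kl_basis y)"
    by (rule poly_mapping_eqI) (simp add: \<eta>_def lookup_sum sum_distrib_right)
  finally have "kl_basis ?w \<odot> kl_basis y = hscale \<eta> (kl_basis y)" .
  moreover have "Poly_Mapping.lookup \<eta> 4 = 1"
  proof -
    note lens = len_dihedral[OF gh] len_dihedral[OF bond4_sym[OF gh]] len_braid[OF gh]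
    have "Poly_Mapping.lookup \<eta> 4 = (\<Sum>i\<in>?K. if i = ?w then 1 else 0)"
      unfolding \<eta>_def lookup_sum
    proof (rule sum.cong)
      fix i assume "i \<in> ?K"
      then have "len i < 4" if "i \<noteq> ?w" using parabolic_dihedral[OF gh K[of i]] lens that by auto
      then show "Poly_Mapping.lookup (vpow (int (len i)) * kl_coeff i ?w) 4 = (if i = ?w then 1 else 0)"
        using len_braid[OF gh] by (auto simp: kl_coeff_pos lookup_one)
    qed simp
    moreover have "kl_coeff ?w ?w \<noteq> 0" by simp
    then have "?w \<in> ?K" unfolding kl_coeff_def ncoeff_eq_0_iff in_keys_iff .
    ultimately show ?thesis by simp
  qed
  ultimately show ?thesis by blast
qed

text \<open>With C_(a w0) = E C_(w0) the product is \<eta> E C_(w0 b), whose normalised coefficient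
  at the longest possible element a w0 b is \<eta> times the coefficient 1 of E at a.\<close>

lemma struct_const_braid:
  assumes gh: "bond4 g h" and len_z: "len (a * (dihedral_longest g h * b)) = len a + 4 + len b"
  shows "Poly_Mapping.lookup (struct_const (a * dihedral_longest g h) (dihedral_longest g h * b)
    (a * (dihedral_longest g h * b))) 4 = 1"
proof -
  let ?w = "dihedral_longest g h"
  have lens: "len (a * ?w) = len a + 4" "len (?w * b) = 4 + len b"
    using len_mult_le[of "a * ?w" b] len_mult_le[of a "?w * b"] len_mult_le[of a ?w] len_mult_le[of ?w b]
      len_braid[OF gh] len_z by (simp_all add: mult.assoc)
  obtain E where E: "kl_basis (a * ?w) = E \<odot> kl_basis ?w" "len_bounded (len a) E" "ncoeff E a = 1"
    using kl_basis_factor[OF gh lens(1)] by blast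
  have "len (winv b * dihedral_longest h g) = len (winv b) + 4"
    using lens(2) len_winv[of "?w * b"] braid[OF gh, of 1] by (simp add: mult.assoc)
  from rd_mult_dihedral_longest[OF bond4_sym[OF gh] this] have ld: "g \<in> ld (?w * b)" "h \<in> ld (?w * b)"
    by (simp_all add: rd_eq_ld_winv mult.assoc)
  obtain \<eta> where \<eta>: "kl_basis ?w \<odot> kl_basis (?w * b) = hscale \<eta> (kl_basis (?w * b))"
    "Poly_Mapping.lookup \<eta> 4 = 1" using kl_basis_dihedral_longest_hmult[OF gh ld] by blast
  have prod: "kl_basis (a * ?w) \<odot> kl_basis (?w * b) = hscale \<eta> (E \<odot> kl_basis (?w * b))"
    by (simp only: E(1) hmult_assoc \<eta>(1) hmult_linear)
  have sum: "len (a * (?w * b)) = len a + len (?w * b)" using len_z lens by simp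
  have "len_bounded (len (a * (?w * b))) (E \<odot> kl_basis (?w * b))"
    unfolding sum by (rule len_bounded_hmult(1)[OF E(2) len_bounded_kl_basis])
  then have "len_bounded (len (a * (?w * b))) (kl_basis (a * ?w) \<odot> kl_basis (?w * b))"
    unfolding prod by (simp add: len_bounded_def)
  from struct_const_longest[OF this] have "struct_const (a * ?w) (?w * b) (a * (?w * b)) = \<eta>"
    using ncoeff_hmult_kl_basis[OF E(2) sum] E(3) by (simp only: prod ncoeff_scale) simp
  then show ?thesis using \<eta>(2) by simp
qed

text \<open>A finite infimum belongs to a nonempty set, where it is the least element.\<close>

lemma Inf_enat_image_eqD:
  assumes "Inf (enat ` A) = enat n" shows "n \<in> A"
proof -
  have "A \<noteq> {}" using assms by (auto simp: top_enat_def)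
  then obtain i where "enat i \<in> enat ` A" by blast
  then have "(LEAST x. x \<in> enat ` A) \<in> enat ` A" by (rule LeastI)
  then have "enat n \<in> enat ` A" using assms \<open>A \<noteq> {}\<close> by (simp add: Inf_enat_def)
  then show ?thesis by auto
qed

lemma c2_braid_free:
  assumes "z \<in> c2" shows "braid_free z"
  unfolding braid_free_def
proof
  assume "\<exists>a g h b. bond4 g h \<and> z = a * (sref g * (sref h * (sref g * (sref h * b)))) \<and> len z = len a + 4 + len b"
  then obtain a g h b where gh: "bond4 g h" and z: "z = a * (dihedral_longest g h * b)" "len z = len a + 4 + len b"
    by (auto simp: mult.assoc)
  have four: "Poly_Mapping.lookup (struct_const (a * dihedral_longest g h) (dihedral_longest g h * b) z) 4 = 1"
    using struct_const_braid[OF gh] z by simp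
  have "Inf (enat ` {i. \<forall>x y. \<forall>k\<in>Poly_Mapping.keys (struct_const x y z). k \<le> int i}) = enat 2"
    using assms by (simp add: c2_def a_fun_def numeral_eq_enat)
  from Inf_enat_image_eqD[OF this]
  have le: "k \<le> 2" if "k \<in> Poly_Mapping.keys (struct_const x y z)" for x y k
    using that by auto
  have "4 \<in> Poly_Mapping.keys (struct_const (a * dihedral_longest g h) (dihedral_longest g h * b) z)"
    using four by (simp add: in_keys_iff)
  from le[OF this] show False by simp
qed

theorem theorem5p9:
  fixes u w :: W
  assumes "u \<in> c2" and "w \<in> c2"
    and "u \<le>\<^sub>B w" and "u \<sim>\<^sub>R w" and "\<not> u \<sim>\<^sub>L w"
  shows "(\<not> right_descents w \<subseteq> right_descents u \<longrightarrow>
            mu u w = (if len w - len u = 1 then 1 else 0)) \<and>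
         (right_descents w \<subseteq> right_descents u \<longrightarrow>
            mu u w = (if len w - len u = 5 then 1 else 0))"
  using mu_rd_not_subset[OF assms(3)] mu_rd_subset[OF c2_braid_free c2_braid_free, OF assms]
  by (simp add: right_descents_subset)

end
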